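(* Let $\mathcal{K}$ be a category and $\mu$ a regular cardinal. The following are equivalent: (1) $\mathcal{K}$ is locally $\mu$-polypresentable and all its morphisms are monomorphisms; (2) $\mathcal{K}$ is equivalent to a $\mu$-AEC which admits intersections.
   Context: An abstract class is a pair $\mathbf{K}=(K,\le_{\mathbf{K}})$ where $K$ is a class of structures in a fixed vocabulary $\tau(\mathbf{K})$ with symbols of arity $<\mu$, closed under isomorphism, and $\le_{\mathbf{K}}$ is a partial order respecting isomorphisms and extending the substructure relation; it is a category whose morphisms are $\mathbf{K}$-embeddings, i.e. maps $f:M\to N$ that are isomorphisms onto $f[M]$ with $f[M]\le_{\mathbf{K}}N$. A $\mu$-AEC is an abstract class satisfying: (Coherence) $M_0\subseteq M_1\le_{\mathbf{K}} M_2$ and $M_0\le_{\mathbf{K}}M_2$ imply $M_0\le_{\mathbf{K}} M_1$; (Chain axioms) for any $\mu$-directed system $\langle M_i\rangle$ in $\mathbf{K}$, $M=\bigcup_i M_i\in K$, each $M_i\le_{\mathbf{K}}M$, and $M_i\le_{\mathbf{K}}N$ for all $i$ implies $M\le_{\mathbf{K}}N$; (LST) there is $\lambda=\lambda^{<\mu}\ge|\tau(\mathbf{K})|+\mu$ such that for every $M\in K$, $A\subseteq UM$ there is $M_0\le_{\mathbf{K}}M$ with $A\subseteq UM_0$, $|UM_0|\le|A|^{<\mu}+\lambda$. $\mathbf{K}$ admits intersections if for all $N\in K$, $A\subseteq UN$, the set $\bigcap\{UM:M\le_{\mathbf{K}}N, A\subseteq UM\}$ is the universe of some $M\le_{\mathbf{K}}N$.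 A category is $\mu$-accessible if it has $\mu$-directed colimits and a set $S$ of $\mu$-presentable objects (objects whose hom-functor preserves $\mu$-directed colimits) such that every object is a $\mu$-directed colimit of objects in $S$. A polyinitial object is a set $\mathcal{I}$ of objects such that for every object $M$ there is a unique $i\in\mathcal{I}$ admitting a morphism $i\to M$, and for any $f,g:i\to M$ there is a unique $h:i\to i$ with $fh=g$. A polycolimit of a diagram $D$ is a polyinitial object of the category of cocones on $D$. A category is locally $\mu$-polypresentable if it is $\mu$-accessible and every small diagram has a polycolimit. *)

theory Defs
  imports Main "HOL-Library.FuncSet"
begin

unbundle cardinal_syntax

section \<open>Sizes\<close>

text \<open>
  HOL has no proper classes, so the set/class distinction is made relative to a type \<^typ>\<open>'u\<close>
  that plays the role of the universe of sets. Classes are arbitrary subsets of \<^typ>\<open>'u\<close> (or of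
  types built from it), sets are the collections of fewer than \<open>|UNIV :: 'u set|\<close> elements, and this cardinal is strongly
  inaccessible; every set is then in bijection with a small subset of \<^typ>\<open>'u\<close>.
\<close>

definition set_universe :: "'u itself \<Rightarrow> bool" where
  "set_universe _ \<longleftrightarrow>
     natLeq <o |UNIV :: 'u set| \<and>
     regularCard |UNIV :: 'u set| \<and>
     (\<forall>A :: 'u set. |A| <o |UNIV :: 'u set| \<longrightarrow> |Pow A| <o |UNIV :: 'u set| )"

definition small :: "'u itself \<Rightarrow> 'a set \<Rightarrow> bool" where
  "small _ A \<longleftrightarrow> |A| <o |UNIV :: 'u set|"

definition regular_cardinal :: "'u rel \<Rightarrow> bool" where
  "regular_cardinal \<mu> \<longleftrightarrow> Card_order \<mu> \<and> cinfinite \<mu> \<and> regularCard \<mu> \<and> small TYPE('u) (Field \<mu>)"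

text \<open>
  The cardinal \<open>\<kappa>\<close> to the power \<open><\<mu>\<close>, as the number of sequences in \<open>\<kappa>\<close> of length an ordinal
  below \<open>\<mu>\<close>. For infinite \<open>\<mu>\<close> and \<open>\<kappa> \<ge> 2\<close> this is the supremum of the \<open>\<kappa>\<^sup>\<alpha>\<close>, \<open>\<alpha> < \<mu>\<close>; for
  \<open>\<kappa> \<le> 1\<close> it is at most \<open>\<mu>\<close>.
\<close>

definition cpow_less :: "'a rel \<Rightarrow> 'b rel \<Rightarrow> ('b \<times> ('b \<Rightarrow> 'a)) rel" where
  "cpow_less \<kappa> \<mu> = |SIGMA a : Field \<mu>. underS \<mu> a \<rightarrow>\<^sub>E Field \<kappa>|"

text \<open>Taking \<open>X = {}\<close> shows that a \<open>\<mu>\<close>-directed poset is nonempty.\<close>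

definition directed_poset :: "'u rel \<Rightarrow> 'u set \<Rightarrow> 'u rel \<Rightarrow> bool" where
  "directed_poset \<mu> I r \<longleftrightarrow>
     small TYPE('u) I \<and> partial_order_on I r \<and>
     (\<forall>X \<subseteq> I. |X| <o \<mu> \<longrightarrow> (\<exists>j \<in> I. \<forall>i \<in> X. (i, j) \<in> r))"


section \<open>Categories\<close>

record ('o, 'm) cat =
  Ob :: "'o set"
  Arr :: "'m set"
  Dom :: "'m \<Rightarrow> 'o"
  Cod :: "'m \<Rightarrow> 'o"
  Idn :: "'o \<Rightarrow> 'm"
  Cmp :: "'m \<Rightarrow> 'm \<Rightarrow> 'm"  \<comment> \<open>\<open>Cmp C g f\<close> is \<open>g\<close> after \<open>f\<close>\<close>

definition hom :: "('o, 'm) cat \<Rightarrow> 'o \<Rightarrow> 'o \<Rightarrow> 'm set" where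
  "hom C X Y = {f \<in> Arr C. Dom C f = X \<and> Cod C f = Y}"

definition category :: "('o, 'm) cat \<Rightarrow> bool" where
  "category C \<longleftrightarrow>
     (\<forall>f \<in> Arr C. Dom C f \<in> Ob C \<and> Cod C f \<in> Ob C) \<and>
     (\<forall>X \<in> Ob C. Idn C X \<in> hom C X X) \<and>
     (\<forall>f \<in> Arr C. \<forall>g \<in> Arr C. Cod C f = Dom C g \<longrightarrow>
        Cmp C g f \<in> hom C (Dom C f) (Cod C g)) \<and>
     (\<forall>f \<in> Arr C. Cmp C f (Idn C (Dom C f)) = f \<and> Cmp C (Idn C (Cod C f)) f = f) \<and>
     (\<forall>f \<in> Arr C. \<forall>g \<in> Arr C. \<forall>h \<in> Arr C. Cod C f = Dom C g \<longrightarrow> Cod C g = Dom C h \<longrightarrow>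
        Cmp C h (Cmp C g f) = Cmp C (Cmp C h g) f)"

definition locally_small :: "'u itself \<Rightarrow> ('o, 'm) cat \<Rightarrow> bool" where
  "locally_small U C \<longleftrightarrow> (\<forall>X \<in> Ob C. \<forall>Y \<in> Ob C. small U (hom C X Y))"

definition small_category :: "'u itself \<Rightarrow> ('o, 'm) cat \<Rightarrow> bool" where
  "small_category U C \<longleftrightarrow> category C \<and> small U (Ob C) \<and> small U (Arr C)"

definition mono_arr :: "('o, 'm) cat \<Rightarrow> 'm \<Rightarrow> bool" where
  "mono_arr C f \<longleftrightarrow> f \<in> Arr C \<and>
     (\<forall>g \<in> Arr C. \<forall>h \<in> Arr C. Cod C g = Dom C f \<longrightarrow> Cod C h = Dom C f \<longrightarrow> Dom C g = Dom C h \<longrightarrow>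
        Cmp C f g = Cmp C f h \<longrightarrow> g = h)"

definition iso_arr :: "('o, 'm) cat \<Rightarrow> 'm \<Rightarrow> bool" where
  "iso_arr C f \<longleftrightarrow> f \<in> Arr C \<and>
     (\<exists>g \<in> hom C (Cod C f) (Dom C f).
        Cmp C g f = Idn C (Dom C f) \<and> Cmp C f g = Idn C (Cod C f))"

record ('o, 'm, 'p, 'n) ftor =
  FOb :: "'o \<Rightarrow> 'p"
  FArr :: "'m \<Rightarrow> 'n"

definition is_functor :: "('o, 'm) cat \<Rightarrow> ('p, 'n) cat \<Rightarrow> ('o, 'm, 'p, 'n) ftor \<Rightarrow> bool" where
  "is_functor C D F \<longleftrightarrow>
     (\<forall>X \<in> Ob C. FOb F X \<in> Ob D) \<and>
     (\<forall>f \<in> Arr C. FArr F f \<in> hom D (FOb F (Dom C f)) (FOb F (Cod C f))) \<and>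
     (\<forall>X \<in> Ob C. FArr F (Idn C X) = Idn D (FOb F X)) \<and>
     (\<forall>f \<in> Arr C. \<forall>g \<in> Arr C. Cod C f = Dom C g \<longrightarrow>
        FArr F (Cmp C g f) = Cmp D (FArr F g) (FArr F f))"

definition ftor_id :: "('o, 'm, 'o, 'm) ftor" where
  "ftor_id = \<lparr>FOb = (\<lambda>X. X), FArr = (\<lambda>f. f)\<rparr>"

definition ftor_comp ::
  "('p, 'n, 'q, 'l) ftor \<Rightarrow> ('o, 'm, 'p, 'n) ftor \<Rightarrow> ('o, 'm, 'q, 'l) ftor" where
  "ftor_comp G F = \<lparr>FOb = FOb G \<circ> FOb F, FArr = FArr G \<circ> FArr F\<rparr>"

definition naturally_isomorphic ::
  "('o, 'm) cat \<Rightarrow> ('p, 'n) cat \<Rightarrow> ('o, 'm, 'p, 'n) ftor \<Rightarrow> ('o, 'm, 'p, 'n) ftor \<Rightarrow> bool" where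
  "naturally_isomorphic C D F G \<longleftrightarrow>
     (\<exists>t. (\<forall>X \<in> Ob C. t X \<in> hom D (FOb F X) (FOb G X) \<and> iso_arr D (t X)) \<and>
          (\<forall>f \<in> Arr C. Cmp D (FArr G f) (t (Dom C f)) = Cmp D (t (Cod C f)) (FArr F f)))"

definition equivalent_categories :: "('o, 'm) cat \<Rightarrow> ('p, 'n) cat \<Rightarrow> bool" where
  "equivalent_categories C D \<longleftrightarrow>
     (\<exists>F G. is_functor C D F \<and> is_functor D C G \<and>
        naturally_isomorphic C C (ftor_comp G F) ftor_id \<and>
        naturally_isomorphic D D (ftor_comp F G) ftor_id)"

definition poset_cat :: "'i set \<Rightarrow> 'i rel \<Rightarrow> ('i, 'i \<times> 'i) cat" where
  "poset_cat I r = \<lparr>Ob = I, Arr = r, Dom = fst, Cod = snd, Idn = (\<lambda>i. (i, i)),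
     Cmp = (\<lambda>g f. (fst f, snd g))\<rparr>"

text \<open>Arrows carry their domain and codomain, and functions are extensional on their domain.\<close>

definition set_cat :: "('u set, 'u set \<times> ('u \<Rightarrow> 'u) \<times> 'u set) cat" where
  "set_cat = \<lparr>
     Ob = {A. small TYPE('u) A},
     Arr = {(A, f, B). small TYPE('u) A \<and> small TYPE('u) B \<and> f \<in> A \<rightarrow>\<^sub>E B},
     Dom = (\<lambda>(A, f, B). A),
     Cod = (\<lambda>(A, f, B). B),
     Idn = (\<lambda>A. (A, \<lambda>x \<in> A. x, A)),
     Cmp = (\<lambda>(B, g, C) (A, f, B'). (A, compose A g f, C))\<rparr>"


section \<open>Cocones, colimits and polycolimits\<close>

text \<open>
  A cocone is a pair of its apex and its family of legs; the family is extensional so that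
  equality of cocones is the intended one.
\<close>

definition is_cocone ::
  "('j, 'k) cat \<Rightarrow> ('o, 'm) cat \<Rightarrow> ('j, 'k, 'o, 'm) ftor \<Rightarrow> 'o \<times> ('j \<Rightarrow> 'm) \<Rightarrow> bool" where
  "is_cocone J C D = (\<lambda>(X, c).
     X \<in> Ob C \<and> c \<in> extensional (Ob J) \<and>
     (\<forall>j \<in> Ob J. c j \<in> hom C (FOb D j) X) \<and>
     (\<forall>u \<in> Arr J. Cmp C (c (Cod J u)) (FArr D u) = c (Dom J u)))"

definition cocone_cat ::
  "('j, 'k) cat \<Rightarrow> ('o, 'm) cat \<Rightarrow> ('j, 'k, 'o, 'm) ftor \<Rightarrow>
   ('o \<times> ('j \<Rightarrow> 'm), ('o \<times> ('j \<Rightarrow> 'm)) \<times> 'm \<times> ('o \<times> ('j \<Rightarrow> 'm))) cat" where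
  "cocone_cat J C D = \<lparr>
     Ob = {p. is_cocone J C D p},
     Arr = {(p, h, q). is_cocone J C D p \<and> is_cocone J C D q \<and> h \<in> hom C (fst p) (fst q) \<and>
              (\<forall>j \<in> Ob J. Cmp C h (snd p j) = snd q j)},
     Dom = (\<lambda>(p, h, q). p),
     Cod = (\<lambda>(p, h, q). q),
     Idn = (\<lambda>p. (p, Idn C (fst p), p)),
     Cmp = (\<lambda>(q, h, s) (p, g, q'). (p, Cmp C h g, s))\<rparr>"

definition initial_object :: "('o, 'm) cat \<Rightarrow> 'o \<Rightarrow> bool" where
  "initial_object C X \<longleftrightarrow> X \<in> Ob C \<and> (\<forall>Y \<in> Ob C. \<exists>!f. f \<in> hom C X Y)"

definition is_colimit ::
  "('j, 'k) cat \<Rightarrow> ('o, 'm) cat \<Rightarrow> ('j, 'k, 'o, 'm) ftor \<Rightarrow> 'o \<times> ('j \<Rightarrow> 'm) \<Rightarrow> bool" where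
  "is_colimit J C D p \<longleftrightarrow> initial_object (cocone_cat J C D) p"

definition polyinitial :: "'u itself \<Rightarrow> ('o, 'm) cat \<Rightarrow> 'o set \<Rightarrow> bool" where
  "polyinitial U C I \<longleftrightarrow>
     small U I \<and> I \<subseteq> Ob C \<and>
     (\<forall>M \<in> Ob C.
        (\<exists>!i. i \<in> I \<and> hom C i M \<noteq> {}) \<and>
        (\<forall>i \<in> I. \<forall>f \<in> hom C i M. \<forall>g \<in> hom C i M. \<exists>!h. h \<in> hom C i i \<and> Cmp C f h = g))"

definition is_polycolimit ::
  "'u itself \<Rightarrow> ('j, 'k) cat \<Rightarrow> ('o, 'm) cat \<Rightarrow> ('j, 'k, 'o, 'm) ftor \<Rightarrow>
   ('o \<times> ('j \<Rightarrow> 'm)) set \<Rightarrow> bool" where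
  "is_polycolimit U J C D I \<longleftrightarrow> polyinitial U (cocone_cat J C D) I"

text \<open>Up to isomorphism, every small category has its objects and arrows in \<^typ>\<open>'u\<close>.\<close>

definition has_polycolimits :: "'u itself \<Rightarrow> ('o, 'm) cat \<Rightarrow> bool" where
  "has_polycolimits U C \<longleftrightarrow>
     (\<forall>(J :: ('u, 'u) cat) D. small_category U J \<and> is_functor J C D \<longrightarrow>
        (\<exists>I. is_polycolimit U J C D I))"


section \<open>Accessible and locally polypresentable categories\<close>

definition has_directed_colimits :: "'u rel \<Rightarrow> ('o, 'm) cat \<Rightarrow> bool" where
  "has_directed_colimits \<mu> C \<longleftrightarrow>
     (\<forall>I r D. directed_poset \<mu> I r \<and> is_functor (poset_cat I r) C D \<longrightarrow>
        (\<exists>p. is_colimit (poset_cat I r) C D p))"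

definition preserves_directed_colimits ::
  "'u rel \<Rightarrow> ('o, 'm) cat \<Rightarrow> ('p, 'n) cat \<Rightarrow> ('o, 'm, 'p, 'n) ftor \<Rightarrow> bool" where
  "preserves_directed_colimits \<mu> C E F \<longleftrightarrow>
     (\<forall>I r D X c. directed_poset \<mu> I r \<and> is_functor (poset_cat I r) C D \<and>
        is_colimit (poset_cat I r) C D (X, c) \<longrightarrow>
        is_colimit (poset_cat I r) E (ftor_comp F D) (FOb F X, \<lambda>i \<in> I. FArr F (c i)))"

text \<open>
  The arrows of the category are elements of the universe \<^typ>\<open>'u\<close>, so that for a locally small
  category the hom-functor takes values in \<^const>\<open>set_cat\<close>.
\<close>

definition hom_functor ::
  "('o, 'u) cat \<Rightarrow> 'o \<Rightarrow> ('o, 'u, 'u set, 'u set \<times> ('u \<Rightarrow> 'u) \<times> 'u set) ftor" where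
  "hom_functor C X = \<lparr>
     FOb = (\<lambda>Y. hom C X Y),
     FArr = (\<lambda>f. (hom C X (Dom C f), \<lambda>g \<in> hom C X (Dom C f). Cmp C f g, hom C X (Cod C f)))\<rparr>"

definition presentable :: "'u rel \<Rightarrow> ('o, 'u) cat \<Rightarrow> 'o \<Rightarrow> bool" where
  "presentable \<mu> C X \<longleftrightarrow>
     X \<in> Ob C \<and> preserves_directed_colimits \<mu> C set_cat (hom_functor C X)"

definition accessible :: "'u rel \<Rightarrow> ('o, 'u) cat \<Rightarrow> bool" where
  "accessible \<mu> C \<longleftrightarrow>
     has_directed_colimits \<mu> C \<and>
     (\<exists>S. small TYPE('u) S \<and> (\<forall>X \<in> S. presentable \<mu> C X) \<and>
        (\<forall>X \<in> Ob C. \<exists>I r D c. directed_poset \<mu> I r \<and> is_functor (poset_cat I r) C D \<and>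
           (\<forall>i \<in> I. FOb D i \<in> S) \<and> is_colimit (poset_cat I r) C D (X, c)))"

definition locally_polypresentable :: "'u rel \<Rightarrow> ('o, 'u) cat \<Rightarrow> bool" where
  "locally_polypresentable \<mu> C \<longleftrightarrow> accessible \<mu> C \<and> has_polycolimits TYPE('u) C"


section \<open>Structures\<close>

text \<open>
  The arity of a symbol is given as an index set: a tuple of arity \<open>I\<close> in \<open>A\<close> is an element of
  \<open>I \<rightarrow>\<^sub>E A\<close>.
\<close>

record 'u vocabulary =
  fun_syms :: "'u set"
  rel_syms :: "'u set"
  fun_arity :: "'u \<Rightarrow> 'u set"
  rel_arity :: "'u \<Rightarrow> 'u set"

definition is_vocabulary :: "'u rel \<Rightarrow> 'u vocabulary \<Rightarrow> bool" where
  "is_vocabulary \<mu> \<tau> \<longleftrightarrow>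
     small TYPE('u) (fun_syms \<tau>) \<and> small TYPE('u) (rel_syms \<tau>) \<and>
     (\<forall>s \<in> fun_syms \<tau>. |fun_arity \<tau> s| <o \<mu>) \<and>
     (\<forall>s \<in> rel_syms \<tau>. |rel_arity \<tau> s| <o \<mu>)"

record 'u struc =
  Univ :: "'u set"
  Fn :: "'u \<Rightarrow> ('u \<Rightarrow> 'u) \<Rightarrow> 'u"
  Rl :: "'u \<Rightarrow> ('u \<Rightarrow> 'u) set"

text \<open>
  Interpretations are fixed outside the vocabulary and the universe, so that equality of
  structures is the intended one. The universe of a structure may be empty.
\<close>

definition is_struc :: "'u vocabulary \<Rightarrow> 'u struc \<Rightarrow> bool" where
  "is_struc \<tau> M \<longleftrightarrow>
     small TYPE('u) (Univ M) \<and>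
     (\<forall>s \<in> fun_syms \<tau>. Fn M s \<in> (fun_arity \<tau> s \<rightarrow>\<^sub>E Univ M) \<rightarrow>\<^sub>E Univ M) \<and>
     (\<forall>s. s \<notin> fun_syms \<tau> \<longrightarrow> Fn M s = (\<lambda>x. undefined)) \<and>
     (\<forall>s \<in> rel_syms \<tau>. Rl M s \<subseteq> rel_arity \<tau> s \<rightarrow>\<^sub>E Univ M) \<and>
     (\<forall>s. s \<notin> rel_syms \<tau> \<longrightarrow> Rl M s = {})"

definition substruc :: "'u vocabulary \<Rightarrow> 'u struc \<Rightarrow> 'u struc \<Rightarrow> bool" where
  "substruc \<tau> M N \<longleftrightarrow>
     is_struc \<tau> M \<and> is_struc \<tau> N \<and> Univ M \<subseteq> Univ N \<and>
     (\<forall>s \<in> fun_syms \<tau>. \<forall>x \<in> fun_arity \<tau> s \<rightarrow>\<^sub>E Univ M. Fn M s x = Fn N s x) \<and>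
     (\<forall>s \<in> rel_syms \<tau>. Rl M s = Rl N s \<inter> (rel_arity \<tau> s \<rightarrow>\<^sub>E Univ M))"

definition struc_iso :: "'u vocabulary \<Rightarrow> 'u struc \<Rightarrow> 'u struc \<Rightarrow> ('u \<Rightarrow> 'u) \<Rightarrow> bool" where
  "struc_iso \<tau> M N f \<longleftrightarrow>
     is_struc \<tau> M \<and> is_struc \<tau> N \<and> f \<in> extensional (Univ M) \<and> bij_betw f (Univ M) (Univ N) \<and>
     (\<forall>s \<in> fun_syms \<tau>. \<forall>x \<in> fun_arity \<tau> s \<rightarrow>\<^sub>E Univ M.
        f (Fn M s x) = Fn N s (compose (fun_arity \<tau> s) f x)) \<and>
     (\<forall>s \<in> rel_syms \<tau>. \<forall>x \<in> rel_arity \<tau> s \<rightarrow>\<^sub>E Univ M.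
        x \<in> Rl M s \<longleftrightarrow> compose (rel_arity \<tau> s) f x \<in> Rl N s)"

text \<open>
  Union of a directed system of structures; in a \<open>\<mu>\<close>-directed system every tuple of arity below
  \<open>\<mu>\<close> lies in some member, and all members containing it agree on the value of a function.
\<close>

definition union_struc ::
  "'u vocabulary \<Rightarrow> 'u set \<Rightarrow> ('u \<Rightarrow> 'u struc) \<Rightarrow> 'u struc" where
  "union_struc \<tau> I M = \<lparr>
     Univ = (\<Union>i \<in> I. Univ (M i)),
     Fn = (\<lambda>s x. if s \<in> fun_syms \<tau> \<and> x \<in> fun_arity \<tau> s \<rightarrow>\<^sub>E (\<Union>i \<in> I. Univ (M i))
                 then THE y. \<exists>i \<in> I. x \<in> fun_arity \<tau> s \<rightarrow>\<^sub>E Univ (M i) \<and> y = Fn (M i) s x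
                 else undefined),
     Rl = (\<lambda>s. \<Union>i \<in> I. Rl (M i) s)\<rparr>"


section \<open>Abstract classes and \<open>\<mu>\<close>-AECs\<close>

record 'u abs_class =
  voc :: "'u vocabulary"
  models :: "'u struc set"
  leq :: "'u struc \<Rightarrow> 'u struc \<Rightarrow> bool"

definition abstract_class :: "'u rel \<Rightarrow> 'u abs_class \<Rightarrow> bool" where
  "abstract_class \<mu> K \<longleftrightarrow>
     is_vocabulary \<mu> (voc K) \<and>
     (\<forall>M \<in> models K. is_struc (voc K) M) \<and>
     (\<forall>M \<in> models K. \<forall>N f. struc_iso (voc K) M N f \<longrightarrow> N \<in> models K) \<and>
     partial_order_on (models K) {(M, N). leq K M N} \<and>
     (\<forall>M N M' N' f. leq K M N \<and> struc_iso (voc K) N N' f \<and>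
        struc_iso (voc K) M M' (restrict f (Univ M)) \<longrightarrow> leq K M' N') \<and>
     (\<forall>M N. leq K M N \<longrightarrow> substruc (voc K) M N)"

text \<open>In the following definition \<open>M'\<close> is the image \<open>f[M]\<close>.\<close>

definition K_embedding :: "'u abs_class \<Rightarrow> 'u struc \<Rightarrow> 'u struc \<Rightarrow> ('u \<Rightarrow> 'u) \<Rightarrow> bool" where
  "K_embedding K M N f \<longleftrightarrow>
     M \<in> models K \<and> N \<in> models K \<and>
     (\<exists>M'. Univ M' = f ` Univ M \<and> struc_iso (voc K) M M' f \<and> leq K M' N)"

definition class_cat :: "'u abs_class \<Rightarrow> ('u struc, 'u struc \<times> ('u \<Rightarrow> 'u) \<times> 'u struc) cat" where
  "class_cat K = \<lparr>
     Ob = models K,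
     Arr = {(M, f, N). K_embedding K M N f},
     Dom = (\<lambda>(M, f, N). M),
     Cod = (\<lambda>(M, f, N). N),
     Idn = (\<lambda>M. (M, \<lambda>x \<in> Univ M. x, M)),
     Cmp = (\<lambda>(N, g, P) (M, f, N'). (M, compose (Univ M) g f, P))\<rparr>"

definition coherence :: "'u abs_class \<Rightarrow> bool" where
  "coherence K \<longleftrightarrow>
     (\<forall>M0 \<in> models K. \<forall>M1 \<in> models K. \<forall>M2 \<in> models K.
        substruc (voc K) M0 M1 \<and> leq K M1 M2 \<and> leq K M0 M2 \<longrightarrow> leq K M0 M1)"

definition directed_system ::
  "'u rel \<Rightarrow> 'u abs_class \<Rightarrow> 'u set \<Rightarrow> 'u rel \<Rightarrow> ('u \<Rightarrow> 'u struc) \<Rightarrow> bool" where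
  "directed_system \<mu> K I r M \<longleftrightarrow>
     directed_poset \<mu> I r \<and> (\<forall>i \<in> I. M i \<in> models K) \<and> (\<forall>(i, j) \<in> r. leq K (M i) (M j))"

definition chain_axioms :: "'u rel \<Rightarrow> 'u abs_class \<Rightarrow> bool" where
  "chain_axioms \<mu> K \<longleftrightarrow>
     (\<forall>I r M. directed_system \<mu> K I r M \<longrightarrow>
        union_struc (voc K) I M \<in> models K \<and>
        (\<forall>i \<in> I. leq K (M i) (union_struc (voc K) I M)) \<and>
        (\<forall>N \<in> models K. (\<forall>i \<in> I. leq K (M i) N) \<longrightarrow> leq K (union_struc (voc K) I M) N))"

definition LST_axiom :: "'u rel \<Rightarrow> 'u abs_class \<Rightarrow> bool" where
  "LST_axiom \<mu> K \<longleftrightarrow>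
     (\<exists>\<nu> :: 'u rel. Card_order \<nu> \<and> small TYPE('u) (Field \<nu>) \<and>
        cpow_less \<nu> \<mu> =o \<nu> \<and>
        |fun_syms (voc K)| +c |rel_syms (voc K)| +c \<mu> \<le>o \<nu> \<and>
        (\<forall>M \<in> models K. \<forall>A \<subseteq> Univ M. \<exists>M0. leq K M0 M \<and> A \<subseteq> Univ M0 \<and>
           |Univ M0| \<le>o cpow_less (card_of A) \<mu> +c \<nu>))"

definition mu_AEC :: "'u rel \<Rightarrow> 'u abs_class \<Rightarrow> bool" where
  "mu_AEC \<mu> K \<longleftrightarrow> abstract_class \<mu> K \<and> coherence K \<and> chain_axioms \<mu> K \<and> LST_axiom \<mu> K"

definition admits_intersections :: "'u abs_class \<Rightarrow> bool" where
  "admits_intersections K \<longleftrightarrow>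
     (\<forall>N \<in> models K. \<forall>A \<subseteq> Univ N. \<exists>M. leq K M N \<and>
        Univ M = \<Inter>{Univ M' | M'. leq K M' N \<and> A \<subseteq> Univ M'})"

end

theory Submission
  imports Defs
begin

text \<open>
  From (2) to (1): \<open>\<K>\<close> inherits underlying sets and injective maps from the class, and
  intersections give every subset \<open>A\<close> of an object \<open>X\<close> a closure, the least subobject containing
  \<open>A\<close>. An object generated by fewer than \<open>\<mu>\<close> elements is \<open>\<mu>\<close>-presentable, because its image in
  a directed union lies in one member as soon as the generators do; every object is the
  \<open>\<mu>\<close>-directed union of the closures of its subsets of size less than \<open>\<mu>\<close>. The polycolimit of a
  diagram consists of the cocones generated by the images of their legs, one from each isomorphism
  class, and the Loewenheim-Skolem axiom makes this a set.

  From (1) to (2): with \<open>S\<close> a set of \<open>\<mu>\<close>-presentable objects as in the definition of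
  accessibility, an object \<open>X\<close> becomes the relational structure of all arrows \<open>s \<rightarrow> X\<close> with
  \<open>s \<in> S\<close>, where an arrow \<open>u\<close> of \<open>S\<close> is the relation \<open>b = a u\<close>. Embeddings of such structures are
  the arrows of \<open>\<K>\<close>, so the class needs no order other than the substructure relation. The closure
  of a set \<open>A\<close> of elements of \<open>X\<close> is the image of the member of the polycolimit of the discrete
  diagram of the domains of \<open>A\<close> that maps to the cocone \<open>A\<close>: any other subobject containing \<open>A\<close>
  receives an arrow from the same member, and the two arrows to \<open>X\<close> differ by an endomorphism.
\<close>

section \<open>Small sets\<close>

text \<open>Presentability is defined only for categories whose arrows lie in \<open>'u\<close>,
  whereas the arrows of \<open>class_cat K\<close> are triples. Hence, starting from a class,
  underlying sets and maps are carried back to \<open>C\<close> along a fully faithful, essentially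
  surjective functor, and the argument sees only this concrete structure on \<open>C\<close>. In the
  other direction the structure of \<open>X\<close> is the presheaf hom(-, X) restricted to
  \<open>S\<close>, written as one set with the graph of each action. That all arrows are monic
  makes the induced maps injective and makes them reflect the relations. Faithfulness holds because
  every object is a colimit of objects of \<open>S\<close>; fullness and the description of directed
  unions use in addition that these objects are presentable. Polycolimits yield closures of all
  subsets, but their size is bounded uniformly only for fewer than \<open>\<mu>\<close> generators,
  since up to indexing there is only a small set of such diagrams. Larger sets are reached by the
  directed union of the closures of their subsets of size below \<open>\<mu>\<close>. The cardinal
  \<open>\<nu>\<close> is taken of the form 2^kappa in order that raising it to powers below
  \<open>\<mu>\<close> does not enlarge it.\<close>

locale sizes =
  fixes \<mu> :: "'u rel"
  assumes universe: "set_universe TYPE('u)" and regular: "regular_cardinal \<mu>"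
begin

lemma Cinfinite_UNIV: "Cinfinite |UNIV :: 'u set|"
  using universe unfolding set_universe_def cinfinite_def
  by (metis Field_card_of card_of_Card_order infinite_iff_natLeq_ordLeq ordLess_imp_ordLeq)

text \<open>Two distinct elements serve twice below: as the values of test maps into a two-element
  set, and as the two argument places of binary relations.\<close>

lemma ex_two_elements: obtains x y :: 'u where "x \<noteq> y"
proof -
  have "infinite (UNIV :: 'u set)" using Cinfinite_UNIV by (simp add: cinfinite_def Field_card_of)
  then show ?thesis using that by (metis (full_types) UNIV_I finite.emptyI finite.insertI finite_subset insertI1 subsetI)
qed

lemma Cinfinite_mu: "Cinfinite \<mu>"
  using regular by (simp add: regular_cardinal_def)

lemma small_ordLeq: "|A| \<le>o |B| \<Longrightarrow> small TYPE('u) B \<Longrightarrow> small TYPE('u) A"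
  unfolding small_def using ordLeq_ordLess_trans by blast

lemma small_subset: "small TYPE('u) B \<Longrightarrow> A \<subseteq> B \<Longrightarrow> small TYPE('u) A"
  using small_ordLeq card_of_mono1 by blast

lemma small_image: "small TYPE('u) A \<Longrightarrow> small TYPE('u) (f ` A)"
  using small_ordLeq card_of_image by blast

lemma small_inj: "inj_on f A \<Longrightarrow> f ` A \<subseteq> B \<Longrightarrow> small TYPE('u) B \<Longrightarrow> small TYPE('u) A"
  by (rule small_ordLeq[of A B]) (auto simp: card_of_ordLeq[symmetric])

lemma small_UN: "small TYPE('u) I \<Longrightarrow> (\<And>i. i \<in> I \<Longrightarrow> small TYPE('u) (A i)) \<Longrightarrow> small TYPE('u) (\<Union>i\<in>I. A i)"
  unfolding small_def
  using card_of_UNION_ordLess_infinite_Field_regularCard[of "|UNIV :: 'u set|" I A]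
    Cinfinite_UNIV universe
  by (auto simp: set_universe_def)

text \<open>Index posets, diagrams and universes of structures consist of elements of
  \<open>'u\<close>; a small set of any other type enters them through such a code.\<close>

lemma small_code:
  assumes "small TYPE('u) A" shows "\<exists>e :: 'a \<Rightarrow> 'u. inj_on e A"
  using assms unfolding small_def
  by (metis card_of_ordLeq ordLess_imp_ordLeq)

lemma small_code_set:
  assumes "small TYPE('u) A" shows "\<exists>Z :: 'u set. small TYPE('u) Z \<and> |A| =o |Z|"
proof -
  obtain e :: "'a \<Rightarrow> 'u" where e: "inj_on e A" using small_code[OF assms] by blast
  then have "|A| =o |e ` A|"
    by (metis card_of_ordIsoI inj_on_imp_bij_betw)
  then show ?thesis using small_image[OF assms] by blast
qed

lemma small_Sigma:
  assumes "small TYPE('u) I" "\<And>i. i \<in> I \<Longrightarrow> small TYPE('u) (A i)" shows "small TYPE('u) (SIGMA i : I. A i)"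
proof -
  have "(SIGMA i : I. A i) = (\<Union>i\<in>I. Pair i ` A i)" by auto
  then show ?thesis using assms by (simp add: small_UN small_image)
qed

text \<open>The strong limit condition speaks only of subsets of \<open>'u\<close>, so
  \<open>A\<close> is first coded in \<open>'u\<close> and its subsets follow along the image
  map.\<close>

lemma small_Pow:
  assumes "small TYPE('u) A" shows "small TYPE('u) (Pow A)"
proof -
  obtain e :: "'a \<Rightarrow> 'u" where e: "inj_on e A" using small_code[OF assms] by blast
  have "small TYPE('u) (Pow (e ` A))"
    using universe small_image[OF assms, of e] by (simp add: set_universe_def small_def)
  moreover have "inj_on ((`) e) (Pow A)" using e by (rule inj_on_image_Pow)
  ultimately show ?thesis using small_inj[of "(`) e" "Pow A" "Pow (e ` A)"] by blast
qed

lemma small_PiE: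
  assumes "small TYPE('u) I" "\<And>i. i \<in> I \<Longrightarrow> small TYPE('u) (A i)" shows "small TYPE('u) (PiE I A)"
proof -
  \<comment> \<open>A function is coded by its graph over \<open>I\<close>; extensionality makes the
    code injective.\<close>
  let ?g = "\<lambda>f. (\<lambda>i. (i, f i)) ` I"
  have "inj_on ?g (PiE I A)"
  proof (rule inj_onI)
    fix f g assume fg: "f \<in> PiE I A" "g \<in> PiE I A" and eq: "?g f = ?g g"
    have "f i = g i" if "i \<in> I" for i
    proof -
      have "(i, f i) \<in> ?g g" using eq that by blast
      then show ?thesis by auto
    qed
    then show "f = g" using fg by (meson PiE_ext)
  qed
  moreover have "?g ` PiE I A \<subseteq> Pow (SIGMA i : I. A i)" by fastforce
  ultimately show ?thesis by (rule small_inj) (rule small_Pow[OF small_Sigma[OF assms]])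
qed

section \<open>Sets of size below the regular cardinal\<close>

lemma finite_less_mu: "finite A \<Longrightarrow> |A| <o \<mu>"
  using Cinfinite_mu
  by (metis Cfinite_ordLess_Cinfinite Field_card_of card_of_Card_order cfinite_def)

lemma less_mu_small: "|A| <o \<mu> \<Longrightarrow> small TYPE('u) A"
  using regular unfolding regular_cardinal_def small_def
  by (meson card_of_Field_ordIso ordIso_symmetric ordLess_ordIso_trans ordLess_transitive)

lemma finite_small: "finite A \<Longrightarrow> small TYPE('u) A"
  using finite_less_mu less_mu_small by blast

lemma small_Field_mu: "small TYPE('u) (Field \<mu>)"
  using regular by (simp add: regular_cardinal_def)

lemma small_Un: "small TYPE('u) A \<Longrightarrow> small TYPE('u) B \<Longrightarrow> small TYPE('u) (A \<union> B)"
  using small_UN[of "{A, B}" "\<lambda>X. X"] finite_small[of "{A, B}"] by auto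

lemma less_mu_UN:
  "|I| <o \<mu> \<Longrightarrow> (\<And>i. i \<in> I \<Longrightarrow> |A i| <o \<mu>) \<Longrightarrow> |\<Union>i\<in>I. A i| <o \<mu>"
  using card_of_UNION_ordLess_infinite_Field_regularCard[of \<mu> I A] regular
  by (auto simp: regular_cardinal_def)

lemma less_mu_image: "|A| <o \<mu> \<Longrightarrow> |f ` A| <o \<mu>"
  using card_of_image ordLeq_ordLess_trans by blast

text \<open>The well-order on \<open>B\<close> is isomorphic to a proper initial segment of
  \<open>\<mu>\<close>. Hence the sequences counted by \<open>cpow_less\<close> enumerate every set
  of size below \<open>\<mu>\<close>.\<close>

lemma less_mu_enum:
  assumes "|B| <o \<mu>" shows "\<exists>a \<in> Field \<mu>. \<exists>f. bij_betw f (underS \<mu> a) B"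
proof -
  have wo: "Well_order \<mu>" using Cinfinite_mu card_order_on_well_order_on by blast
  obtain a where a: "a \<in> Field \<mu>" "|B| =o Restr \<mu> (underS \<mu> a)"
    using assms ordLess_iff_ordIso_Restr[OF wo card_of_Well_order[of B]] by auto
  have "Field (Restr \<mu> (underS \<mu> a)) = underS \<mu> a"
    using wo by (simp add: Field_Restr_ofilter wo_rel.underS_ofilter wo_rel_def)
  then have "|B| =o |underS \<mu> a|"
    using card_of_cong[OF a(2)] by (simp add: Field_card_of)
  then have "|underS \<mu> a| =o |B|" by (rule ordIso_symmetric)
  then show ?thesis using a(1) by (meson card_of_ordIso)
qed

text \<open>Regularity of \<open>\<mu>\<close> keeps a union of fewer than \<open>\<mu>\<close> such
  subsets below \<open>\<mu>\<close>, and this union is the required upper bound. The poset must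
  live on \<open>'u\<close>, so its elements \<open>i\<close> are codes and \<open>d i\<close> is
  the subset coded.\<close>

lemma ex_poset_of_subsets_less_mu:
  assumes A: "small TYPE('u) A"
  shows "\<exists>I r d. directed_poset \<mu> I r \<and> bij_betw d I {B. B \<subseteq> A \<and> |B| <o \<mu>} \<and>
    (\<forall>i j. (i, j) \<in> r \<longleftrightarrow> i \<in> I \<and> j \<in> I \<and> d i \<subseteq> d j)"
proof -
  let ?A = "{B. B \<subseteq> A \<and> |B| <o \<mu>}"
  have smA: "small TYPE('u) ?A" by (rule small_subset[OF small_Pow[OF A]]) blast
  obtain e :: "'a set \<Rightarrow> 'u" where e: "inj_on e ?A" using small_code[OF smA] by blast
  define d where "d = inv_into ?A e"
  define I where "I = e ` ?A"
  define r where "r = {(i, j). i \<in> I \<and> j \<in> I \<and> d i \<subseteq> d j}"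
  have bij: "bij_betw d I ?A"
    unfolding d_def I_def using e by (intro bij_betw_inv_into) (simp add: bij_betw_def)
  then have d: "d i \<subseteq> A" "|d i| <o \<mu>" if "i \<in> I" for i using that by (auto dest: bij_betwE)
  have "partial_order_on I r"
    unfolding partial_order_on_def preorder_on_def
    using bij_betw_imp_inj_on[OF bij] by (auto simp: r_def refl_on_def trans_def antisym_def dest: inj_onD)
  moreover have "\<exists>j \<in> I. \<forall>i \<in> Y. (i, j) \<in> r" if Y: "Y \<subseteq> I" "|Y| <o \<mu>" for Y
  proof -
    have "|\<Union>i \<in> Y. d i| <o \<mu>" by (rule less_mu_UN[OF Y(2)]) (use d Y(1) in blast)
    moreover have "(\<Union>i \<in> Y. d i) \<subseteq> A" using d Y(1) by blast
    ultimately have "(\<Union>i \<in> Y. d i) \<in> d ` I" unfolding bij_betw_imp_surj_on[OF bij] by blast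
    then obtain j where "j \<in> I" "(\<Union>i \<in> Y. d i) = d j" by (elim imageE)
    then show ?thesis using Y(1) unfolding r_def by (intro bexI[of _ j]) auto
  qed
  ultimately have "directed_poset \<mu> I r"
    unfolding directed_poset_def using small_image[OF smA, of e] I_def by blast
  then show ?thesis using bij by (intro exI[of _ I] exI[of _ r] exI[of _ d]) (simp add: r_def)
qed

section \<open>Powers with exponent below the regular cardinal\<close>

lemma Field_cpow_less: "Field (cpow_less \<kappa> \<mu>) = (SIGMA a : Field \<mu>. underS \<mu> a \<rightarrow>\<^sub>E Field \<kappa>)"
  by (simp add: cpow_less_def Field_card_of)

lemma small_underS: "small TYPE('u) (underS \<mu> a)"
  by (rule small_subset[OF small_Field_mu]) (auto simp: underS_def Field_def)

lemma small_cpow_less: "small TYPE('u) (Field \<kappa>) \<Longrightarrow> small TYPE('u) (Field (cpow_less \<kappa> \<mu>))"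
  unfolding Field_cpow_less by (intro small_Sigma small_PiE small_Field_mu small_underS)

lemma cpow_less_mono:
  assumes "|Field \<kappa>| \<le>o |Field \<kappa>'|" shows "cpow_less \<kappa> \<mu> \<le>o cpow_less \<kappa>' \<mu>"
proof -
  obtain f where f: "inj_on f (Field \<kappa>)" "f ` Field \<kappa> \<subseteq> Field \<kappa>'"
    using assms by (meson card_of_ordLeq)
  let ?g = "\<lambda>(a, h). (a, compose (underS \<mu> a) f h)"
  let ?S = "\<lambda>\<kappa>. SIGMA a : Field \<mu>. underS \<mu> a \<rightarrow>\<^sub>E Field \<kappa>"
  have "inj_on ?g (?S \<kappa>)"
  proof (rule inj_onI)
    fix p q assume pq: "p \<in> ?S \<kappa>" "q \<in> ?S \<kappa>" "?g p = ?g q"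
    obtain a h a' h' where p: "p = (a, h)" and q: "q = (a', h')" by (cases p, cases q)
    have h: "h \<in> underS \<mu> a \<rightarrow>\<^sub>E Field \<kappa>" "h' \<in> underS \<mu> a' \<rightarrow>\<^sub>E Field \<kappa>"
      and eq: "a = a' \<and> compose (underS \<mu> a) f h = compose (underS \<mu> a') f h'"
      using pq unfolding p q prod.case prod.inject by blast+
    have "h i = h' i" if "i \<in> underS \<mu> a" for i
    proof -
      have "f (h i) = f (h' i)" using fun_cong[of _ _ i] eq that by (metis compose_eq)
      then show ?thesis using f(1) h that eq by (auto dest: inj_onD)
    qed
    then show "p = q" using h eq unfolding p q by (auto intro: PiE_ext)
  qed
  moreover have "?g ` ?S \<kappa> \<subseteq> ?S \<kappa>'" using f(2) by (auto simp: compose_def Pi_iff PiE_iff)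
  ultimately show ?thesis unfolding cpow_less_def using card_of_ordLeq by blast
qed

text \<open>Every such subset is the range of a sequence in \<open>A\<close> whose length is an
  initial segment of \<open>\<mu>\<close>, so sequences map onto subsets.\<close>

lemma card_subsets_less_mu: "|{B. B \<subseteq> A \<and> |B| <o \<mu>}| \<le>o cpow_less |A| \<mu>"
proof -
  let ?S = "SIGMA a : Field \<mu>. underS \<mu> a \<rightarrow>\<^sub>E A"
  have "{B. B \<subseteq> A \<and> |B| <o \<mu>} \<subseteq> (\<lambda>(a, f). f ` underS \<mu> a) ` ?S"
  proof clarify
    fix B assume B: "B \<subseteq> A" "|B| <o \<mu>"
    obtain a f where af: "a \<in> Field \<mu>" "bij_betw f (underS \<mu> a) B" using less_mu_enum[OF B(2)] by blast
    then have "(a, restrict f (underS \<mu> a)) \<in> ?S" using B(1) by (auto simp: bij_betw_def)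
    moreover have "B = restrict f (underS \<mu> a) ` underS \<mu> a" using af(2) by (auto simp: bij_betw_def)
    ultimately show "B \<in> (\<lambda>(a, f). f ` underS \<mu> a) ` ?S" by (intro image_eqI[of _ _ "(a, restrict f (underS \<mu> a))"]) simp_all
  qed
  then have "|{B. B \<subseteq> A \<and> |B| <o \<mu>}| \<le>o |(\<lambda>(a, f). f ` underS \<mu> a) ` ?S|" by (rule card_of_mono1)
  also have "|(\<lambda>(a, f). f ` underS \<mu> a) ` ?S| \<le>o |?S|" by (rule card_of_image)
  finally show ?thesis by (simp add: cpow_less_def Field_card_of)
qed

text \<open>This is the shape of the bound in \<open>LST_axiom\<close>: the sum absorbs both the
  number of pieces and the size of each.\<close>

lemma card_UN_subsets_less_mu:
  assumes \<nu>: "Cinfinite \<nu>" and F: "\<And>B. B \<subseteq> A \<Longrightarrow> |B| <o \<mu> \<Longrightarrow> |F B| \<le>o \<nu>"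
  shows "|\<Union>B \<in> {B. B \<subseteq> A \<and> |B| <o \<mu>}. F B| \<le>o cpow_less |A| \<mu> +c \<nu>"
proof (rule UNION_Cinfinite_bound)
  have "Card_order (cpow_less |A| \<mu>)" by (simp add: cpow_less_def card_of_Card_order)
  then show "|{B. B \<subseteq> A \<and> |B| <o \<mu>}| \<le>o cpow_less |A| \<mu> +c \<nu>"
    using card_subsets_less_mu ordLeq_csum1 ordLeq_transitive by blast
  show "\<forall>i \<in> {B. B \<subseteq> A \<and> |B| <o \<mu>}. |F i| \<le>o cpow_less |A| \<mu> +c \<nu>"
    using F \<nu> ordLeq_csum2 ordLeq_transitive by blast
  show "Cinfinite (cpow_less |A| \<mu> +c \<nu>)" using \<nu> by (simp add: Cinfinite_csum)
qed

text \<open>A cardinal of the form \<open>2\<^sup>\<kappa>\<close> with \<open>\<kappa> \<ge> \<mu>\<close> is fixed by \<open>\<nu> \<mapsto> \<nu>\<^sup><\<^sup>\<mu>\<close>.\<close>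

lemma ex_cpow_less_closed:
  fixes Z :: "'a set"
  assumes "small TYPE('u) Z"
  shows "\<exists>\<nu> :: 'u rel. Cinfinite \<nu> \<and> small TYPE('u) (Field \<nu>) \<and> cpow_less \<nu> \<mu> =o \<nu> \<and> |Z| \<le>o \<nu> \<and> \<mu> \<le>o \<nu>"
proof -
  let ?Y = "Z <+> Field \<mu>"
  have iY: "infinite ?Y" using Cinfinite_mu by (simp add: cinfinite_def)
  have smY: "small TYPE('u) ?Y"
    unfolding Plus_def using assms small_Field_mu by (simp add: small_Un small_image)
  \<comment> \<open>\<open>V\<close> is a copy in \<open>'u\<close> of the power set of
    \<open>?Y\<close>, where \<open>?Y\<close> is at least as large as \<open>Z\<close> and
    \<open>\<mu>\<close>. Its cardinal is the required \<open>\<nu>\<close>.\<close>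
  obtain V :: "'u set" where V: "small TYPE('u) V" "|Pow ?Y| =o |V|"
    using small_code_set[OF small_Pow[OF smY]] by blast
  obtain v where v: "bij_betw v V (Pow ?Y)"
    using V(2) by (meson card_of_ordIso ordIso_symmetric)
  have mY: "|Field \<mu>| \<le>o |?Y|" and ZY: "|Z| \<le>o |?Y|" by (simp_all add: card_of_Plus1 card_of_Plus2)
  have YV: "|?Y| \<le>o |V|"
    using V(2) card_of_Pow ordLess_imp_ordLeq ordLeq_ordIso_trans by blast
  have \<mu>Y: "\<mu> \<le>o |?Y|"
    using mY Cinfinite_mu by (meson card_of_Field_ordIso ordIso_ordLeq_trans ordIso_symmetric)
  have iV: "infinite V" using YV iY card_of_ordLeq_infinite by blast
  let ?S = "SIGMA a : Field \<mu>. underS \<mu> a \<rightarrow>\<^sub>E V"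
  have "|?S| \<le>o |V|"
  proof -
    \<comment> \<open>A sequence of subsets of \<open>?Y\<close> becomes a single subset of
      \<open>Field \<mu> \<times> ?Y\<close>, with its length kept as first component. Since
      \<open>?Y\<close> absorbs the factor \<open>Field \<mu>\<close>, such codes number at most
      2^|Y|.\<close>
    let ?g = "\<lambda>(a, h). (a, (SIGMA i : underS \<mu> a. v (h i)))"
    have "inj_on ?g ?S"
    proof (rule inj_onI)
      fix p q assume pq: "p \<in> ?S" "q \<in> ?S" "?g p = ?g q"
      obtain a h a' h' where p: "p = (a, h)" and q: "q = (a', h')" by (cases p, cases q)
      have h: "h \<in> underS \<mu> a \<rightarrow>\<^sub>E V" "h' \<in> underS \<mu> a' \<rightarrow>\<^sub>E V"
        and eq: "a = a' \<and> (SIGMA i : underS \<mu> a. v (h i)) = (SIGMA i : underS \<mu> a'. v (h' i))"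
        using pq unfolding p q prod.case prod.inject by blast+
      have "h i = h' i" if i: "i \<in> underS \<mu> a" for i
      proof -
        have "v (h i) = v (h' i)"
          using eq i by (auto simp: set_eq_iff)
        then show ?thesis using v h i eq by (metis PiE_mem bij_betw_inv_into_left)
      qed
      then show "p = q" using h eq unfolding p q by (auto intro: PiE_ext)
    qed
    moreover have "?g ` ?S \<subseteq> Field \<mu> \<times> Pow (Field \<mu> \<times> ?Y)"
    proof -
      have "underS \<mu> a \<subseteq> Field \<mu>" for a by (auto simp: underS_def Field_def)
      moreover have "v x \<subseteq> ?Y" if "x \<in> V" for x using v that by (auto simp: bij_betw_def)
      ultimately show ?thesis by fastforce
    qed
    ultimately have "|?S| \<le>o |Field \<mu> \<times> Pow (Field \<mu> \<times> ?Y)|" using card_of_ordLeq by blast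
    moreover have "|Field \<mu> \<times> ?Y| \<le>o |?Y|"
      by (rule ordLeq_ordIso_trans[OF card_of_Times_mono1[OF mY] card_of_Times_same_infinite[OF iY]])
    then obtain g where g: "inj_on g (Field \<mu> \<times> ?Y)" "g ` (Field \<mu> \<times> ?Y) \<subseteq> ?Y"
      by (meson card_of_ordLeq)
    have "|Pow (Field \<mu> \<times> ?Y)| \<le>o |Pow ?Y|"
      using inj_on_image_Pow[OF g(1)] image_Pow_mono[OF g(2)] by (meson card_of_ordLeq)
    then have "|Pow (Field \<mu> \<times> ?Y)| \<le>o |V|" using V(2) ordLeq_ordIso_trans by blast
    moreover have "|Field \<mu>| \<le>o |V|" using mY YV ordLeq_transitive by blast
    ultimately show ?thesis
      by (meson card_of_Card_order card_of_Times_ordLeq_infinite_Field Field_card_of iV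
          card_of_Sigma_ordLeq_infinite ordLeq_transitive)
  qed
  moreover have "|V| \<le>o |?S|"
  proof -
    \<comment> \<open>For the lower bound constant sequences suffice, but their length must be
      nonzero; enumerating a singleton provides a nonempty initial segment.\<close>
    have "\<exists>a \<in> Field \<mu>. underS \<mu> a \<noteq> {}"
      using less_mu_enum[of "{undefined :: 'u}"] finite_less_mu[of "{undefined :: 'u}"]
      by (force simp: bij_betw_def)
    then obtain a where a: "a \<in> Field \<mu>" "underS \<mu> a \<noteq> {}" by blast
    have "inj_on (\<lambda>x. (a, \<lambda>i \<in> underS \<mu> a. x)) V"
      using a(2) by (auto simp: inj_on_def restrict_def fun_eq_iff split: if_splits)
    then show ?thesis using a(1) by (intro card_of_ordLeqI) auto
  qed
  ultimately have "cpow_less |V| \<mu> =o |V|"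
    unfolding cpow_less_def Field_card_of by (simp add: ordIso_iff_ordLeq)
  moreover have "|Z| \<le>o |V|" "\<mu> \<le>o |V|" using ZY \<mu>Y YV ordLeq_transitive by blast+
  ultimately show ?thesis using V(1) iV
    by (intro exI[of _ "|V|"]) (simp add: cinfinite_def Field_card_of card_of_card_order_on)
qed

end

section \<open>Categories\<close>

lemma homD:
  assumes "f \<in> hom C X Y" shows "f \<in> Arr C" "Dom C f = X" "Cod C f = Y"
  using assms by (auto simp: hom_def)

lemma hom_Ob:
  assumes "category C" "f \<in> hom C X Y" shows "X \<in> Ob C" "Y \<in> Ob C"
  using assms by (auto simp: hom_def category_def)

lemma Arr_hom: "f \<in> Arr C \<Longrightarrow> f \<in> hom C (Dom C f) (Cod C f)"
  by (auto simp: hom_def)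

lemma Idn_hom: "category C \<Longrightarrow> X \<in> Ob C \<Longrightarrow> Idn C X \<in> hom C X X"
  by (simp add: category_def)

lemma Cmp_hom: "category C \<Longrightarrow> f \<in> hom C X Y \<Longrightarrow> g \<in> hom C Y Z \<Longrightarrow> Cmp C g f \<in> hom C X Z"
  unfolding category_def hom_def by auto

lemma Cmp_Idn: "category C \<Longrightarrow> f \<in> hom C X Y \<Longrightarrow> Cmp C f (Idn C X) = f"
  unfolding category_def hom_def by auto

lemma Idn_Cmp: "category C \<Longrightarrow> f \<in> hom C X Y \<Longrightarrow> Cmp C (Idn C Y) f = f"
  unfolding category_def hom_def by auto

lemma Cmp_assoc:
  "category C \<Longrightarrow> f \<in> hom C W X \<Longrightarrow> g \<in> hom C X Y \<Longrightarrow> h \<in> hom C Y Z \<Longrightarrow>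
   Cmp C h (Cmp C g f) = Cmp C (Cmp C h g) f"
  unfolding category_def hom_def by auto

lemma mono_cancel:
  "mono_arr C f \<Longrightarrow> f \<in> hom C Y Z \<Longrightarrow> g \<in> hom C X Y \<Longrightarrow> h \<in> hom C X Y \<Longrightarrow>
   Cmp C f g = Cmp C f h \<Longrightarrow> g = h"
  unfolding mono_arr_def hom_def by auto

lemma iso_arrE:
  assumes "iso_arr C f" "f \<in> hom C X Y"
  obtains g where "g \<in> hom C Y X" "Cmp C g f = Idn C X" "Cmp C f g = Idn C Y"
  using assms unfolding iso_arr_def hom_def by auto

lemma iso_arrI:
  assumes "f \<in> hom C X Y" "g \<in> hom C Y X" "Cmp C g f = Idn C X" "Cmp C f g = Idn C Y"
  shows "iso_arr C f"
  using assms unfolding iso_arr_def hom_def by auto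

lemma functor_Ob: "is_functor C D F \<Longrightarrow> X \<in> Ob C \<Longrightarrow> FOb F X \<in> Ob D"
  by (simp add: is_functor_def)

lemma functor_hom: "is_functor C D F \<Longrightarrow> f \<in> hom C X Y \<Longrightarrow> FArr F f \<in> hom D (FOb F X) (FOb F Y)"
  unfolding is_functor_def by (auto simp: hom_def)

lemma functor_Idn: "is_functor C D F \<Longrightarrow> X \<in> Ob C \<Longrightarrow> FArr F (Idn C X) = Idn D (FOb F X)"
  by (simp add: is_functor_def)

lemma functor_Cmp:
  "is_functor C D F \<Longrightarrow> f \<in> hom C X Y \<Longrightarrow> g \<in> hom C Y Z \<Longrightarrow>
   FArr F (Cmp C g f) = Cmp D (FArr F g) (FArr F f)"
  unfolding is_functor_def by (auto simp: hom_def)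

text \<open>Fully faithful and essentially surjective: a single functor carries all the data, so
  this is the form in which equivalences are both used and constructed.\<close>

definition weak_equivalence :: "('o, 'm) cat \<Rightarrow> ('p, 'n) cat \<Rightarrow> ('o, 'm, 'p, 'n) ftor \<Rightarrow> bool" where
  "weak_equivalence C D F \<longleftrightarrow>
     is_functor C D F \<and>
     (\<forall>X \<in> Ob C. \<forall>Y \<in> Ob C. bij_betw (FArr F) (hom C X Y) (hom D (FOb F X) (FOb F Y))) \<and>
     (\<forall>Z \<in> Ob D. \<exists>X \<in> Ob C. \<exists>t \<in> hom D (FOb F X) Z. iso_arr D t)"

text \<open>By naturality the image of \<open>f\<close> under \<open>G\<close> after
  \<open>F\<close> determines the composite of \<open>f\<close> with \<open>t X\<close>, and
  \<open>t X\<close> has a right inverse. The two functors play symmetric parts in an equivalence,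
  so the lemma is applied to \<open>F\<close> and to \<open>G\<close>.\<close>

lemma iso_retract_faithful:
  assumes C: "category C" and D: "category D" and F: "is_functor C D F" and G: "is_functor D C G"
    and t: "\<And>X. X \<in> Ob C \<Longrightarrow> t X \<in> hom C (FOb G (FOb F X)) X \<and> iso_arr C (t X)"
    and nat: "\<And>f X Y. f \<in> hom C X Y \<Longrightarrow> Cmp C f (t X) = Cmp C (t Y) (FArr G (FArr F f))"
    and f: "f \<in> hom C X Y" and g: "g \<in> hom C X Y" and eq: "FArr F f = FArr F g"
  shows "f = g"
proof -
  have X: "X \<in> Ob C" using hom_Ob[OF C f] by simp
  obtain t' where t': "t' \<in> hom C X (FOb G (FOb F X))" "Cmp C (t X) t' = Idn C X"
    using t[OF X] by (meson iso_arrE)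
  have "Cmp C f (t X) = Cmp C g (t X)" using nat[OF f] nat[OF g] eq by simp
  then have "Cmp C f (Cmp C (t X) t') = Cmp C g (Cmp C (t X) t')"
    using Cmp_assoc[OF C t'(1) conjunct1[OF t[OF X]]] f g by metis
  then show ?thesis using t'(2) Cmp_Idn[OF C] f g by simp
qed

lemma equivalent_imp_weak_equivalence:
  assumes C: "category C" and D: "category D" and eqv: "equivalent_categories C D"
  shows "\<exists>F. weak_equivalence C D F"
proof -
  obtain F G t s where F: "is_functor C D F" and G: "is_functor D C G"
    and t': "\<forall>X \<in> Ob C. t X \<in> hom C (FOb G (FOb F X)) X \<and> iso_arr C (t X)"
    and nat_t: "\<forall>f \<in> Arr C. Cmp C f (t (Dom C f)) = Cmp C (t (Cod C f)) (FArr G (FArr F f))"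
    and s': "\<forall>X \<in> Ob D. s X \<in> hom D (FOb F (FOb G X)) X \<and> iso_arr D (s X)"
    and nat_s: "\<forall>f \<in> Arr D. Cmp D f (s (Dom D f)) = Cmp D (s (Cod D f)) (FArr F (FArr G f))"
    using eqv unfolding equivalent_categories_def naturally_isomorphic_def ftor_comp_def ftor_id_def
    by auto
  note t = t'[rule_format] and s = s'[rule_format]
  have nt: "\<And>f X Y. f \<in> hom C X Y \<Longrightarrow> Cmp C f (t X) = Cmp C (t Y) (FArr G (FArr F f))"
    using nat_t by (auto simp: hom_def)
  have ns: "\<And>f X Y. f \<in> hom D X Y \<Longrightarrow> Cmp D f (s X) = Cmp D (s Y) (FArr F (FArr G f))"
    using nat_s by (auto simp: hom_def)
  have "bij_betw (FArr F) (hom C X Y) (hom D (FOb F X) (FOb F Y))" if X: "X \<in> Ob C" and Y: "Y \<in> Ob C" for X Y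
    unfolding bij_betw_def
  proof (intro conjI equalityI subsetI)
    show "inj_on (FArr F) (hom C X Y)"
      using iso_retract_faithful[OF C D F G t nt] by (meson inj_onI)
    show "f \<in> hom D (FOb F X) (FOb F Y)" if "f \<in> FArr F ` hom C X Y" for f
      using that functor_hom[OF F] by blast
    fix \<phi> assume \<phi>: "\<phi> \<in> hom D (FOb F X) (FOb F Y)"
    have tX: "t X \<in> hom C (FOb G (FOb F X)) X" and tY: "t Y \<in> hom C (FOb G (FOb F Y)) Y"
      using t X Y by auto
    obtain t' where t': "t' \<in> hom C X (FOb G (FOb F X))" "Cmp C t' (t X) = Idn C (FOb G (FOb F X))"
      using t[OF X] by (meson iso_arrE)
    obtain u where u: "u \<in> hom C Y (FOb G (FOb F Y))" "Cmp C u (t Y) = Idn C (FOb G (FOb F Y))"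
      using t[OF Y] by (meson iso_arrE)
    have G\<phi>: "FArr G \<phi> \<in> hom C (FOb G (FOb F X)) (FOb G (FOb F Y))" using functor_hom[OF G \<phi>] .
    \<comment> \<open>The candidate preimage is \<open>G \<phi>\<close> conjugated by the
      isomorphisms \<open>t\<close>. It satisfies \<open>G (F f) = G \<phi>\<close>, and
      faithfulness of \<open>G\<close> then yields \<open>F f = \<phi>\<close>.\<close>
    define f where "f = Cmp C (Cmp C (t Y) (FArr G \<phi>)) t'"
    have tG: "Cmp C (t Y) (FArr G \<phi>) \<in> hom C (FOb G (FOb F X)) Y" using Cmp_hom[OF C G\<phi> tY] .
    have f: "f \<in> hom C X Y" unfolding f_def using Cmp_hom[OF C t'(1) tG] .
    have GFf: "FArr G (FArr F f) \<in> hom C (FOb G (FOb F X)) (FOb G (FOb F Y))"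
      using functor_hom[OF G functor_hom[OF F f]] .
    have "Cmp C f (t X) = Cmp C (t Y) (FArr G \<phi>)"
      unfolding f_def using Cmp_assoc[OF C tX t'(1) tG] t'(2) Cmp_Idn[OF C tG] by simp
    then have "Cmp C (t Y) (FArr G (FArr F f)) = Cmp C (t Y) (FArr G \<phi>)" using nt[OF f] by simp
    then have "Cmp C u (Cmp C (t Y) (FArr G (FArr F f))) = Cmp C u (Cmp C (t Y) (FArr G \<phi>))" by simp
    then have "FArr G (FArr F f) = FArr G \<phi>"
      using Cmp_assoc[OF C GFf tY u(1)] Cmp_assoc[OF C G\<phi> tY u(1)] u(2) Idn_Cmp[OF C GFf] Idn_Cmp[OF C G\<phi>]
      by simp
    then have "FArr F f = \<phi>"
      using iso_retract_faithful[OF D C G F s ns functor_hom[OF F f] \<phi>] by blast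
    then show "\<phi> \<in> FArr F ` hom C X Y" using f by blast
  qed
  moreover have "\<exists>X \<in> Ob C. \<exists>t \<in> hom D (FOb F X) Z. iso_arr D t" if "Z \<in> Ob D" for Z
    using s[OF that] functor_Ob[OF G that] by blast
  ultimately show ?thesis using F unfolding weak_equivalence_def by blast
qed

text \<open>The inverse functor is chosen objectwise by essential surjectivity and on arrows by
  fullness; every equation it must satisfy is checked after applying the faithful
  \<open>F\<close>.\<close>

lemma weak_equivalence_imp_equivalent:
  assumes C: "category C" and D: "category D" and W: "weak_equivalence C D F"
  shows "equivalent_categories C D"
proof -
  have F: "is_functor C D F"
    and ff: "\<And>X Y. X \<in> Ob C \<Longrightarrow> Y \<in> Ob C \<Longrightarrow> bij_betw (FArr F) (hom C X Y) (hom D (FOb F X) (FOb F Y))"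
    and ess: "\<And>Z. Z \<in> Ob D \<Longrightarrow> \<exists>X \<in> Ob C. \<exists>t \<in> hom D (FOb F X) Z. iso_arr D t"
    using W by (auto simp: weak_equivalence_def)
  have faithful: "f = g" if "f \<in> hom C X Y" "g \<in> hom C X Y" "FArr F f = FArr F g" for f g X Y
    using ff[of X Y] hom_Ob[OF C that(1)] that by (meson bij_betw_def inj_onD)
  have full: "\<exists>f \<in> hom C X Y. FArr F f = \<phi>"
    if "X \<in> Ob C" "Y \<in> Ob C" "\<phi> \<in> hom D (FOb F X) (FOb F Y)" for X Y \<phi>
    using ff[of X Y] that by (metis bij_betw_def imageE)
  have "\<forall>Z. \<exists>X t t'. Z \<in> Ob D \<longrightarrow> X \<in> Ob C \<and> t \<in> hom D (FOb F X) Z \<and> t' \<in> hom D Z (FOb F X) \<and>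
          Cmp D t' t = Idn D (FOb F X) \<and> Cmp D t t' = Idn D Z"
    using ess by (meson iso_arrE)
  then obtain g s s' where gs: "\<And>Z. Z \<in> Ob D \<Longrightarrow> g Z \<in> Ob C \<and> s Z \<in> hom D (FOb F (g Z)) Z \<and>
      s' Z \<in> hom D Z (FOb F (g Z)) \<and> Cmp D (s' Z) (s Z) = Idn D (FOb F (g Z)) \<and> Cmp D (s Z) (s' Z) = Idn D Z"
    by metis
  \<comment> \<open>\<open>Q \<phi>\<close> is the conjugate of \<open>\<phi>\<close> by the
    isomorphisms \<open>s\<close>. It runs between objects in the image of \<open>F\<close>, so it
    has a unique lift \<open>a \<phi>\<close>.\<close>
  define Q where "Q \<phi> = Cmp D (s' (Cod D \<phi>)) (Cmp D \<phi> (s (Dom D \<phi>)))" for \<phi>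
  have Q: "Q \<phi> \<in> hom D (FOb F (g Z)) (FOb F (g W))" if \<phi>: "\<phi> \<in> hom D Z W" for \<phi> Z W
    unfolding Q_def using homD[OF \<phi>] gs hom_Ob[OF D \<phi>] \<phi> by (metis Cmp_hom D)
  have "\<forall>\<phi>. \<exists>f. \<phi> \<in> Arr D \<longrightarrow> f \<in> hom C (g (Dom D \<phi>)) (g (Cod D \<phi>)) \<and> FArr F f = Q \<phi>"
    using full Q Arr_hom gs hom_Ob[OF D] by metis
  then obtain a where a0: "\<And>\<phi>. \<phi> \<in> Arr D \<Longrightarrow> a \<phi> \<in> hom C (g (Dom D \<phi>)) (g (Cod D \<phi>)) \<and> FArr F (a \<phi>) = Q \<phi>"
    by metis
  have a: "a \<phi> \<in> hom C (g Z) (g W)" "FArr F (a \<phi>) = Q \<phi>" if "\<phi> \<in> hom D Z W" for \<phi> Z W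
    using a0[of \<phi>] homD[OF that] by auto
  have sQ: "Cmp D (s W) (Q \<phi>) = Cmp D \<phi> (s Z)" if \<phi>: "\<phi> \<in> hom D Z W" for \<phi> Z W
  proof -
    have s: "s Z \<in> hom D (FOb F (g Z)) Z" "s W \<in> hom D (FOb F (g W)) W" "s' W \<in> hom D W (FOb F (g W))"
      "Cmp D (s W) (s' W) = Idn D W" using gs hom_Ob[OF D \<phi>] by auto
    have \<phi>s: "Cmp D \<phi> (s Z) \<in> hom D (FOb F (g Z)) W" using Cmp_hom[OF D s(1) \<phi>] .
    show ?thesis unfolding Q_def using homD[OF \<phi>] Cmp_assoc[OF D \<phi>s s(3,2)] s(4) Idn_Cmp[OF D \<phi>s] by simp
  qed
  have s_cancel: "p = q" if "W \<in> Ob D" "p \<in> hom D V (FOb F (g W))" "q \<in> hom D V (FOb F (g W))"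
    "Cmp D (s W) p = Cmp D (s W) q" for p q V W
  proof -
    have s: "s W \<in> hom D (FOb F (g W)) W" "s' W \<in> hom D W (FOb F (g W))"
      "Cmp D (s' W) (s W) = Idn D (FOb F (g W))" using gs[OF that(1)] by auto
    show ?thesis using that(4) Cmp_assoc[OF D that(2) s(1,2)] Cmp_assoc[OF D that(3) s(1,2)] s(3)
        Idn_Cmp[OF D that(2)] Idn_Cmp[OF D that(3)] by metis
  qed
  define G where "G = \<lparr>FOb = g, FArr = a\<rparr>"
  have G: "is_functor D C G"
    unfolding is_functor_def G_def ftor.simps
  proof (intro conjI ballI impI)
    show "g X \<in> Ob C" if "X \<in> Ob D" for X using gs that by blast
    show "a f \<in> hom C (g (Dom D f)) (g (Cod D f))" if "f \<in> Arr D" for f using a0 that by blast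
    fix X assume X: "X \<in> Ob D"
    have i: "Idn D X \<in> hom D X X" using Idn_hom[OF D X] .
    have gX: "g X \<in> Ob C" and sX: "s X \<in> hom D (FOb F (g X)) X" using gs X by auto
    have "Q (Idn D X) = Idn D (FOb F (g X))"
      using s_cancel[OF X Q[OF i] Idn_hom[OF D functor_Ob[OF F gX]]] sQ[OF i] Idn_Cmp[OF D sX] Cmp_Idn[OF D sX]
      by simp
    then show "a (Idn D X) = Idn C (g X)"
      using faithful[OF a(1)[OF i] Idn_hom[OF C gX]] a(2)[OF i] functor_Idn[OF F gX] by simp
  next
    fix f h assume fh: "f \<in> Arr D" "h \<in> Arr D" "Cod D f = Dom D h"
    obtain X Y Z where f: "f \<in> hom D X Y" and h: "h \<in> hom D Y Z" using fh Arr_hom by metis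
    have hf: "Cmp D h f \<in> hom D X Z" using Cmp_hom[OF D f h] .
    have Ob: "X \<in> Ob D" "Y \<in> Ob D" "Z \<in> Ob D" using hom_Ob[OF D f] hom_Ob[OF D h] by auto
    have s: "s X \<in> hom D (FOb F (g X)) X" "s Y \<in> hom D (FOb F (g Y)) Y" "s Z \<in> hom D (FOb F (g Z)) Z"
      using gs Ob by auto
    have "Cmp D (s Z) (Cmp D (Q h) (Q f)) = Cmp D (s Z) (Q (Cmp D h f))"
      using Cmp_assoc[OF D Q[OF f] Q[OF h] s(3)] sQ[OF h] sQ[OF f] sQ[OF hf]
        Cmp_assoc[OF D Q[OF f] s(2) h] Cmp_assoc[OF D s(1) f h] by simp
    then have "Cmp D (Q h) (Q f) = Q (Cmp D h f)"
      using s_cancel[OF Ob(3) Cmp_hom[OF D Q[OF f] Q[OF h]] Q[OF hf]] by simp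
    then show "a (Cmp D h f) = Cmp C (a h) (a f)"
      using faithful[OF a(1)[OF hf] Cmp_hom[OF C a(1)[OF f] a(1)[OF h]]] a(2)[OF hf]
        functor_Cmp[OF F a(1)[OF f] a(1)[OF h]] a(2)[OF f] a(2)[OF h] by simp
  qed
  have FG: "naturally_isomorphic D D (ftor_comp F G) ftor_id"
    unfolding naturally_isomorphic_def ftor_comp_def ftor_id_def G_def ftor.simps o_apply
  proof (intro exI[of _ s] conjI ballI)
    show "s X \<in> hom D (FOb F (g X)) X" if "X \<in> Ob D" for X using gs that by blast
    show "iso_arr D (s X)" if "X \<in> Ob D" for X using gs[OF that] by (meson iso_arrI)
    show "Cmp D f (s (Dom D f)) = Cmp D (s (Cod D f)) (FArr F (a f))" if "f \<in> Arr D" for f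
      using sQ[OF Arr_hom[OF that]] a0[OF that] by simp
  qed
  \<comment> \<open>The second natural isomorphism is the lift of the first: \<open>s\<close> at an
    object \<open>F X\<close> is an arrow between images of \<open>F\<close>.\<close>
  have "\<forall>X. \<exists>t. X \<in> Ob C \<longrightarrow> t \<in> hom C (g (FOb F X)) X \<and> FArr F t = s (FOb F X)"
    using full gs functor_Ob[OF F] by metis
  then obtain t where t: "\<And>X. X \<in> Ob C \<Longrightarrow> t X \<in> hom C (g (FOb F X)) X \<and> FArr F (t X) = s (FOb F X)"
    by metis
  have GF: "naturally_isomorphic C C (ftor_comp G F) ftor_id"
    unfolding naturally_isomorphic_def ftor_comp_def ftor_id_def G_def ftor.simps o_apply
  proof (intro exI[of _ t] conjI ballI)
    fix X assume X: "X \<in> Ob C"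
    show tX: "t X \<in> hom C (g (FOb F X)) X" using t X by blast
    have FX: "FOb F X \<in> Ob D" using functor_Ob[OF F X] .
    obtain t' where t': "t' \<in> hom C X (g (FOb F X))" "FArr F t' = s' (FOb F X)"
      using full[of X "g (FOb F X)"] gs[OF FX] X by blast
    have gX: "g (FOb F X) \<in> Ob C" using gs FX by blast
    show "iso_arr C (t X)"
    proof (rule iso_arrI[OF tX t'(1)])
      show "Cmp C t' (t X) = Idn C (g (FOb F X))"
        using faithful[OF Cmp_hom[OF C tX t'(1)] Idn_hom[OF C gX]] functor_Cmp[OF F tX t'(1)]
          functor_Idn[OF F gX] t'(2) t[OF X] gs[OF FX] by simp
      show "Cmp C (t X) t' = Idn C X"
        using faithful[OF Cmp_hom[OF C t'(1) tX] Idn_hom[OF C X]] functor_Cmp[OF F t'(1) tX]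
          functor_Idn[OF F X] t'(2) t[OF X] gs[OF FX] by simp
    qed
  next
    fix f assume "f \<in> Arr C"
    then obtain X Y where f: "f \<in> hom C X Y" by (meson Arr_hom)
    have X: "X \<in> Ob C" and Y: "Y \<in> Ob C" using hom_Ob[OF C f] by auto
    have Ff: "FArr F f \<in> hom D (FOb F X) (FOb F Y)" using functor_hom[OF F f] .
    have tX: "t X \<in> hom C (g (FOb F X)) X" and tY: "t Y \<in> hom C (g (FOb F Y)) Y" using t X Y by auto
    have "Cmp C f (t X) = Cmp C (t Y) (a (FArr F f))"
      using faithful[OF Cmp_hom[OF C tX f] Cmp_hom[OF C a(1)[OF Ff] tY]] functor_Cmp[OF F tX f]
        functor_Cmp[OF F a(1)[OF Ff] tY] a(2)[OF Ff] sQ[OF Ff] t X Y by simp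
    then show "Cmp C f (t (Dom C f)) = Cmp C (t (Cod C f)) (a (FArr F f))" using homD[OF f] by simp
  qed
  show ?thesis unfolding equivalent_categories_def using F G GF FG by blast
qed

section \<open>Diagrams over posets, cocones and colimits in terms of arrows\<close>

lemma poset_cat_simps [simp]:
  "Ob (poset_cat I r) = I" "Arr (poset_cat I r) = r" "Dom (poset_cat I r) = fst"
  "Cod (poset_cat I r) = snd" "Idn (poset_cat I r) = (\<lambda>i. (i, i))"
  "Cmp (poset_cat I r) = (\<lambda>g f. (fst f, snd g))"
  by (simp_all add: poset_cat_def)

lemma poset_functor_iff:
  "is_functor (poset_cat I r) C D \<longleftrightarrow>
     (\<forall>i \<in> I. FOb D i \<in> Ob C) \<and>
     (\<forall>i j. (i, j) \<in> r \<longrightarrow> FArr D (i, j) \<in> hom C (FOb D i) (FOb D j)) \<and>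
     (\<forall>i \<in> I. FArr D (i, i) = Idn C (FOb D i)) \<and>
     (\<forall>i j k. (i, j) \<in> r \<longrightarrow> (j, k) \<in> r \<longrightarrow> FArr D (i, k) = Cmp C (FArr D (j, k)) (FArr D (i, j)))"
  unfolding is_functor_def by (auto simp: Ball_def split_paired_All)

lemma poset_cocone_iff:
  "is_cocone (poset_cat I r) C D (X, c) \<longleftrightarrow>
     X \<in> Ob C \<and> c \<in> extensional I \<and> (\<forall>i \<in> I. c i \<in> hom C (FOb D i) X) \<and>
     (\<forall>i j. (i, j) \<in> r \<longrightarrow> Cmp C (c j) (FArr D (i, j)) = c i)"
  unfolding is_cocone_def by auto

lemma cocone_Ob [simp]: "s \<in> Ob (cocone_cat J C D) \<longleftrightarrow> is_cocone J C D s"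
  by (simp add: cocone_cat_def)

lemma cocone_Cmp [simp]: "Cmp (cocone_cat J C D) (t, h, v) (s, g, t') = (s, Cmp C h g, v)"
  by (simp add: cocone_cat_def)

lemma cocone_hom_iff:
  "f \<in> hom (cocone_cat J C D) s t \<longleftrightarrow> is_cocone J C D s \<and> is_cocone J C D t \<and>
     (\<exists>h \<in> hom C (fst s) (fst t). f = (s, h, t) \<and> (\<forall>j \<in> Ob J. Cmp C h (snd s j) = snd t j))"
  unfolding hom_def cocone_cat_def by auto

lemma cocone_hom_nonempty: "hom (cocone_cat J C D) s t \<noteq> {} \<longleftrightarrow> (\<exists>h. (s, h, t) \<in> hom (cocone_cat J C D) s t)"
  using cocone_hom_iff[of _ J C D s t] by (metis equals0I empty_iff)

lemma is_colimit_iff: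
  "is_colimit J C D (X, c) \<longleftrightarrow>
     is_cocone J C D (X, c) \<and>
     (\<forall>Y d. is_cocone J C D (Y, d) \<longrightarrow> (\<exists>!h. h \<in> hom C X Y \<and> (\<forall>j \<in> Ob J. Cmp C h (c j) = d j)))"
proof -
  have "(\<exists>!f. f \<in> hom (cocone_cat J C D) (X, c) (Y, d)) \<longleftrightarrow>
      (\<exists>!h. h \<in> hom C X Y \<and> (\<forall>j \<in> Ob J. Cmp C h (c j) = d j))"
    if "is_cocone J C D (X, c)" "is_cocone J C D (Y, d)" for Y d
    unfolding cocone_hom_iff using that by auto
  then show ?thesis
    unfolding is_colimit_def initial_object_def Ball_def cocone_Ob split_paired_All
    by (simp cong: conj_cong)
qed

lemma directed_posetD:
  assumes "directed_poset \<mu> (I :: 'u set) r"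
  shows "small TYPE('u) I" "r \<subseteq> I \<times> I" "\<And>i. i \<in> I \<Longrightarrow> (i, i) \<in> r"
    "\<And>i j k. (i, j) \<in> r \<Longrightarrow> (j, k) \<in> r \<Longrightarrow> (i, k) \<in> r"
    "\<And>X. X \<subseteq> I \<Longrightarrow> |X| <o \<mu> \<Longrightarrow> \<exists>j \<in> I. \<forall>i \<in> X. (i, j) \<in> r"
  using assms unfolding directed_poset_def
  by (auto dest: partial_order_onD refl_onD transD)

lemma (in sizes) directed_poset_ub:
  assumes "directed_poset \<mu> I r" "i \<in> I" "j \<in> I"
  obtains k where "k \<in> I" "(i, k) \<in> r" "(j, k) \<in> r"
  using directed_posetD(5)[OF assms(1), of "{i, j}"] assms finite_less_mu[of "{i, j}"] by auto

lemma (in sizes) directed_poset_nonempty: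
  assumes "directed_poset \<mu> I r" shows "I \<noteq> {}"
  using directed_posetD(5)[OF assms, of "{}"] finite_less_mu[of "{} :: 'u set"] by auto

section \<open>Presentable objects in categories of monomorphisms\<close>

locale lsm_category = sizes \<mu> for \<mu> :: "'u rel" +
  fixes C :: "('o, 'u) cat"
  assumes category: "category C" and locally_small: "locally_small TYPE('u) C"
    and all_mono: "\<And>f. f \<in> Arr C \<Longrightarrow> mono_arr C f"
begin

lemma cancel: "f \<in> hom C Y Z \<Longrightarrow> g \<in> hom C X Y \<Longrightarrow> h \<in> hom C X Y \<Longrightarrow> Cmp C f g = Cmp C f h \<Longrightarrow> g = h"
  using mono_cancel all_mono homD(1) by metis

lemma small_hom: "X \<in> Ob C \<Longrightarrow> Y \<in> Ob C \<Longrightarrow> small TYPE('u) (hom C X Y)"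
  using locally_small by (auto simp: locally_small_def)

text \<open>A directed colimit of sets demands that elements identified in the colimit become equal
  at some stage and that every element comes from a stage. The first holds automatically because all
  legs are monic, which leaves the second.\<close>

lemma hom_set_colimit_iff:
  assumes dir: "directed_poset \<mu> I r" and D: "is_functor (poset_cat I r) C D"
    and cc: "is_cocone (poset_cat I r) C D (X, c)" and P: "P \<in> Ob C"
  shows "is_colimit (poset_cat I r) set_cat (ftor_comp (hom_functor C P) D)
      (FOb (hom_functor C P) X, \<lambda>i \<in> I. FArr (hom_functor C P) (c i)) \<longleftrightarrow>
    (\<forall>a \<in> hom C P X. \<exists>i \<in> I. \<exists>b \<in> hom C P (FOb D i). Cmp C (c i) b = a)"
    (is "is_colimit ?J set_cat ?HD (?H, ?c) \<longleftrightarrow> ?R")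
proof -
  have X: "X \<in> Ob C" and c: "\<And>i. i \<in> I \<Longrightarrow> c i \<in> hom C (FOb D i) X"
    and cn: "\<And>i j. (i, j) \<in> r \<Longrightarrow> Cmp C (c j) (FArr D (i, j)) = c i"
    using cc by (auto simp: poset_cocone_iff)
  have DO: "\<And>i. i \<in> I \<Longrightarrow> FOb D i \<in> Ob C"
    and DA: "\<And>i j. (i, j) \<in> r \<Longrightarrow> FArr D (i, j) \<in> hom C (FOb D i) (FOb D j)"
    using D by (auto simp: poset_functor_iff)
  note dp = directed_posetD[OF dir]
  let ?h = "\<lambda>i. hom C P (FOb D i)"
  have smH: "small TYPE('u) ?H" using small_hom[OF P X] by (simp add: hom_functor_def)
  have smh: "small TYPE('u) (?h i)" if "i \<in> I" for i using small_hom[OF P DO[OF that]] .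
  have HO: "FOb ?HD i = ?h i" for i by (simp add: ftor_comp_def hom_functor_def)
  have HA: "FArr ?HD (i, j) = (?h i, \<lambda>g \<in> ?h i. Cmp C (FArr D (i, j)) g, ?h j)" if "(i, j) \<in> r" for i j
    using homD[OF DA[OF that]] by (simp add: ftor_comp_def hom_functor_def)
  have cH: "?c i = (?h i, \<lambda>g \<in> ?h i. Cmp C (c i) g, ?H)" if "i \<in> I" for i
    using homD[OF c[OF that]] that by (simp add: hom_functor_def)
  have hom_set: "hom set_cat A B = {(A, f, B) | f. small TYPE('u) A \<and> small TYPE('u) B \<and> f \<in> A \<rightarrow>\<^sub>E B}"
    for A B :: "'u set"
    by (auto simp: hom_def set_cat_def)
  have cmp_set: "Cmp set_cat (B, g, E) (A, f, B') = (A, compose A g f, E)"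
    for A B B' E :: "'u set" and f g by (simp add: set_cat_def)
  have "is_cocone ?J set_cat ?HD (?H, ?c)"
    unfolding poset_cocone_iff
  proof (intro conjI ballI allI impI)
    show "?H \<in> Ob set_cat" using smH by (simp add: set_cat_def)
    show "?c \<in> extensional I" by simp
    show "?c i \<in> hom set_cat (FOb ?HD i) ?H" if "i \<in> I" for i
      unfolding cH[OF that] HO hom_set using smh[OF that] smH Cmp_hom[OF category _ c[OF that]]
      by (auto simp: hom_functor_def)
    fix i j assume ij: "(i, j) \<in> r"
    have I: "i \<in> I" "j \<in> I" using ij dp(2) by auto
    have "compose (?h i) (\<lambda>g \<in> ?h j. Cmp C (c j) g) (\<lambda>g \<in> ?h i. Cmp C (FArr D (i, j)) g) =
        (\<lambda>g \<in> ?h i. Cmp C (c i) g)"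
    proof (rule ext)
      fix g
      show "compose (?h i) (\<lambda>g \<in> ?h j. Cmp C (c j) g) (\<lambda>g \<in> ?h i. Cmp C (FArr D (i, j)) g) g =
        (\<lambda>g \<in> ?h i. Cmp C (c i) g) g"
        using Cmp_hom[OF category _ DA[OF ij]] Cmp_assoc[OF category _ DA[OF ij] c[OF I(2)]] cn[OF ij]
        by (simp add: compose_def)
    qed
    then show "Cmp set_cat (?c j) (FArr ?HD (i, j)) = ?c i"
      unfolding cH[OF I(1)] cH[OF I(2)] HA[OF ij] cmp_set by simp
  qed
  note cocone = this
  have mediate: "Cmp set_cat (?H, h, B) (?c i) = (?h i, \<lambda>b \<in> ?h i. h (Cmp C (c i) b), B)" if "i \<in> I" for h i B
    unfolding cH[OF that] cmp_set by (auto simp: compose_def)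
  show ?thesis
  proof
    assume col: "is_colimit ?J set_cat ?HD (?H, ?c)"
    \<comment> \<open>A two-element set detects arrows that come from no stage: the constant map and
      the map \<open>f\<close>, with value \<open>y\<close> exactly on those arrows, both mediate to
      the constant cocone \<open>d\<close>, so they coincide.\<close>
    obtain x y :: 'u where xy: "x \<noteq> y" by (rule ex_two_elements)
    let ?B = "{x, y}"
    have smB: "small TYPE('u) ?B" by (simp add: finite_small)
    define d where "d = (\<lambda>i \<in> I. (?h i, \<lambda>b \<in> ?h i. x, ?B))"
    have "is_cocone ?J set_cat ?HD (?B, d)"
      unfolding poset_cocone_iff
    proof (intro conjI ballI allI impI)
      show "?B \<in> Ob set_cat" using smB by (simp add: set_cat_def)
      show "d \<in> extensional I" by (simp add: d_def)
      show "d i \<in> hom set_cat (FOb ?HD i) ?B" if "i \<in> I" for i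
        unfolding HO hom_set using smh[OF that] smB that by (auto simp: d_def)
      fix i j assume ij: "(i, j) \<in> r"
      have I: "i \<in> I" "j \<in> I" using ij dp(2) by auto
      have "compose (?h i) (\<lambda>g \<in> ?h j. x) (\<lambda>g \<in> ?h i. Cmp C (FArr D (i, j)) g) = (\<lambda>g \<in> ?h i. x)"
        using Cmp_hom[OF category _ DA[OF ij]] by (auto simp: compose_def)
      then show "Cmp set_cat (d j) (FArr ?HD (i, j)) = d i"
        unfolding HA[OF ij] using I by (simp add: d_def cmp_set)
    qed
    then have ex1: "\<exists>!h. h \<in> hom set_cat ?H ?B \<and> (\<forall>i \<in> I. Cmp set_cat h (?c i) = d i)"
      using col unfolding is_colimit_iff poset_cat_simps by blast
    define f where "f = (\<lambda>a \<in> ?H. if \<exists>i \<in> I. \<exists>b \<in> ?h i. Cmp C (c i) b = a then x else y)"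
    have H: "?H = hom C P X" by (simp add: hom_functor_def)
    have cb: "Cmp C (c i) b \<in> ?H" if "i \<in> I" "b \<in> ?h i" for i b
      unfolding H using Cmp_hom[OF category that(2) c[OF that(1)]] .
    have "(?H, \<lambda>a \<in> ?H. x, ?B) \<in> hom set_cat ?H ?B \<and> (\<forall>i \<in> I. Cmp set_cat (?H, \<lambda>a \<in> ?H. x, ?B) (?c i) = d i)"
    proof (intro conjI ballI)
      show "(?H, \<lambda>a \<in> ?H. x, ?B) \<in> hom set_cat ?H ?B" using smH smB by (auto simp: hom_set)
      fix i assume i: "i \<in> I"
      have "(\<lambda>b \<in> ?h i. (\<lambda>a \<in> ?H. x) (Cmp C (c i) b)) = (\<lambda>b \<in> ?h i. x)"
        using cb[OF i] by (auto simp: fun_eq_iff)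
      then show "Cmp set_cat (?H, \<lambda>a \<in> ?H. x, ?B) (?c i) = d i"
        unfolding mediate[OF i] using i by (simp add: d_def)
    qed
    moreover have "(?H, f, ?B) \<in> hom set_cat ?H ?B \<and> (\<forall>i \<in> I. Cmp set_cat (?H, f, ?B) (?c i) = d i)"
    proof (intro conjI ballI)
      show "(?H, f, ?B) \<in> hom set_cat ?H ?B" using smH smB by (auto simp: hom_set f_def)
      fix i assume i: "i \<in> I"
      have "f (Cmp C (c i) b) = x" if "b \<in> ?h i" for b using cb[OF i that] i that by (auto simp: f_def)
      then have "(\<lambda>b \<in> ?h i. f (Cmp C (c i) b)) = (\<lambda>b \<in> ?h i. x)" by (auto simp: fun_eq_iff)
      then show "Cmp set_cat (?H, f, ?B) (?c i) = d i"
        unfolding mediate[OF i] using i by (simp add: d_def)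
    qed
    ultimately have "(?H, \<lambda>a \<in> ?H. x, ?B) = (?H, f, ?B)"
      using ex1 unfolding Ex1_def by (elim exE conjE) (metis (no_types, lifting))
    then have "(\<lambda>a \<in> ?H. x) = f" by (simp only: prod.inject)
    then have fx: "f a = x" if "a \<in> ?H" for a using fun_cong[of _ _ a] that by force
    show ?R
    proof
      fix a assume "a \<in> hom C P X"
      then have "a \<in> ?H" by (simp add: H)
      then show "\<exists>i \<in> I. \<exists>b \<in> ?h i. Cmp C (c i) b = a"
        using fx[of a] xy unfolding f_def by (simp split: if_splits)
    qed
  next
    assume R: ?R
    show "is_colimit ?J set_cat ?HD (?H, ?c)"
      unfolding is_colimit_iff
    proof (intro conjI allI impI cocone)
      fix B d assume dc: "is_cocone ?J set_cat ?HD (B, d)"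
      have smB: "small TYPE('u) B" using dc by (simp add: poset_cocone_iff set_cat_def)
      have "\<forall>i \<in> I. \<exists>e. d i = (?h i, e, B) \<and> e \<in> ?h i \<rightarrow>\<^sub>E B"
        using dc unfolding poset_cocone_iff HO hom_set by blast
      then obtain e where e: "\<And>i. i \<in> I \<Longrightarrow> d i = (?h i, e i, B) \<and> e i \<in> ?h i \<rightarrow>\<^sub>E B"
        by metis
      have en: "e j (Cmp C (FArr D (i, j)) b) = e i b" if ij: "(i, j) \<in> r" and b: "b \<in> ?h i" for i j b
      proof -
        have I: "i \<in> I" "j \<in> I" using ij dp(2) by auto
        have "Cmp set_cat (d j) (FArr ?HD (i, j)) = d i" using dc ij by (simp add: poset_cocone_iff)
        then have "compose (?h i) (e j) (\<lambda>g \<in> ?h i. Cmp C (FArr D (i, j)) g) = e i"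
          unfolding HA[OF ij] using e[OF I(1)] e[OF I(2)] by (simp add: cmp_set)
        then show ?thesis using b by (metis compose_eq restrict_apply')
      qed
      \<comment> \<open>Elements with the same image in \<open>X\<close> already agree at a common
        later stage \<open>k\<close>, where the leg \<open>c k\<close> is cancelled; there the
        cocone \<open>d\<close> takes one value.\<close>
      have wd: "e i b = e j b'" if i: "i \<in> I" "b \<in> ?h i" and j: "j \<in> I" "b' \<in> ?h j"
        and eq: "Cmp C (c i) b = Cmp C (c j) b'" for i j b b'
      proof -
        obtain k where k: "k \<in> I" "(i, k) \<in> r" "(j, k) \<in> r" using directed_poset_ub[OF dir i(1) j(1)] .
        let ?b = "Cmp C (FArr D (i, k)) b" and ?b' = "Cmp C (FArr D (j, k)) b'"
        have "Cmp C (c k) ?b = Cmp C (c k) ?b'"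
          using Cmp_assoc[OF category i(2) DA[OF k(2)] c[OF k(1)]] Cmp_assoc[OF category j(2) DA[OF k(3)] c[OF k(1)]]
            cn k eq by simp
        then have "?b = ?b'"
          using cancel[OF c[OF k(1)] Cmp_hom[OF category i(2) DA[OF k(2)]] Cmp_hom[OF category j(2) DA[OF k(3)]]]
          by blast
        then show ?thesis using en[OF k(2) i(2)] en[OF k(3) j(2)] by simp
      qed
      have H: "?H = hom C P X" by (simp add: hom_functor_def)
      have "\<forall>a. \<exists>i b. a \<in> ?H \<longrightarrow> i \<in> I \<and> b \<in> ?h i \<and> Cmp C (c i) b = a" using R unfolding H by blast
      then obtain i b where ib: "\<And>a. a \<in> ?H \<Longrightarrow> i a \<in> I \<and> b a \<in> ?h (i a) \<and> Cmp C (c (i a)) (b a) = a"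
        by metis
      define h where "h = (\<lambda>a \<in> ?H. e (i a) (b a))"
      have hc: "h (Cmp C (c k) x) = e k x" if k: "k \<in> I" "x \<in> ?h k" for k x
      proof -
        have a: "Cmp C (c k) x \<in> ?H" unfolding H using Cmp_hom[OF category k(2) c[OF k(1)]] .
        show ?thesis unfolding h_def restrict_apply'[OF a] using ib[OF a] by (intro wd k) simp_all
      qed
      show "\<exists>!h. h \<in> hom set_cat ?H B \<and> (\<forall>j \<in> Ob (poset_cat I r). Cmp set_cat h (?c j) = d j)"
      proof (rule ex1I[of _ "(?H, h, B)"])
        have "e (i a) (b a) \<in> B" if "a \<in> ?H" for a using ib[OF that] e[of "i a"] by blast
        then have hB: "h \<in> ?H \<rightarrow>\<^sub>E B" unfolding h_def by simp
        then have "(?H, h, B) \<in> hom set_cat ?H B" unfolding hom_set using smH smB by blast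
        moreover have "Cmp set_cat (?H, h, B) (?c j) = d j" if j: "j \<in> I" for j
        proof -
          have "(\<lambda>b \<in> ?h j. h (Cmp C (c j) b)) = e j"
          proof (rule extensionalityI)
            show "e j \<in> extensional (?h j)" using e[OF j] by (simp add: PiE_def)
          qed (simp_all add: hc[OF j])
          then show ?thesis using mediate[OF j] e[OF j] by simp
        qed
        ultimately show "(?H, h, B) \<in> hom set_cat ?H B \<and> (\<forall>j \<in> Ob (poset_cat I r). Cmp set_cat (?H, h, B) (?c j) = d j)"
          by simp
        fix g assume g: "g \<in> hom set_cat ?H B \<and> (\<forall>j \<in> Ob (poset_cat I r). Cmp set_cat g (?c j) = d j)"
        then obtain g' where g': "g = (?H, g', B)" "g' \<in> ?H \<rightarrow>\<^sub>E B" by (auto simp: hom_set)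
        have "g' a = h a" if a: "a \<in> ?H" for a
        proof -
          have "(\<lambda>x \<in> ?h (i a). g' (Cmp C (c (i a)) x)) = e (i a)"
            using g ib[OF a] e[of "i a"] mediate[of "i a" g' B] g'(1) by simp
          then have "g' a = e (i a) (b a)" using ib[OF a] by (metis restrict_apply')
          then show ?thesis by (simp add: h_def a)
        qed
        then have "g' = h" using PiE_ext[OF g'(2) hB] by blast
        then show "g = (?H, h, B)" using g'(1) by simp
      qed
    qed
  qed
qed

text \<open>The usual criterion by essentially unique factorization through a stage, where
  uniqueness comes from the monic legs.\<close>

lemma presentable_iff:
  "presentable \<mu> C P \<longleftrightarrow> P \<in> Ob C \<and>
     (\<forall>I r D X c. directed_poset \<mu> I r \<and> is_functor (poset_cat I r) C D \<and>
        is_colimit (poset_cat I r) C D (X, c) \<longrightarrow>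
        (\<forall>a \<in> hom C P X. \<exists>i \<in> I. \<exists>b \<in> hom C P (FOb D i). Cmp C (c i) b = a))"
proof (cases "P \<in> Ob C")
  case P: True
  show ?thesis unfolding presentable_def preserves_directed_colimits_def
    using hom_set_colimit_iff[OF _ _ _ P] by (simp add: is_colimit_iff cong: conj_cong)
qed (simp add: presentable_def)

end

section \<open>Concrete categories with closures\<close>

lemma inj_on_image_subsetD: "inj_on f S \<Longrightarrow> A \<subseteq> S \<Longrightarrow> B \<subseteq> S \<Longrightarrow> f ` A \<subseteq> f ` B \<Longrightarrow> A \<subseteq> B"
  by (auto simp: inj_on_def subset_iff image_iff) metis

text \<open>The least subobject containing \<open>A\<close>, with subobjects compared by their
  images. The underlying sets \<open>V\<close> and maps \<open>E\<close> are parameters because two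
  concrete structures occur: \<open>U\<close> with \<open>m\<close>, and \<open>pts\<close> with
  \<open>em\<close>.\<close>

definition hull :: "('o, 'm) cat \<Rightarrow> ('o \<Rightarrow> 'u set) \<Rightarrow> ('m \<Rightarrow> 'u \<Rightarrow> 'u) \<Rightarrow> 'u set \<Rightarrow> 'o \<Rightarrow> 'm \<Rightarrow> 'o \<Rightarrow> bool" where
  "hull C V E A P m X \<longleftrightarrow> m \<in> hom C P X \<and> A \<subseteq> E m ` V P \<and>
     (\<forall>Y. \<forall>n \<in> hom C Y X. A \<subseteq> E n ` V Y \<longrightarrow> E m ` V P \<subseteq> E n ` V Y)"

lemma hullD:
  assumes "hull C V E A P m X"
  shows "m \<in> hom C P X" "A \<subseteq> E m ` V P"
    "\<And>Y n. n \<in> hom C Y X \<Longrightarrow> A \<subseteq> E n ` V Y \<Longrightarrow> E m ` V P \<subseteq> E n ` V Y"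
  using assms by (auto simp: hull_def)

text \<open>What the class contributes once it is carried over to \<open>C\<close>. Coherence
  becomes \<open>factor\<close>, the chain axioms become the two directed conditions, and
  intersections with the size bound become \<open>closure\<close>: for generating sets of size at
  most \<open>|Z|\<close> the domains of the hulls can be taken from one small set
  \<open>T\<close>.\<close>

locale concrete_category = sizes \<mu> for \<mu> :: "'u rel" +
  fixes C :: "('o, 'u) cat" and V :: "'o \<Rightarrow> 'u set" and E :: "'u \<Rightarrow> 'u \<Rightarrow> 'u"
  assumes category: "category C" and locally_small: "locally_small TYPE('u) C"
    and small_V: "X \<in> Ob C \<Longrightarrow> small TYPE('u) (V X)"
    and E_into: "f \<in> hom C X Y \<Longrightarrow> E f ` V X \<subseteq> V Y"
    and E_inj: "f \<in> hom C X Y \<Longrightarrow> inj_on (E f) (V X)"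
    and E_Cmp: "f \<in> hom C X Y \<Longrightarrow> g \<in> hom C Y W \<Longrightarrow> x \<in> V X \<Longrightarrow> E (Cmp C g f) x = E g (E f x)"
    and faithful: "f \<in> hom C X Y \<Longrightarrow> g \<in> hom C X Y \<Longrightarrow> (\<And>x. x \<in> V X \<Longrightarrow> E f x = E g x) \<Longrightarrow> f = g"
    and factor: "m \<in> hom C P X \<Longrightarrow> n \<in> hom C Y X \<Longrightarrow> E m ` V P \<subseteq> E n ` V Y \<Longrightarrow>
      \<exists>k \<in> hom C P Y. Cmp C n k = m"
    and closure: "small TYPE('u) (Z :: 'u set) \<Longrightarrow> \<exists>T. small TYPE('u) T \<and> T \<subseteq> Ob C \<and>
      (\<forall>X \<in> Ob C. \<forall>A \<subseteq> V X. |A| \<le>o |Z| \<longrightarrow> (\<exists>P \<in> T. \<exists>m. hull C V E A P m X))"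
    and directed_cocone: "directed_poset \<mu> I r \<Longrightarrow> is_functor (poset_cat I r) C D \<Longrightarrow>
      \<exists>X c. is_cocone (poset_cat I r) C D (X, c) \<and> V X \<subseteq> (\<Union>i \<in> I. E (c i) ` V (FOb D i))"
    and directed_mediator: "directed_poset \<mu> I r \<Longrightarrow> is_functor (poset_cat I r) C D \<Longrightarrow>
      is_cocone (poset_cat I r) C D (X, c) \<Longrightarrow> V X \<subseteq> (\<Union>i \<in> I. E (c i) ` V (FOb D i)) \<Longrightarrow>
      is_cocone (poset_cat I r) C D (Y, d) \<Longrightarrow> \<exists>h \<in> hom C X Y. \<forall>i \<in> I. Cmp C h (c i) = d i"
begin

lemma mono: "f \<in> Arr C \<Longrightarrow> mono_arr C f"
  unfolding mono_arr_def
proof (intro conjI ballI impI)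
  fix g h assume f: "f \<in> Arr C" and "g \<in> Arr C" "h \<in> Arr C" "Cod C g = Dom C f" "Cod C h = Dom C f"
    "Dom C g = Dom C h" and eq: "Cmp C f g = Cmp C f h"
  then have g: "g \<in> hom C (Dom C g) (Dom C f)" and h: "h \<in> hom C (Dom C g) (Dom C f)"
    by (auto simp: hom_def)
  note f' = Arr_hom[OF f]
  show "g = h"
  proof (rule faithful[OF g h])
    fix x assume x: "x \<in> V (Dom C g)"
    have "E f (E g x) = E f (E h x)" using E_Cmp[OF g f' x] E_Cmp[OF h f' x] eq by simp
    then show "E g x = E h x" using E_inj[OF f'] E_into[OF g] E_into[OF h] x by (meson image_subset_iff inj_onD)
  qed
qed

sublocale lsm_category \<mu> C
  by unfold_locales (auto simp: category locally_small mono)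

lemma E_Cmp_image: "f \<in> hom C X Y \<Longrightarrow> g \<in> hom C Y Z \<Longrightarrow> E (Cmp C g f) ` V X = E g ` E f ` V X"
  using E_Cmp by (force simp: image_iff)

text \<open>The notion is intrinsic to \<open>P\<close>, without an ambient object;
  \<open>generates_minimal\<close> shows that it persists along every arrow out of
  \<open>P\<close>.\<close>

definition generates :: "'u set \<Rightarrow> 'o \<Rightarrow> bool" where
  "generates A P \<longleftrightarrow> P \<in> Ob C \<and> A \<subseteq> V P \<and> (\<forall>Y. \<forall>n \<in> hom C Y P. A \<subseteq> E n ` V Y \<longrightarrow> V P \<subseteq> E n ` V Y)"

lemma ex_closure:
  assumes X: "X \<in> Ob C" and A: "A \<subseteq> V X"
  shows "\<exists>P m. hull C V E A P m X"
  using closure[OF small_subset[OF small_V[OF X] A]] X A ordLeq_refl[OF card_of_Card_order] by meson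

text \<open>The hull in \<open>X\<close> of the image of \<open>A\<close> lies in the image of
  \<open>P\<close>, hence comes from a subobject of \<open>P\<close> containing \<open>A\<close>. By
  generation this is all of \<open>P\<close>, so the image of \<open>P\<close> is itself the
  hull.\<close>

lemma generates_minimal:
  assumes gen: "generates A P" and a: "a \<in> hom C P X" and n: "n \<in> hom C Y X" and sub: "E a ` A \<subseteq> E n ` V Y"
  shows "E a ` V P \<subseteq> E n ` V Y"
proof -
  have AP: "A \<subseteq> V P" using gen by (simp add: generates_def)
  have "X \<in> Ob C" "E a ` A \<subseteq> V X" using hom_Ob[OF category a] E_into[OF a] AP by auto
  from ex_closure[OF this] obtain Q m where "hull C V E (E a ` A) Q m X" by blast
  note m = hullD(1,2)[OF this] and min = hullD(3)[OF this]
  \<comment> \<open>The arrow \<open>a\<close> is itself a subobject of \<open>X\<close> containing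
    the image of \<open>A\<close>.\<close>
  have "E m ` V Q \<subseteq> E a ` V P" using min[OF a] AP by blast
  then obtain k where k: "k \<in> hom C Q P" "Cmp C a k = m" using factor[OF m(1) a] by blast
  have km: "E m ` V Q = E a ` E k ` V Q" using E_Cmp_image[OF k(1) a] k(2) by simp
  have kP: "E k ` V Q \<subseteq> V P" using E_into[OF k(1)] .
  have "A \<subseteq> E k ` V Q"
    using inj_on_image_subsetD[OF E_inj[OF a] AP kP] m(2) unfolding km .
  then have "V P \<subseteq> E k ` V Q" using gen k(1) unfolding generates_def by blast
  then have "E a ` V P \<subseteq> E m ` V Q" unfolding km by blast
  then show ?thesis using min[OF n sub] by blast
qed

text \<open>A subobject of \<open>P\<close> containing the preimage of \<open>A\<close> composes
  with \<open>m\<close> to a subobject of \<open>X\<close> containing \<open>A\<close>, so the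
  minimality of the hull can be pulled back along the injective \<open>E m\<close>.\<close>

lemma closure_generates:
  assumes hull: "hull C V E A P m X"
  shows "generates {p \<in> V P. E m p \<in> A} P"
  unfolding generates_def
proof (intro conjI allI ballI impI)
  note m = hullD(1)[OF hull] and A = hullD(2)[OF hull] and min = hullD(3)[OF hull]
  show "P \<in> Ob C" using hom_Ob[OF category m] by simp
  fix Y n assume n: "n \<in> hom C Y P" and sub: "{p \<in> V P. E m p \<in> A} \<subseteq> E n ` V Y"
  have mn: "E (Cmp C m n) ` V Y = E m ` E n ` V Y" using E_Cmp_image[OF n m] .
  have "A \<subseteq> E m ` {p \<in> V P. E m p \<in> A}" using A by auto
  also have "\<dots> \<subseteq> E m ` E n ` V Y" using sub by (rule image_mono)
  finally have "A \<subseteq> E m ` E n ` V Y" .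
  then have "E m ` V P \<subseteq> E m ` E n ` V Y" using min[OF Cmp_hom[OF category n m]] mn by simp
  then show "V P \<subseteq> E n ` V Y" using inj_on_image_subsetD[OF E_inj[OF m] order_refl E_into[OF n]] by simp
qed auto

text \<open>\<open>directed_mediator\<close> gives existence; a mediator is unique because the legs
  cover \<open>X\<close> and an arrow is determined by its underlying map.\<close>

lemma surjective_cocone_colimit:
  assumes dir: "directed_poset \<mu> I r" and D: "is_functor (poset_cat I r) C D"
    and cc: "is_cocone (poset_cat I r) C D (X, c)" and surj: "V X \<subseteq> (\<Union>i \<in> I. E (c i) ` V (FOb D i))"
  shows "is_colimit (poset_cat I r) C D (X, c)"
  unfolding is_colimit_iff
proof (intro conjI allI impI cc)
  fix Y d assume dc: "is_cocone (poset_cat I r) C D (Y, d)"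
  obtain h where h: "h \<in> hom C X Y" "\<forall>i \<in> I. Cmp C h (c i) = d i"
    using directed_mediator[OF dir D cc surj dc] by blast
  show "\<exists>!h. h \<in> hom C X Y \<and> (\<forall>j \<in> Ob (poset_cat I r). Cmp C h (c j) = d j)"
  proof (rule ex1I[of _ h])
    show "h \<in> hom C X Y \<and> (\<forall>j \<in> Ob (poset_cat I r). Cmp C h (c j) = d j)" using h by simp
    fix g assume g: "g \<in> hom C X Y \<and> (\<forall>j \<in> Ob (poset_cat I r). Cmp C g (c j) = d j)"
    show "g = h"
    proof (rule faithful)
      show "g \<in> hom C X Y" "h \<in> hom C X Y" using g h by auto
      fix x assume "x \<in> V X"
      then obtain i y where i: "i \<in> I" "y \<in> V (FOb D i)" "x = E (c i) y" using surj by blast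
      have c: "c i \<in> hom C (FOb D i) X" using cc i(1) by (simp add: poset_cocone_iff)
      show "E g x = E h x"
        using E_Cmp[OF c conjunct1[OF g] i(2)] E_Cmp[OF c h(1) i(2)] g h(2) i(1,3) by simp
    qed
  qed
qed

lemma has_directed_colimits: "has_directed_colimits \<mu> C"
  unfolding has_directed_colimits_def using directed_cocone surjective_cocone_colimit by meson

text \<open>The given colimit \<open>X\<close> comes without a covering by its legs. The
  factorization is therefore found in a covered cocone \<open>X'\<close> and brought back to
  \<open>X\<close>.\<close>

lemma generates_presentable:
  assumes gen: "generates A P" and A: "|A| <o \<mu>"
  shows "presentable \<mu> C P"
  unfolding presentable_iff
proof (intro conjI allI impI ballI; (elim conjE)?)
  show "P \<in> Ob C" using gen by (simp add: generates_def)
  fix I r D X c a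
  assume dir: "directed_poset \<mu> I r" and D: "is_functor (poset_cat I r) C D"
    and col: "is_colimit (poset_cat I r) C D (X, c)" and a: "a \<in> hom C P X"
  have cc: "is_cocone (poset_cat I r) C D (X, c)" using col by (simp add: is_colimit_iff)
  have AP: "A \<subseteq> V P" using gen by (simp add: generates_def)
  obtain X' c' where cc': "is_cocone (poset_cat I r) C D (X', c')"
    and surj: "V X' \<subseteq> (\<Union>i \<in> I. E (c' i) ` V (FOb D i))"
    using directed_cocone[OF dir D] by blast
  obtain g where g: "g \<in> hom C X X'" "\<forall>i \<in> I. Cmp C g (c i) = c' i"
    using col cc' unfolding is_colimit_iff poset_cat_simps by blast
  obtain h where h: "h \<in> hom C X' X" "\<forall>i \<in> I. Cmp C h (c' i) = c i"
    using directed_mediator[OF dir D cc' surj cc] by blast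
  have c: "c i \<in> hom C (FOb D i) X" "c' i \<in> hom C (FOb D i) X'" if "i \<in> I" for i
    using cc cc' that by (auto simp: poset_cocone_iff)
  have X: "X \<in> Ob C" using cc by (simp add: poset_cocone_iff)
  \<comment> \<open>Both sides mediate from the colimit \<open>X\<close> to itself. A factorization
    of \<open>g\<close> after \<open>a\<close> through a leg of \<open>X'\<close> therefore becomes
    one of \<open>a\<close> after applying \<open>h\<close>.\<close>
  have "Cmp C h g = Idn C X"
  proof -
    have ex1: "\<exists>!k. k \<in> hom C X X \<and> (\<forall>i \<in> I. Cmp C k (c i) = c i)"
      using col cc unfolding is_colimit_iff poset_cat_simps by blast
    have "Cmp C h g \<in> hom C X X \<and> (\<forall>i \<in> I. Cmp C (Cmp C h g) (c i) = c i)"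
      using Cmp_hom[OF category g(1) h(1)] Cmp_assoc[OF category c(1) g(1) h(1)] g(2) h(2) by simp
    moreover have "Idn C X \<in> hom C X X \<and> (\<forall>i \<in> I. Cmp C (Idn C X) (c i) = c i)"
      using Idn_hom[OF category X] Idn_Cmp[OF category c(1)] by simp
    ultimately show ?thesis using ex1 by blast
  qed
  then have hga: "Cmp C h (Cmp C g a) = a"
    using Cmp_assoc[OF category a g(1) h(1)] Idn_Cmp[OF category a] by simp
  define a' where "a' = Cmp C g a"
  have a': "a' \<in> hom C P X'" unfolding a'_def using Cmp_hom[OF category a g(1)] .
  have "\<forall>x \<in> A. \<exists>i \<in> I. E a' x \<in> E (c' i) ` V (FOb D i)" using E_into[OF a'] AP surj by blast
  then obtain i where i: "\<And>x. x \<in> A \<Longrightarrow> i x \<in> I \<and> E a' x \<in> E (c' (i x)) ` V (FOb D (i x))" by metis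
  have "i ` A \<subseteq> I" using i by blast
  \<comment> \<open>Fewer than \<open>\<mu>\<close> stages are needed to reach the images of the
    generators, so a single stage \<open>j\<close> lies above all of them.\<close>
  then obtain j where j: "j \<in> I" "\<forall>k \<in> i ` A. (k, j) \<in> r"
    using directed_posetD(5)[OF dir _ less_mu_image[OF A]] by blast
  have "E a' ` A \<subseteq> E (c' j) ` V (FOb D j)"
  proof
    fix y assume "y \<in> E a' ` A"
    then obtain x z where x: "x \<in> A" "y = E (c' (i x)) z" "z \<in> V (FOb D (i x))" using i by blast
    have ij: "(i x, j) \<in> r" using j x by blast
    have d: "FArr D (i x, j) \<in> hom C (FOb D (i x)) (FOb D j)" using D ij by (simp add: poset_functor_iff)
    have "Cmp C (c' j) (FArr D (i x, j)) = c' (i x)" using cc' ij by (simp add: poset_cocone_iff)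
    then have "y = E (c' j) (E (FArr D (i x, j)) z)" using E_Cmp[OF d c(2)[OF j(1)] x(3)] x(2) by simp
    then show "y \<in> E (c' j) ` V (FOb D j)" using E_into[OF d] x(3) by blast
  qed
  from factor[OF a' c(2)[OF j(1)] generates_minimal[OF gen a' c(2)[OF j(1)] this]]
  obtain b where b: "b \<in> hom C P (FOb D j)" "Cmp C (c' j) b = a'" by blast
  have "Cmp C (c j) b = a"
    using Cmp_assoc[OF category b(1) c(2)[OF j(1)] h(1)] b(2) h(2) j(1) hga by (simp add: a'_def)
  then show "\<exists>i \<in> I. \<exists>b \<in> hom C P (FOb D i). Cmp C (c i) b = a" using j(1) b(1) by blast
qed

text \<open>The diagram is indexed by the subsets of size below \<open>\<mu>\<close>. Minimality of
  hulls and \<open>factor\<close> give the comparison arrows, and cancelling the monic legs makes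
  them functorial.\<close>

lemma colimit_of_generated:
  assumes T: "\<And>X A. X \<in> Ob C \<Longrightarrow> A \<subseteq> V X \<Longrightarrow> |A| <o \<mu> \<Longrightarrow> \<exists>P \<in> T. \<exists>m. hull C V E A P m X"
    and X: "X \<in> Ob C"
  shows "\<exists>I r D c. directed_poset \<mu> I r \<and> is_functor (poset_cat I r) C D \<and>
    (\<forall>i \<in> I. FOb D i \<in> {P \<in> T. \<exists>A. |A| <o \<mu> \<and> generates A P}) \<and> is_colimit (poset_cat I r) C D (X, c)"
proof -
  let ?A = "{A. A \<subseteq> V X \<and> |A| <o \<mu>}"
  obtain I r d where dir: "directed_poset \<mu> I r" and bij: "bij_betw d I ?A"
    and r: "\<And>i j. (i, j) \<in> r \<longleftrightarrow> i \<in> I \<and> j \<in> I \<and> d i \<subseteq> d j"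
    using ex_poset_of_subsets_less_mu[OF small_V[OF X]] by meson
  have d: "d i \<subseteq> V X" "|d i| <o \<mu>" if "i \<in> I" for i using bij_betwE[OF bij] that by auto
  have "\<forall>i. \<exists>P m. i \<in> I \<longrightarrow> P \<in> T \<and> hull C V E (d i) P m X"
    using T[OF X] d by meson
  then obtain P m where Pm: "\<And>i. i \<in> I \<Longrightarrow> P i \<in> T \<and> hull C V E (d i) (P i) (m i) X"
    by metis
  note hl = hullD[OF conjunct2[OF Pm]]
  note m = hl(1)
  have "\<forall>i j. \<exists>k. (i, j) \<in> r \<longrightarrow> k \<in> hom C (P i) (P j) \<and> Cmp C (m j) k = m i"
  proof (intro allI)
    fix i j
    show "\<exists>k. (i, j) \<in> r \<longrightarrow> k \<in> hom C (P i) (P j) \<and> Cmp C (m j) k = m i"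
    proof (cases "(i, j) \<in> r")
      case True
      then have ij: "i \<in> I" "j \<in> I" "d i \<subseteq> d j" using r by auto
      have "E (m i) ` V (P i) \<subseteq> E (m j) ` V (P j)"
        using hl(3)[OF ij(1) m[OF ij(2)]] hl(2)[OF ij(2)] ij(3) by blast
      then show ?thesis using factor[OF m[OF ij(1)] m[OF ij(2)]] by blast
    qed simp
  qed
  then obtain k where k: "\<And>i j. (i, j) \<in> r \<Longrightarrow> k i j \<in> hom C (P i) (P j) \<and> Cmp C (m j) (k i j) = m i" by metis
  define D where "D = \<lparr>FOb = P, FArr = (\<lambda>(i, j). k i j)\<rparr>"
  note dp = directed_posetD[OF dir]
  have D: "is_functor (poset_cat I r) C D"
    unfolding poset_functor_iff D_def ftor.simps prod.case
  proof (intro conjI ballI allI impI)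
    fix i assume i: "i \<in> I"
    show PO: "P i \<in> Ob C" using hom_Ob[OF category m[OF i]] by simp
    show "k i i = Idn C (P i)"
      using cancel[OF m[OF i] _ Idn_hom[OF category PO]] k[OF dp(3)[OF i]] Cmp_Idn[OF category m[OF i]] by metis
  next
    show "k i j \<in> hom C (P i) (P j)" if "(i, j) \<in> r" for i j using k that by blast
    fix i j l assume ij: "(i, j) \<in> r" and jl: "(j, l) \<in> r"
    have il: "(i, l) \<in> r" using dp(4) ij jl by blast
    have l: "l \<in> I" using jl dp(2) by blast
    have "Cmp C (m l) (Cmp C (k j l) (k i j)) = Cmp C (m l) (k i l)"
      using Cmp_assoc[OF category _ _ m[OF l]] k[OF ij] k[OF jl] k[OF il] by metis
    then show "k i l = Cmp C (k j l) (k i j)"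
      using cancel[OF m[OF l]] k[OF il] Cmp_hom[OF category] k[OF ij] k[OF jl] by metis
  qed
  have cc: "is_cocone (poset_cat I r) C D (X, restrict m I)"
    unfolding poset_cocone_iff using X m k dp(2) by (auto simp: D_def)
  have "V X \<subseteq> (\<Union>i \<in> I. E (restrict m I i) ` V (FOb D i))"
  proof
    \<comment> \<open>Singletons occur among the indexing subsets, so the legs cover
      \<open>X\<close>.\<close>
    fix x assume x: "x \<in> V X"
    then have "{x} \<in> d ` I" unfolding bij_betw_imp_surj_on[OF bij] by (simp add: finite_less_mu)
    then obtain i where i: "i \<in> I" "{x} = d i" by (elim imageE)
    have "x \<in> E (m i) ` V (P i)" using hl(2)[OF i(1)] i(2) by blast
    then show "x \<in> (\<Union>i \<in> I. E (restrict m I i) ` V (FOb D i))" using i by (auto simp: D_def)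
  qed
  then have col: "is_colimit (poset_cat I r) C D (X, restrict m I)"
    using surjective_cocone_colimit[OF dir D cc] by blast
  have "FOb D i \<in> {P \<in> T. \<exists>A. |A| <o \<mu> \<and> generates A P}" if i: "i \<in> I" for i
  proof -
    let ?B = "{p \<in> V (P i). E (m i) p \<in> d i}"
    \<comment> \<open>\<open>?B\<close> is the generating set of \<open>P i\<close>; the injection
      into \<open>d i\<close> bounds it by \<open>\<mu>\<close>.\<close>
    have "inj_on (E (m i)) ?B" using E_inj[OF m[OF i]] by (rule inj_on_subset) blast
    then have "|?B| \<le>o |d i|" by (rule card_of_ordLeqI) blast
    then have "|?B| <o \<mu>" using d(2)[OF i] ordLeq_ordLess_trans by blast
    moreover have "generates ?B (P i)" using closure_generates Pm[OF i] by blast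
    ultimately show ?thesis using Pm[OF i] by (auto simp: D_def)
  qed
  then show ?thesis using dir D col by blast
qed

text \<open>Taking \<open>Field \<mu>\<close> as the bound in \<open>closure\<close> handles all
  sets of size below \<open>\<mu>\<close> at once, so one small \<open>T\<close> contains all the
  generators.\<close>

lemma accessible: "accessible \<mu> C"
proof -
  obtain T where smT: "small TYPE('u) T"
    and T: "\<And>X A. X \<in> Ob C \<Longrightarrow> A \<subseteq> V X \<Longrightarrow> |A| \<le>o |Field \<mu>| \<Longrightarrow> \<exists>P \<in> T. \<exists>m. hull C V E A P m X"
    using closure[OF small_Field_mu] by meson
  have le: "|A| \<le>o |Field \<mu>|" if "|A| <o \<mu>" for A :: "'u set"
    using that Cinfinite_mu
    by (meson card_of_Field_ordIso ordIso_symmetric ordLess_imp_ordLeq ordLeq_ordIso_trans)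
  let ?S = "{P \<in> T. \<exists>A. |A| <o \<mu> \<and> generates A P}"
  have "small TYPE('u) ?S" using smT by (rule small_subset) blast
  moreover have "\<forall>X \<in> ?S. presentable \<mu> C X" using generates_presentable by blast
  moreover have "\<forall>X \<in> Ob C. \<exists>I r D c. directed_poset \<mu> I r \<and> is_functor (poset_cat I r) C D \<and>
           (\<forall>i \<in> I. FOb D i \<in> ?S) \<and> is_colimit (poset_cat I r) C D (X, c)"
    using colimit_of_generated[OF T[OF _ _ le]] by blast
  ultimately show ?thesis unfolding accessible_def using has_directed_colimits by blast
qed

text \<open>Two generated cocones with arrows to a common cocone factor through each other over it.
  This one fact gives the uniqueness of the member and the mediating endomorphism, whose uniqueness
  is cancellation of a monomorphism.\<close>

lemma has_polycolimits: "has_polycolimits TYPE('u) C"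
  unfolding has_polycolimits_def
proof (intro allI impI, elim conjE)
  fix J :: "('u, 'u) cat" and D
  assume J: "small_category TYPE('u) J" and D: "is_functor J C D"
  have catJ: "category J" using J by (simp add: small_category_def)
  \<comment> \<open>The legs of a cocone reach at most \<open>|?W|\<close> elements of its apex, a
    bound that does not depend on the apex.\<close>
  let ?W = "SIGMA j : Ob J. V (FOb D j)"
  have "small TYPE('u) ?W"
    using J functor_Ob[OF D] small_V by (intro small_Sigma) (auto simp: small_category_def)
  then obtain Z :: "'u set" where Z: "small TYPE('u) Z" "|?W| =o |Z|" using small_code_set by blast
  obtain T where smT: "small TYPE('u) T" and TO: "T \<subseteq> Ob C"
    and T: "\<And>X A. X \<in> Ob C \<Longrightarrow> A \<subseteq> V X \<Longrightarrow> |A| \<le>o |Z| \<Longrightarrow> \<exists>P \<in> T. \<exists>m. hull C V E A P m X"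
    using closure[OF Z(1)] by meson
  define legs where "legs p = (\<Union>j \<in> Ob J. E (snd p j) ` V (FOb D j))" for p :: "'o \<times> ('u \<Rightarrow> 'u)"
  define G where "G = {p. is_cocone J C D p \<and> fst p \<in> T \<and> generates (legs p) (fst p)}"
  let ?K = "cocone_cat J C D"
  have coc: "fst p \<in> Ob C" "snd p \<in> extensional (Ob J)" "\<And>j. j \<in> Ob J \<Longrightarrow> snd p j \<in> hom C (FOb D j) (fst p)"
    "\<And>u. u \<in> Arr J \<Longrightarrow> Cmp C (snd p (Cod J u)) (FArr D u) = snd p (Dom J u)" if "is_cocone J C D p" for p
    using that by (auto simp: is_cocone_def)
  have legs_map: "E h ` legs p = legs q" if "(p, h, q) \<in> hom ?K p q" for h p q
  proof -
    have pq: "is_cocone J C D p" "h \<in> hom C (fst p) (fst q)" "\<And>j. j \<in> Ob J \<Longrightarrow> Cmp C h (snd p j) = snd q j"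
      using that unfolding cocone_hom_iff by auto
    have "E h ` E (snd p j) ` V (FOb D j) = E (snd q j) ` V (FOb D j)" if "j \<in> Ob J" for j
      using E_Cmp_image[OF coc(3)[OF pq(1) that] pq(2)] pq(3)[OF that] by simp
    then show ?thesis unfolding legs_def image_UN by simp
  qed
  have legs_V: "legs p \<subseteq> V (fst p)" if "is_cocone J C D p" for p
    unfolding legs_def using E_into[OF coc(3)[OF that]] by blast
  have smG: "small TYPE('u) G"
  proof (rule small_subset)
    show "small TYPE('u) (SIGMA P : T. PiE (Ob J) (\<lambda>j. hom C (FOb D j) P))"
      using J smT small_hom functor_Ob[OF D] TO by (intro small_Sigma small_PiE) (auto simp: small_category_def)
    show "G \<subseteq> (SIGMA P : T. PiE (Ob J) (\<lambda>j. hom C (FOb D j) P))"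
      using coc(2,3) by (auto simp: G_def PiE_def)
  qed
  \<comment> \<open>The hull of the legs inside the apex of \<open>q\<close> carries a cocone,
    because each leg factors through the hull and the equations hold after the monic
    \<open>m\<close>.\<close>
  have below: "\<exists>p \<in> G. hom ?K p q \<noteq> {}" if q: "is_cocone J C D q" for q
  proof -
    have "legs q = (\<lambda>(j, x). E (snd q j) x) ` ?W" by (auto simp: legs_def)
    then have "|legs q| \<le>o |?W|" using card_of_image by simp
    then have "|legs q| \<le>o |Z|" using Z(2) ordLeq_ordIso_trans by blast
    then obtain P m where P: "P \<in> T" and hull: "hull C V E (legs q) P m (fst q)"
      using T[OF coc(1)[OF q] legs_V[OF q]] by blast
    note m = hullD(1)[OF hull] and leg = hullD(2)[OF hull]
    have "\<forall>j. \<exists>b. j \<in> Ob J \<longrightarrow> b \<in> hom C (FOb D j) P \<and> Cmp C m b = snd q j"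
    proof (intro allI)
      fix j
      show "\<exists>b. j \<in> Ob J \<longrightarrow> b \<in> hom C (FOb D j) P \<and> Cmp C m b = snd q j"
      proof (cases "j \<in> Ob J")
        case True
        then have "E (snd q j) ` V (FOb D j) \<subseteq> E m ` V P" using leg by (auto simp: legs_def)
        then show ?thesis using factor[OF coc(3)[OF q True] m] by blast
      qed simp
    qed
    then obtain b where b: "\<And>j. j \<in> Ob J \<Longrightarrow> b j \<in> hom C (FOb D j) P \<and> Cmp C m (b j) = snd q j" by metis
    let ?p = "(P, restrict b (Ob J))"
    have pc: "is_cocone J C D ?p"
      unfolding is_cocone_def prod.case
    proof (intro conjI ballI)
      show "P \<in> Ob C" using P TO by blast
      show "restrict b (Ob J) j \<in> hom C (FOb D j) P" if "j \<in> Ob J" for j using b that by simp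
      fix u assume u: "u \<in> Arr J"
      have uO: "Dom J u \<in> Ob J" "Cod J u \<in> Ob J" using hom_Ob[OF catJ Arr_hom[OF u]] by auto
      have Du: "FArr D u \<in> hom C (FOb D (Dom J u)) (FOb D (Cod J u))" using functor_hom[OF D Arr_hom[OF u]] .
      have "Cmp C m (Cmp C (b (Cod J u)) (FArr D u)) = Cmp C m (b (Dom J u))"
        using Cmp_assoc[OF category Du _ m] b[OF uO(1)] b[OF uO(2)] coc(4)[OF q u] by metis
      then have "Cmp C (b (Cod J u)) (FArr D u) = b (Dom J u)"
        using cancel[OF m] Cmp_hom[OF category Du] b[OF uO(1)] b[OF uO(2)] by metis
      then show "Cmp C (restrict b (Ob J) (Cod J u)) (FArr D u) = restrict b (Ob J) (Dom J u)" using uO by simp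
    qed simp
    have mK: "(?p, m, q) \<in> hom ?K ?p q" unfolding cocone_hom_iff using pc q m b by auto
    \<comment> \<open>Injectivity of \<open>E m\<close> makes the new legs the full preimage of the
      old ones, which is the generating set in \<open>closure_generates\<close>.\<close>
    have "legs ?p = {x \<in> V P. E m x \<in> legs q}"
      using legs_map[OF mK] legs_V[OF pc] E_inj[OF m] by (auto dest: inj_onD)
    then have "generates (legs ?p) P" using closure_generates[OF hull] by simp
    then have "?p \<in> G" unfolding G_def using pc P by simp
    then show ?thesis using mK by blast
  qed
  \<comment> \<open>\<open>f\<close> and \<open>g\<close> carry the legs to the same subset of the
    apex of \<open>s\<close>. Since \<open>p\<close> is generated by its legs, its whole image lies
    in that of \<open>q\<close>.\<close>
  have lift: "\<exists>k. (p, k, q) \<in> hom ?K p q \<and> Cmp C g k = f"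
    if p: "p \<in> G" and f: "(p, f, s) \<in> hom ?K p s" and g: "(q, g, s) \<in> hom ?K q s" for p q s f g
  proof -
    have f': "f \<in> hom C (fst p) (fst s)" and g': "g \<in> hom C (fst q) (fst s)"
      and pc: "is_cocone J C D p" and qc: "is_cocone J C D q"
      and fg: "\<And>j. j \<in> Ob J \<Longrightarrow> Cmp C f (snd p j) = Cmp C g (snd q j)"
      using f g unfolding cocone_hom_iff by auto
    have gen: "generates (legs p) (fst p)" using p by (simp add: G_def)
    have "E f ` legs p \<subseteq> E g ` V (fst q)" using legs_map[OF f] legs_map[OF g] legs_V[OF qc] by blast
    from factor[OF f' g' generates_minimal[OF gen f' g' this]]
    obtain k where k: "k \<in> hom C (fst p) (fst q)" "Cmp C g k = f" by blast
    have "Cmp C k (snd p j) = snd q j" if j: "j \<in> Ob J" for j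
    proof (rule cancel[OF g'])
      show "Cmp C k (snd p j) \<in> hom C (FOb D j) (fst q)" using Cmp_hom[OF category coc(3)[OF pc j] k(1)] .
      show "snd q j \<in> hom C (FOb D j) (fst q)" using coc(3)[OF qc j] .
      show "Cmp C g (Cmp C k (snd p j)) = Cmp C g (snd q j)"
        using Cmp_assoc[OF category coc(3)[OF pc j] k(1) g'] k(2) fg[OF j] by simp
    qed
    then show ?thesis using k pc qc unfolding cocone_hom_iff by blast
  qed
  \<comment> \<open>\<open>R\<close> is a preorder, and by \<open>lift\<close> it is symmetric on
    \<open>G\<close>; one representative of each of its classes is needed.\<close>
  define R where "R p q \<longleftrightarrow> hom ?K p q \<noteq> {}" for p q
  have Gc: "is_cocone J C D p" if "p \<in> G" for p using that by (simp add: G_def)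
  have idK: "(p, Idn C (fst p), p) \<in> hom ?K p p" if p: "is_cocone J C D p" for p
    unfolding cocone_hom_iff using p Idn_hom[OF category coc(1)[OF p]] Idn_Cmp[OF category coc(3)[OF p]] by auto
  have homE: "\<exists>h. f = (p, h, q)" if "f \<in> hom ?K p q" for f p q using that unfolding cocone_hom_iff by blast
  have R_lift: "R p q" if pG: "p \<in> G" and ps: "R p s" and qs: "R q s" for p q s
  proof -
    obtain f g where "(p, f, s) \<in> hom ?K p s" "(q, g, s) \<in> hom ?K q s"
      using ps qs homE unfolding R_def by fast
    then show ?thesis using lift[OF pG] unfolding R_def by blast
  qed
  have R_refl: "R p p" if "is_cocone J C D p" for p using idK[OF that] unfolding R_def by blast
  have R_sym: "R q p" if "q \<in> G" "R p q" for p q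
    using R_lift[OF that(1) R_refl that(2)] Gc that(1) by blast
  have R_trans: "R p s" if pq: "R p q" and qs: "R q s" for p q s
  proof -
    obtain f g where f: "(p, f, q) \<in> hom ?K p q" and g: "(q, g, s) \<in> hom ?K q s"
      using pq qs homE unfolding R_def by fast
    have c: "is_cocone J C D p" "is_cocone J C D s"
      and fg: "f \<in> hom C (fst p) (fst q)" "g \<in> hom C (fst q) (fst s)"
      and l: "\<And>j. j \<in> Ob J \<Longrightarrow> Cmp C f (snd p j) = snd q j" "\<And>j. j \<in> Ob J \<Longrightarrow> Cmp C g (snd q j) = snd s j"
      using f g unfolding cocone_hom_iff by auto
    have "Cmp C (Cmp C g f) (snd p j) = snd s j" if j: "j \<in> Ob J" for j
      using Cmp_assoc[OF category coc(3)[OF c(1) j] fg] l[OF j] by simp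
    then have "(p, Cmp C g f, s) \<in> hom ?K p s"
      unfolding cocone_hom_iff using c Cmp_hom[OF category fg] by blast
    then show ?thesis unfolding R_def by blast
  qed
  define sel where "sel p = (SOME q. q \<in> G \<and> R p q)" for p
  have sel: "sel p \<in> G \<and> R p (sel p)" if "p \<in> G" for p
    unfolding sel_def by (rule someI[of _ p]) (use that R_refl Gc in blast)
  have "polyinitial TYPE('u) ?K (sel ` G)"
    unfolding polyinitial_def
  proof (intro conjI ballI)
    show "small TYPE('u) (sel ` G)" using smG by (rule small_image)
    have "sel ` G \<subseteq> G" using sel by blast
    then show "sel ` G \<subseteq> Ob ?K" using Gc by (meson cocone_Ob subset_iff)
    fix s assume "s \<in> Ob ?K"
    then have s: "is_cocone J C D s" by simp
    obtain p where p: "p \<in> G" "R p s" using below[OF s] unfolding R_def by blast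
    show "\<exists>!q. q \<in> sel ` G \<and> hom ?K q s \<noteq> {}"
    proof (rule ex1I[of _ "sel p"])
      show "sel p \<in> sel ` G \<and> hom ?K (sel p) s \<noteq> {}"
        using sel[OF p(1)] R_sym R_trans p unfolding R_def[symmetric] by blast
      fix q assume "q \<in> sel ` G \<and> hom ?K q s \<noteq> {}"
      then obtain p' where p': "p' \<in> G" "q = sel p'" "R q s" unfolding R_def by blast
      \<comment> \<open>Comparable members satisfy the same predicate \<open>R\<close>, so the
        choice in \<open>sel\<close> returns the same representative for both.\<close>
      have pp: "R p p'" "R p' p"
        using R_lift p p' sel[OF p'(1)] R_trans by blast+
      then have "R p x = R p' x" for x using R_trans by blast
      then show "q = sel p" unfolding p'(2) sel_def by simp
    qed
    fix q f g assume q: "q \<in> sel ` G" and f: "f \<in> hom ?K q s" and g: "g \<in> hom ?K q s"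
    have qG: "q \<in> G" using q sel by blast
    obtain f' g' where f': "f = (q, f', s)" and g': "g = (q, g', s)" using homE f g by meson
    obtain k where k: "(q, k, q) \<in> hom ?K q q" "Cmp C f' k = g'"
      using lift[OF qG] f g unfolding f' g' by blast
    show "\<exists>!h. h \<in> hom ?K q q \<and> Cmp ?K f h = g"
    proof (rule ex1I[of _ "(q, k, q)"])
      show "(q, k, q) \<in> hom ?K q q \<and> Cmp ?K f (q, k, q) = g" using k by (simp add: f' g')
      fix h assume h: "h \<in> hom ?K q q \<and> Cmp ?K f h = g"
      then obtain l where l: "h = (q, l, q)" using homE by blast
      have "Cmp C f' l = Cmp C f' k" using h k unfolding l f' g' cocone_Cmp by simp
      moreover have "f' \<in> hom C (fst q) (fst s)" "l \<in> hom C (fst q) (fst q)" "k \<in> hom C (fst q) (fst q)"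
        using f h k(1) unfolding l f' cocone_hom_iff by auto
      ultimately have "l = k" using cancel by blast
      then show "h = (q, k, q)" using l by simp
    qed
  qed
  then show "\<exists>I. is_polycolimit TYPE('u) J C D I" unfolding is_polycolimit_def by blast
qed

theorem locally_polypresentable: "locally_polypresentable \<mu> C"
  unfolding locally_polypresentable_def using accessible has_polycolimits by blast

end

section \<open>Structures and embeddings\<close>

lemma PiE_image_lift:
  assumes "x \<in> A \<rightarrow>\<^sub>E f ` B" shows "\<exists>y \<in> A \<rightarrow>\<^sub>E B. x = compose A f y"
proof (intro bexI)
  let ?y = "\<lambda>a \<in> A. inv_into B f (x a)"
  have "x a \<in> f ` B" if "a \<in> A" for a using assms that by auto
  then have i: "inv_into B f (x a) \<in> B" "f (inv_into B f (x a)) = x a" if "a \<in> A" for a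
    using that by (simp_all add: inv_into_into f_inv_into_f)
  then show "?y \<in> A \<rightarrow>\<^sub>E B" by simp
  show "x = compose A f ?y"
  proof (rule extensionalityI)
    show "x \<in> extensional A" using assms by (simp add: PiE_def)
  qed (simp_all add: compose_eq i)
qed

lemma compose_PiE: "x \<in> A \<rightarrow>\<^sub>E B \<Longrightarrow> f ` B \<subseteq> B' \<Longrightarrow> compose A f x \<in> A \<rightarrow>\<^sub>E B'"
  by (auto simp: compose_def)

lemma compose_compose:
  "x \<in> A \<rightarrow>\<^sub>E B \<Longrightarrow> compose A g (compose A f x) = compose A (compose B g f) x"
  by (auto simp: compose_def fun_eq_iff)

lemma compose_cong_PiE: "x \<in> A \<rightarrow>\<^sub>E B \<Longrightarrow> (\<And>b. b \<in> B \<Longrightarrow> f b = g b) \<Longrightarrow> compose A f x = compose A g x"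
  by (auto simp: compose_def fun_eq_iff)

lemma compose_PiE_ident: "x \<in> A \<rightarrow>\<^sub>E B \<Longrightarrow> (\<And>b. b \<in> B \<Longrightarrow> f b = b) \<Longrightarrow> compose A f x = x"
  by (rule extensionalityI[of _ A]) (auto simp: compose_eq PiE_def Pi_iff)

lemma is_struc_Fn: "is_struc \<tau> M \<Longrightarrow> s \<in> fun_syms \<tau> \<Longrightarrow> x \<in> fun_arity \<tau> s \<rightarrow>\<^sub>E Univ M \<Longrightarrow> Fn M s x \<in> Univ M"
  unfolding is_struc_def by (elim conjE) (drule (1) bspec, erule (1) PiE_mem)

lemma is_struc_Rl: "is_struc \<tau> M \<Longrightarrow> s \<in> rel_syms \<tau> \<Longrightarrow> Rl M s \<subseteq> rel_arity \<tau> s \<rightarrow>\<^sub>E Univ M"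
  unfolding is_struc_def by blast

text \<open>This is a structure only when \<open>B\<close> is closed under the functions of
  \<open>N\<close>, as images of embeddings are.\<close>

definition restr_struc :: "'u vocabulary \<Rightarrow> 'u struc \<Rightarrow> 'u set \<Rightarrow> 'u struc" where
  "restr_struc \<tau> N B = \<lparr>
     Univ = B,
     Fn = (\<lambda>s. if s \<in> fun_syms \<tau> then restrict (Fn N s) (fun_arity \<tau> s \<rightarrow>\<^sub>E B) else (\<lambda>x. undefined)),
     Rl = (\<lambda>s. if s \<in> rel_syms \<tau> then Rl N s \<inter> (rel_arity \<tau> s \<rightarrow>\<^sub>E B) else {})\<rparr>"

lemma Univ_restr_struc [simp]: "Univ (restr_struc \<tau> N B) = B"
  by (simp add: restr_struc_def)

lemma struc_eqI:
  assumes M: "is_struc \<tau> M" and N: "is_struc \<tau> N" and U: "Univ M = Univ N"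
    and F: "\<And>s x. s \<in> fun_syms \<tau> \<Longrightarrow> x \<in> fun_arity \<tau> s \<rightarrow>\<^sub>E Univ M \<Longrightarrow> Fn M s x = Fn N s x"
    and R: "\<And>s x. s \<in> rel_syms \<tau> \<Longrightarrow> x \<in> rel_arity \<tau> s \<rightarrow>\<^sub>E Univ M \<Longrightarrow> x \<in> Rl M s \<longleftrightarrow> x \<in> Rl N s"
  shows "M = N"
proof (rule struc.equality)
  show "Univ M = Univ N" by (rule U)
  show "Fn M = Fn N"
  proof
    fix s show "Fn M s = Fn N s"
    proof (cases "s \<in> fun_syms \<tau>")
      case True
      then have "Fn M s \<in> (fun_arity \<tau> s \<rightarrow>\<^sub>E Univ M) \<rightarrow>\<^sub>E Univ M" "Fn N s \<in> (fun_arity \<tau> s \<rightarrow>\<^sub>E Univ M) \<rightarrow>\<^sub>E Univ M"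
        using M N U by (auto simp: is_struc_def)
      then show ?thesis using F[OF True] by (rule PiE_ext)
    next
      case False then show ?thesis using M N by (simp add: is_struc_def)
    qed
  qed
  show "Rl M = Rl N"
  proof
    fix s show "Rl M s = Rl N s"
    proof (cases "s \<in> rel_syms \<tau>")
      case True
      then have "Rl M s \<subseteq> rel_arity \<tau> s \<rightarrow>\<^sub>E Univ M" "Rl N s \<subseteq> rel_arity \<tau> s \<rightarrow>\<^sub>E Univ M"
        using M N U by (auto simp: is_struc_def)
      then show ?thesis using R[OF True] by blast
    next
      case False then show ?thesis using M N by (simp add: is_struc_def)
    qed
  qed
qed simp

lemma substruc_unique: "substruc \<tau> M N \<Longrightarrow> substruc \<tau> M' N \<Longrightarrow> Univ M = Univ M' \<Longrightarrow> M = M'"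
  by (rule struc_eqI[of \<tau>]) (auto simp: substruc_def)

lemma substruc_within:
  assumes "substruc \<tau> M N" "substruc \<tau> M' N" "Univ M \<subseteq> Univ M'" shows "substruc \<tau> M M'"
proof -
  have "A \<rightarrow>\<^sub>E Univ M \<subseteq> A \<rightarrow>\<^sub>E Univ M'" for A :: "'a set" using assms(3) by (rule PiE_mono)
  then show ?thesis using assms unfolding substruc_def by (auto simp: subset_iff)
qed

text \<open>The part of a \<open>K\<close>-embedding that concerns the vocabulary alone;
  \<open>K_embedding_iff\<close> puts the order back.\<close>

definition struc_emb :: "'u vocabulary \<Rightarrow> 'u struc \<Rightarrow> 'u struc \<Rightarrow> ('u \<Rightarrow> 'u) \<Rightarrow> bool" where
  "struc_emb \<tau> M N f \<longleftrightarrow>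
     is_struc \<tau> M \<and> is_struc \<tau> N \<and> f \<in> extensional (Univ M) \<and> inj_on f (Univ M) \<and> f ` Univ M \<subseteq> Univ N \<and>
     (\<forall>s \<in> fun_syms \<tau>. \<forall>x \<in> fun_arity \<tau> s \<rightarrow>\<^sub>E Univ M.
        f (Fn M s x) = Fn N s (compose (fun_arity \<tau> s) f x)) \<and>
     (\<forall>s \<in> rel_syms \<tau>. \<forall>x \<in> rel_arity \<tau> s \<rightarrow>\<^sub>E Univ M.
        x \<in> Rl M s \<longleftrightarrow> compose (rel_arity \<tau> s) f x \<in> Rl N s)"

lemma struc_iso_iff: "struc_iso \<tau> M N f \<longleftrightarrow> struc_emb \<tau> M N f \<and> f ` Univ M = Univ N"
  unfolding struc_iso_def struc_emb_def bij_betw_def by auto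

lemma struc_emb_substruc:
  assumes f: "struc_emb \<tau> M M' f" and sub: "substruc \<tau> M' N" shows "struc_emb \<tau> M N f"
proof -
  have c: "compose A f x \<in> A \<rightarrow>\<^sub>E Univ M'" if "x \<in> A \<rightarrow>\<^sub>E Univ M" for x and A :: "'a set"
    by (rule compose_PiE[OF that]) (use f in \<open>simp add: struc_emb_def\<close>)
  show ?thesis
    using f sub c unfolding struc_emb_def substruc_def by auto
qed

lemma struc_emb_restrict:
  assumes f: "struc_emb \<tau> N P f" and sub: "substruc \<tau> M N" shows "struc_emb \<tau> M P (restrict f (Univ M))"
proof -
  have U: "Univ M \<subseteq> Univ N" using sub by (simp add: substruc_def)
  have c: "compose A (restrict f (Univ M)) x = compose A f x" if "x \<in> A \<rightarrow>\<^sub>E Univ M" for x and A :: "'a set"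
    using that by (rule compose_cong_PiE) simp
  have m: "x \<in> A \<rightarrow>\<^sub>E Univ N" if "x \<in> A \<rightarrow>\<^sub>E Univ M" for x and A :: "'a set" using that U by auto
  have F: "Fn M s x \<in> Univ M" if "s \<in> fun_syms \<tau>" "x \<in> fun_arity \<tau> s \<rightarrow>\<^sub>E Univ M" for s x
    using is_struc_Fn[OF _ that] sub by (simp add: substruc_def)
  then have FN: "Fn N s x \<in> Univ M" if "s \<in> fun_syms \<tau>" "x \<in> fun_arity \<tau> s \<rightarrow>\<^sub>E Univ M" for s x
    using sub that by (simp add: substruc_def)
  have fP: "f x \<in> Univ P" if "x \<in> Univ M" for x using f U that by (auto simp: struc_emb_def)
  have inj: "inj_on (restrict f (Univ M)) (Univ M)"
    using f U by (auto simp: struc_emb_def intro: inj_on_subset)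
  show ?thesis
    using f sub inj fP unfolding struc_emb_def substruc_def by (auto simp: c m FN)
qed

lemma struc_emb_image:
  assumes f: "struc_emb \<tau> M N f"
  shows "struc_iso \<tau> M (restr_struc \<tau> N (f ` Univ M)) f" "substruc \<tau> (restr_struc \<tau> N (f ` Univ M)) N"
proof -
  let ?M = "restr_struc \<tau> N (f ` Univ M)"
  have U: "f ` Univ M \<subseteq> Univ N" and N: "is_struc \<tau> N" and M: "is_struc \<tau> M" using f by (auto simp: struc_emb_def)
  have F: "Fn N s x \<in> f ` Univ M" if s: "s \<in> fun_syms \<tau>" and x: "x \<in> fun_arity \<tau> s \<rightarrow>\<^sub>E f ` Univ M" for s x
  proof -
    obtain y where y: "y \<in> fun_arity \<tau> s \<rightarrow>\<^sub>E Univ M" "x = compose (fun_arity \<tau> s) f y"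
      using PiE_image_lift[OF x] by blast
    have "Fn N s x = f (Fn M s y)" using f s y by (simp add: struc_emb_def)
    then show ?thesis using M s y(1) by (auto simp: is_struc_def)
  qed
  have sm: "small TYPE('a) (f ` Univ M)"
    using M card_of_image ordLeq_ordLess_trans unfolding is_struc_def small_def by blast
  have S: "is_struc \<tau> ?M"
    unfolding is_struc_def using sm F by (auto simp: restr_struc_def)
  have c: "compose A f x \<in> A \<rightarrow>\<^sub>E f ` Univ M" if "x \<in> A \<rightarrow>\<^sub>E Univ M" for x and A :: "'a set"
    using that by (rule compose_PiE) simp
  show sub: "substruc \<tau> ?M N"
    unfolding substruc_def using S N U by (auto simp: restr_struc_def)
  show "struc_iso \<tau> M ?M f"
    unfolding struc_iso_iff struc_emb_def using f S c by (auto simp: restr_struc_def struc_emb_def)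
qed

lemma struc_emb_id:
  assumes N: "is_struc \<tau> N" shows "struc_emb \<tau> N N (\<lambda>x \<in> Univ N. x)"
proof -
  have c: "compose A (\<lambda>x \<in> Univ N. x) x = x" if "x \<in> A \<rightarrow>\<^sub>E Univ N" for x and A :: "'a set"
    using that by (rule compose_PiE_ident) simp
  show ?thesis using N by (auto simp: struc_emb_def c is_struc_Fn inj_on_def)
qed

lemma substruc_restr:
  assumes sub: "substruc \<tau> M N" shows "restr_struc \<tau> N (Univ M) = M"
proof -
  have "is_struc \<tau> N" using sub by (simp add: substruc_def)
  from struc_emb_image(2)[OF struc_emb_restrict[OF struc_emb_id[OF this] sub]]
  have "substruc \<tau> (restr_struc \<tau> N (restrict (\<lambda>x \<in> Univ N. x) (Univ M) ` Univ M)) N" .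
  moreover have "restrict (\<lambda>x \<in> Univ N. x) (Univ M) ` Univ M = Univ M"
    using sub by (auto simp: substruc_def)
  ultimately show ?thesis using substruc_unique sub by fastforce
qed

lemma substruc_refl: "is_struc \<tau> N \<Longrightarrow> substruc \<tau> N N"
  using is_struc_Rl by (fastforce simp: substruc_def)

lemma struc_emb_comp:
  assumes f: "struc_emb \<tau> M N f" and g: "struc_emb \<tau> N P g"
  shows "struc_emb \<tau> M P (compose (Univ M) g f)"
proof -
  have U: "f ` Univ M \<subseteq> Univ N" "g ` Univ N \<subseteq> Univ P" using f g by (auto simp: struc_emb_def)
  have c: "compose A f x \<in> A \<rightarrow>\<^sub>E Univ N" if "x \<in> A \<rightarrow>\<^sub>E Univ M" for x and A :: "'a set"
    using compose_PiE[OF that U(1)] .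
  have F: "Fn M s x \<in> Univ M" if "s \<in> fun_syms \<tau>" "x \<in> fun_arity \<tau> s \<rightarrow>\<^sub>E Univ M" for s x
    using is_struc_Fn[OF _ that] f by (simp add: struc_emb_def)
  have "inj_on (compose (Univ M) g f) (Univ M)"
  proof (rule inj_onI)
    fix x y assume xy: "x \<in> Univ M" "y \<in> Univ M" "compose (Univ M) g f x = compose (Univ M) g f y"
    have "inj_on g (Univ N)" "inj_on f (Univ M)" using f g by (auto simp: struc_emb_def)
    moreover have "f x \<in> Univ N" "f y \<in> Univ N" "g (f x) = g (f y)" using xy U by (auto simp: compose_eq)
    ultimately show "x = y" using xy(1,2) by (meson inj_onD)
  qed
  moreover have "compose (Univ M) g f ` Univ M \<subseteq> Univ P" using U by (auto simp: compose_def)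
  moreover have "compose (Univ M) g f (Fn M s x) = Fn P s (compose (fun_arity \<tau> s) (compose (Univ M) g f) x)"
    if "s \<in> fun_syms \<tau>" "x \<in> fun_arity \<tau> s \<rightarrow>\<^sub>E Univ M" for s x
    using f g that c[OF that(2)] F[OF that] compose_compose[OF that(2), symmetric, of g f]
    by (simp add: struc_emb_def compose_eq)
  moreover have "x \<in> Rl M s \<longleftrightarrow> compose (rel_arity \<tau> s) (compose (Univ M) g f) x \<in> Rl P s"
    if "s \<in> rel_syms \<tau>" "x \<in> rel_arity \<tau> s \<rightarrow>\<^sub>E Univ M" for s x
    using f g that c[OF that(2)] compose_compose[OF that(2), symmetric, of g f] by (simp add: struc_emb_def)
  ultimately show ?thesis using f g unfolding struc_emb_def by simp
qed

text \<open>On elements \<open>k\<close> is \<open>m\<close> followed by the inverse of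
  \<open>n\<close>. It is an embedding because \<open>n\<close> is injective and reflects the
  relations.\<close>

lemma struc_emb_factor:
  assumes m: "struc_emb \<tau> M P m" and n: "struc_emb \<tau> N P n" and sub: "m ` Univ M \<subseteq> n ` Univ N"
  shows "\<exists>k. struc_emb \<tau> M N k \<and> compose (Univ M) n k = m"
proof -
  define k where "k = (\<lambda>x \<in> Univ M. inv_into (Univ N) n (m x))"
  have k: "k x \<in> Univ N" "n (k x) = m x" if "x \<in> Univ M" for x
    using sub that by (auto simp: k_def inv_into_into f_inv_into_f)
  have nk: "compose (Univ M) n k = m"
  proof (rule extensionalityI)
    show "m \<in> extensional (Univ M)" using m by (simp add: struc_emb_def)
  qed (simp_all add: compose_eq k)
  have kM: "k ` Univ M \<subseteq> Univ N" using k by blast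
  have inj_n: "inj_on n (Univ N)" and inj_m: "inj_on m (Univ M)" using m n by (auto simp: struc_emb_def)
  have c: "compose A k x \<in> A \<rightarrow>\<^sub>E Univ N" if "x \<in> A \<rightarrow>\<^sub>E Univ M" for x and A :: "'a set"
    using compose_PiE[OF that kM] .
  have cc: "compose A n (compose A k x) = compose A m x" if "x \<in> A \<rightarrow>\<^sub>E Univ M" for x and A :: "'a set"
    using compose_compose[OF that, of n k] nk by simp
  have FM: "Fn M s x \<in> Univ M" if "s \<in> fun_syms \<tau>" "x \<in> fun_arity \<tau> s \<rightarrow>\<^sub>E Univ M" for s x
    using is_struc_Fn[OF _ that] m by (simp add: struc_emb_def)
  have FN: "Fn N s x \<in> Univ N" if "s \<in> fun_syms \<tau>" "x \<in> fun_arity \<tau> s \<rightarrow>\<^sub>E Univ N" for s x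
    using is_struc_Fn[OF _ that] n by (simp add: struc_emb_def)
  have "k (Fn M s x) = Fn N s (compose (fun_arity \<tau> s) k x)"
    if s: "s \<in> fun_syms \<tau>" and x: "x \<in> fun_arity \<tau> s \<rightarrow>\<^sub>E Univ M" for s x
  proof (rule inj_onD[OF inj_n])
    show "n (k (Fn M s x)) = n (Fn N s (compose (fun_arity \<tau> s) k x))"
      using k(2)[OF FM[OF s x]] m n s x c[OF x] cc[OF x] by (simp add: struc_emb_def)
  qed (use k FM FN c s x in auto)
  moreover have "x \<in> Rl M s \<longleftrightarrow> compose (rel_arity \<tau> s) k x \<in> Rl N s"
    if s: "s \<in> rel_syms \<tau>" and x: "x \<in> rel_arity \<tau> s \<rightarrow>\<^sub>E Univ M" for s x
    using m n s x c[OF x] cc[OF x] by (simp add: struc_emb_def)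
  moreover have "inj_on k (Univ M)"
    using inj_m k(2) by (metis inj_on_def)
  ultimately have "struc_emb \<tau> M N k"
    using m n kM unfolding struc_emb_def by (simp add: k_def)
  then show ?thesis using nk by blast
qed

text \<open>The inverse arises by factoring the identity of \<open>N\<close> through
  \<open>f\<close>, regarded as an embedding.\<close>

lemma struc_iso_inv:
  assumes f: "struc_iso \<tau> M N f"
  shows "\<exists>g. struc_iso \<tau> N M g \<and> (\<forall>x \<in> Univ M. g (f x) = x) \<and> (\<forall>y \<in> Univ N. f (g y) = y)"
proof -
  have fe: "struc_emb \<tau> M N f" and fU: "f ` Univ M = Univ N" using f by (auto simp: struc_iso_iff)
  have N: "is_struc \<tau> N" using fe by (simp add: struc_emb_def)
  have "(\<lambda>x \<in> Univ N. x) ` Univ N \<subseteq> f ` Univ M" using fU by auto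
  from struc_emb_factor[OF struc_emb_id[OF N] fe this]
  obtain g where g: "struc_emb \<tau> N M g" "compose (Univ N) f g = (\<lambda>x \<in> Univ N. x)" by blast
  have fg: "f (g y) = y" if "y \<in> Univ N" for y using g(2) that by (metis compose_eq restrict_apply')
  have gU: "g ` Univ N \<subseteq> Univ M" using g by (simp add: struc_emb_def)
  have gf: "g (f x) = x" if "x \<in> Univ M" for x
  proof (rule inj_onD[of f "Univ M"])
    show "inj_on f (Univ M)" using fe by (simp add: struc_emb_def)
    show "f (g (f x)) = f x" using fg[of "f x"] fU that by blast
  qed (use that fU gU in auto)
  have "Univ M \<subseteq> g ` Univ N" using gf fU by (metis image_eqI subsetI)
  then show ?thesis using g(1) gU gf fg by (auto simp: struc_iso_iff)
qed

lemma struc_iso_unique: "struc_iso \<tau> M N f \<Longrightarrow> struc_iso \<tau> M N' f \<Longrightarrow> N = N'"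
proof -
  assume f: "struc_iso \<tau> M N f" and f': "struc_iso \<tau> M N' f"
  have U: "f ` Univ M = Univ N" "f ` Univ M = Univ N'" using f f' by (auto simp: struc_iso_iff)
  show "N = N'"
  proof (rule struc_eqI[of \<tau>])
    show "is_struc \<tau> N" "is_struc \<tau> N'" using f f' by (auto simp: struc_iso_def)
    show "Univ N = Univ N'" using U by simp
    show "Fn N s x = Fn N' s x" if s: "s \<in> fun_syms \<tau>" and x: "x \<in> fun_arity \<tau> s \<rightarrow>\<^sub>E Univ N" for s x
      using PiE_image_lift[OF x[folded U(1)]] f f' s unfolding struc_iso_def by metis
    show "x \<in> Rl N s \<longleftrightarrow> x \<in> Rl N' s" if s: "s \<in> rel_syms \<tau>" and x: "x \<in> rel_arity \<tau> s \<rightarrow>\<^sub>E Univ N" for s x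
      using PiE_image_lift[OF x[folded U(1)]] f f' s unfolding struc_iso_def by metis
  qed
qed

text \<open>Transport of structure. It turns systems of embeddings into systems of inclusions, and
  moves models into a prescribed subset of \<open>'u\<close>.\<close>

lemma ex_struc_iso:
  assumes M: "is_struc \<tau> M" and e: "inj_on e (Univ M)"
  shows "\<exists>N. struc_iso \<tau> M N (restrict e (Univ M))"
proof -
  let ?e = "restrict e (Univ M)" and ?U = "e ` Univ M"
  let ?i = "inv_into (Univ M) e"
  define N where "N = \<lparr>Univ = ?U,
    Fn = (\<lambda>s. if s \<in> fun_syms \<tau> then (\<lambda>x \<in> fun_arity \<tau> s \<rightarrow>\<^sub>E ?U. e (Fn M s (compose (fun_arity \<tau> s) ?i x))) else (\<lambda>x. undefined)),
    Rl = (\<lambda>s. if s \<in> rel_syms \<tau> then {x \<in> rel_arity \<tau> s \<rightarrow>\<^sub>E ?U. compose (rel_arity \<tau> s) ?i x \<in> Rl M s} else {})\<rparr>"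
  have iU: "?i ` ?U \<subseteq> Univ M" using e by auto
  have ci: "compose A ?i x \<in> A \<rightarrow>\<^sub>E Univ M" if "x \<in> A \<rightarrow>\<^sub>E ?U" for x and A :: "'a set"
    using compose_PiE[OF that iU] .
  have ce: "compose A ?e x \<in> A \<rightarrow>\<^sub>E ?U" if "x \<in> A \<rightarrow>\<^sub>E Univ M" for x and A :: "'a set"
    using that by (rule compose_PiE) auto
  have cie: "compose A ?i (compose A ?e x) = x" if "x \<in> A \<rightarrow>\<^sub>E Univ M" for x and A :: "'a set"
    unfolding compose_compose[OF that] using that by (rule compose_PiE_ident) (simp add: compose_eq e)
  have F: "Fn M s x \<in> Univ M" if "s \<in> fun_syms \<tau>" "x \<in> fun_arity \<tau> s \<rightarrow>\<^sub>E Univ M" for s x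
    using M that by (auto simp: is_struc_def)
  have sm: "small TYPE('a) ?U"
    using M card_of_image ordLeq_ordLess_trans unfolding is_struc_def small_def by blast
  have "is_struc \<tau> N"
    unfolding is_struc_def N_def using sm by (auto simp: F ci)
  then have "struc_iso \<tau> M N ?e"
    unfolding struc_iso_def bij_betw_def using M e by (auto simp: N_def ce cie F)
  then show ?thesis by blast
qed

section \<open>Abstract classes as categories\<close>

locale abs_class = sizes \<mu> for \<mu> :: "'u rel" +
  fixes K :: "'u abs_class"
  assumes abstract_class: "abstract_class \<mu> K"
begin

lemma models_struc: "M \<in> models K \<Longrightarrow> is_struc (voc K) M"
  using abstract_class by (simp add: abstract_class_def)

lemma models_iso: "M \<in> models K \<Longrightarrow> struc_iso (voc K) M N f \<Longrightarrow> N \<in> models K"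
  using abstract_class unfolding abstract_class_def by blast

lemma leq_models: "leq K M N \<Longrightarrow> M \<in> models K" "leq K M N \<Longrightarrow> N \<in> models K"
  using abstract_class unfolding abstract_class_def by (blast dest: partial_order_onD(4))+

lemma leq_refl: "M \<in> models K \<Longrightarrow> leq K M M"
  using abstract_class unfolding abstract_class_def by (auto dest!: partial_order_onD(1) refl_onD)

lemma leq_trans: "leq K M N \<Longrightarrow> leq K N P \<Longrightarrow> leq K M P"
  using abstract_class unfolding abstract_class_def by (auto dest!: partial_order_onD(2) dest: transD)

lemma leq_substruc: "leq K M N \<Longrightarrow> substruc (voc K) M N"
  using abstract_class by (simp add: abstract_class_def)

lemma leq_iso:
  "leq K M N \<Longrightarrow> struc_iso (voc K) N N' f \<Longrightarrow> struc_iso (voc K) M M' (restrict f (Univ M)) \<Longrightarrow> leq K M' N'"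
  using abstract_class unfolding abstract_class_def by blast

lemma leq_restr: "leq K M N \<Longrightarrow> restr_struc (voc K) N (Univ M) = M"
  using substruc_restr leq_substruc by blast

text \<open>The intermediate structure in \<open>K_embedding\<close> is a substructure of
  \<open>N\<close> with known universe, which determines it as the restriction of
  \<open>N\<close>.\<close>

lemma K_embedding_iff:
  "K_embedding K M N f \<longleftrightarrow> M \<in> models K \<and> struc_emb (voc K) M N f \<and> leq K (restr_struc (voc K) N (f ` Univ M)) N"
proof
  assume "K_embedding K M N f"
  then obtain M' where M: "M \<in> models K" and M': "Univ M' = f ` Univ M" "struc_iso (voc K) M M' f" "leq K M' N"
    unfolding K_embedding_def by blast
  have "struc_emb (voc K) M N f"
    using struc_emb_substruc[OF _ leq_substruc[OF M'(3)]] M'(2) by (simp add: struc_iso_iff)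
  then show "M \<in> models K \<and> struc_emb (voc K) M N f \<and> leq K (restr_struc (voc K) N (f ` Univ M)) N"
    using M M' leq_restr[OF M'(3)] by simp
next
  assume a: "M \<in> models K \<and> struc_emb (voc K) M N f \<and> leq K (restr_struc (voc K) N (f ` Univ M)) N"
  then show "K_embedding K M N f"
    unfolding K_embedding_def using struc_emb_image(1) leq_models(2) by (metis Univ_restr_struc)
qed

lemma K_embeddingD:
  assumes "K_embedding K M N f"
  shows "M \<in> models K" "N \<in> models K" "struc_emb (voc K) M N f" "f \<in> extensional (Univ M)"
    "inj_on f (Univ M)" "f ` Univ M \<subseteq> Univ N" "leq K (restr_struc (voc K) N (f ` Univ M)) N"
  using assms leq_models(2) unfolding K_embedding_iff struc_emb_def by auto

text \<open>Invariance of the order under isomorphism, applied to \<open>g\<close> as an isomorphism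
  onto its image.\<close>

lemma leq_transport:
  assumes le: "leq K M N" and g: "struc_emb (voc K) N P g"
  shows "leq K (restr_struc (voc K) P (g ` Univ M)) (restr_struc (voc K) P (g ` Univ N))"
proof (rule leq_iso[OF le])
  show "struc_iso (voc K) N (restr_struc (voc K) P (g ` Univ N)) g" using struc_emb_image(1)[OF g] .
  show "struc_iso (voc K) M (restr_struc (voc K) P (g ` Univ M)) (restrict g (Univ M))"
    using struc_emb_image(1)[OF struc_emb_restrict[OF g leq_substruc[OF le]]] by simp
qed

lemma K_embedding_comp:
  assumes f: "K_embedding K M N f" and g: "K_embedding K N P g"
  shows "K_embedding K M P (compose (Univ M) g f)"
proof -
  let ?g = "compose (Univ M) g f"
  have im: "?g ` Univ M = g ` f ` Univ M" by (auto simp: compose_def)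
  have "leq K (restr_struc (voc K) P (g ` f ` Univ M)) (restr_struc (voc K) P (g ` Univ N))"
    using leq_transport[OF K_embeddingD(7)[OF f] K_embeddingD(3)[OF g]] by simp
  then show ?thesis
    unfolding K_embedding_iff im
    using K_embeddingD(1)[OF f] struc_emb_comp[OF K_embeddingD(3)[OF f] K_embeddingD(3)[OF g]]
      K_embeddingD(7)[OF g] leq_trans by blast
qed

lemma K_embedding_iso: "M \<in> models K \<Longrightarrow> struc_iso (voc K) M N f \<Longrightarrow> K_embedding K M N f"
  unfolding K_embedding_def using models_iso leq_refl by (metis struc_iso_iff)

lemma K_embedding_id: "M \<in> models K \<Longrightarrow> K_embedding K M M (\<lambda>x \<in> Univ M. x)"
  by (rule K_embedding_iso) (simp_all add: struc_iso_iff struc_emb_id models_struc)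

lemma K_embedding_leq: "K_embedding K M N f \<Longrightarrow> leq K N P \<Longrightarrow> K_embedding K M P f"
proof -
  assume f: "K_embedding K M N f" and le: "leq K N P"
  obtain M' where "Univ M' = f ` Univ M" "struc_iso (voc K) M M' f" "leq K M' N"
    using f unfolding K_embedding_def by blast
  then show ?thesis
    unfolding K_embedding_def using leq_trans le leq_models(2) K_embeddingD(1)[OF f] by blast
qed

lemma hom_class_cat: "hom (class_cat K) M N = {(M, f, N) | f. K_embedding K M N f}"
  by (auto simp: hom_def class_cat_def)

lemma Cmp_class_cat [simp]: "Cmp (class_cat K) (N, g, P) (M, f, N') = (M, compose (Univ M) g f, P)"
  by (simp add: class_cat_def)

lemma Ob_class_cat [simp]: "Ob (class_cat K) = models K"
  by (simp add: class_cat_def)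

lemma Idn_class_cat [simp]: "Idn (class_cat K) M = (M, \<lambda>x \<in> Univ M. x, M)"
  by (simp add: class_cat_def)

lemma category_class_cat: "category (class_cat K)"
proof -
  have ids: "compose (Univ M) f (\<lambda>x \<in> Univ M. x) = f" "compose (Univ M) (\<lambda>x \<in> Univ N. x) f = f"
    if "K_embedding K M N f" for M N f
  proof -
    have "f \<in> extensional (Univ M)" "f ` Univ M \<subseteq> Univ N" using K_embeddingD[OF that] by auto
    then show "compose (Univ M) f (\<lambda>x \<in> Univ M. x) = f" "compose (Univ M) (\<lambda>x \<in> Univ N. x) f = f"
      by (auto simp: compose_def fun_eq_iff extensional_def)
  qed
  have assoc: "compose (Univ M) h (compose (Univ M) g f) = compose (Univ M) (compose (Univ N) h g) f"
    if "K_embedding K M N f" for M N f g h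
    using K_embeddingD(6)[OF that] by (auto simp: compose_def fun_eq_iff)
  show ?thesis
    unfolding category_def hom_class_cat
    by (auto simp: class_cat_def K_embeddingD K_embedding_id K_embedding_comp ids assoc)
qed

end

section \<open>Abstract elementary classes with intersections\<close>

context sizes begin

text \<open>The classical colimit of sets, with its elements coded in \<open>'u\<close>. Injective
  transition maps make the maps into it injective.\<close>

lemma directed_set_colimit:
  fixes A :: "'u \<Rightarrow> 'u set" and \<phi> :: "'u \<Rightarrow> 'u \<Rightarrow> 'u \<Rightarrow> 'u"
  assumes dir: "directed_poset \<mu> I r" and smA: "\<And>i. i \<in> I \<Longrightarrow> small TYPE('u) (A i)"
    and into: "\<And>i j x. (i, j) \<in> r \<Longrightarrow> x \<in> A i \<Longrightarrow> \<phi> i j x \<in> A j"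
    and inj: "\<And>i j. (i, j) \<in> r \<Longrightarrow> inj_on (\<phi> i j) (A i)"
    and comp: "\<And>i j k x. (i, j) \<in> r \<Longrightarrow> (j, k) \<in> r \<Longrightarrow> x \<in> A i \<Longrightarrow> \<phi> j k (\<phi> i j x) = \<phi> i k x"
  shows "\<exists>e :: 'u \<Rightarrow> 'u \<Rightarrow> 'u. (\<forall>i \<in> I. inj_on (e i) (A i)) \<and>
    (\<forall>i j x. (i, j) \<in> r \<longrightarrow> x \<in> A i \<longrightarrow> e j (\<phi> i j x) = e i x)"
proof -
  note dp = directed_posetD[OF dir]
  \<comment> \<open>The class of \<open>(i, x)\<close> in the disjoint union: all pairs that agree
    with it at some later stage.\<close>
  define cls where "cls i x = {(l, y). l \<in> I \<and> y \<in> A l \<and> (\<exists>k. (i, k) \<in> r \<and> (l, k) \<in> r \<and> \<phi> i k x = \<phi> l k y)}" for i x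
  have "small TYPE('u) (Pow (Sigma I A))" using dp(1) smA by (intro small_Pow small_Sigma)
  then obtain g :: "('u \<times> 'u) set \<Rightarrow> 'u" where g: "inj_on g (Pow (Sigma I A))" using small_code by blast
  have clsP: "cls i x \<in> Pow (Sigma I A)" for i x by (auto simp: cls_def)
  have "inj_on (\<lambda>x. g (cls i x)) (A i)" if i: "i \<in> I" for i
  proof (rule inj_onI)
    fix x y assume x: "x \<in> A i" and y: "y \<in> A i" and eq: "g (cls i x) = g (cls i y)"
    have "cls i x = cls i y" using g eq clsP by (meson inj_onD)
    moreover have "(i, y) \<in> cls i y" using i y dp(3)[OF i] by (auto simp: cls_def)
    ultimately have "(i, y) \<in> cls i x" by simp
    then obtain k where k: "(i, k) \<in> r" "\<phi> i k x = \<phi> i k y" by (auto simp: cls_def)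
    then show "x = y" using inj[OF k(1)] x y by (meson inj_onD)
  qed
  moreover have "cls j (\<phi> i j x) = cls i x" if ij: "(i, j) \<in> r" and x: "x \<in> A i" for i j x
  proof -
    have J: "j \<in> I" using ij dp(2) by blast
    have "(l, y) \<in> cls j (\<phi> i j x) \<longleftrightarrow> (l, y) \<in> cls i x" for l y
    proof
      assume "(l, y) \<in> cls j (\<phi> i j x)"
      then obtain k where "l \<in> I" "y \<in> A l" "(j, k) \<in> r" "(l, k) \<in> r" "\<phi> j k (\<phi> i j x) = \<phi> l k y"
        by (auto simp: cls_def)
      then show "(l, y) \<in> cls i x" using comp[OF ij _ x] dp(4)[OF ij] by (auto simp: cls_def)
    next
      assume "(l, y) \<in> cls i x"
      then obtain k where k: "l \<in> I" "y \<in> A l" "(i, k) \<in> r" "(l, k) \<in> r" "\<phi> i k x = \<phi> l k y"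
        by (auto simp: cls_def)
      have "k \<in> I" using k dp(2) by blast
      then obtain m where m: "(k, m) \<in> r" "(j, m) \<in> r" using directed_poset_ub[OF dir _ J] by blast
      have "\<phi> j m (\<phi> i j x) = \<phi> k m (\<phi> i k x)" using comp[OF ij m(2) x] comp[OF k(3) m(1) x] by simp
      also have "\<dots> = \<phi> l m y" using comp[OF k(4) m(1) k(2)] k(5) by simp
      finally show "(l, y) \<in> cls j (\<phi> i j x)" using k m dp(4)[OF k(4) m(1)] by (auto simp: cls_def)
    qed
    then show ?thesis by (auto simp: set_eq_iff)
  qed
  ultimately show ?thesis by (intro exI[of _ "\<lambda>i x. g (cls i x)"]) simp
qed

text \<open>At a common later stage the equations \<open>c i x = c j y\<close> and
  \<open>d i x = d j y\<close> both reduce to one between transition maps, since both families are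
  injective. So \<open>h\<close> is at once well defined and injective.\<close>

lemma directed_glue:
  fixes A :: "'u \<Rightarrow> 'u set"
  assumes dir: "directed_poset \<mu> I r"
    and into: "\<And>i j x. (i, j) \<in> r \<Longrightarrow> x \<in> A i \<Longrightarrow> \<phi> i j x \<in> A j"
    and c: "\<And>i. i \<in> I \<Longrightarrow> inj_on (c i) (A i)" "\<And>i j x. (i, j) \<in> r \<Longrightarrow> x \<in> A i \<Longrightarrow> c j (\<phi> i j x) = c i x"
    and d: "\<And>i. i \<in> I \<Longrightarrow> inj_on (d i) (A i)" "\<And>i j x. (i, j) \<in> r \<Longrightarrow> x \<in> A i \<Longrightarrow> d j (\<phi> i j x) = d i x"
    and X: "X = (\<Union>i \<in> I. c i ` A i)"
  shows "\<exists>h \<in> extensional X. inj_on h X \<and> (\<forall>i \<in> I. \<forall>x \<in> A i. h (c i x) = d i x)"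
proof -
  have key: "c i x = c j y \<longleftrightarrow> d i x = d j y" if i: "i \<in> I" "x \<in> A i" and j: "j \<in> I" "y \<in> A j" for i j x y
  proof -
    obtain k where k: "k \<in> I" "(i, k) \<in> r" "(j, k) \<in> r" using directed_poset_ub[OF dir i(1) j(1)] .
    have "c i x = c j y \<longleftrightarrow> c k (\<phi> i k x) = c k (\<phi> j k y)" using c(2) k i j by simp
    also have "\<dots> \<longleftrightarrow> \<phi> i k x = \<phi> j k y" using c(1)[OF k(1)] into k i j by (simp add: inj_on_eq_iff)
    also have "\<dots> \<longleftrightarrow> d k (\<phi> i k x) = d k (\<phi> j k y)" using d(1)[OF k(1)] into k i j by (simp add: inj_on_eq_iff)
    also have "\<dots> \<longleftrightarrow> d i x = d j y" using d(2) k i j by simp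
    finally show ?thesis .
  qed
  have "\<forall>z. \<exists>i x. z \<in> X \<longrightarrow> i \<in> I \<and> x \<in> A i \<and> z = c i x" unfolding X by blast
  then obtain i x where ix: "\<And>z. z \<in> X \<Longrightarrow> i z \<in> I \<and> x z \<in> A (i z) \<and> z = c (i z) (x z)" by metis
  define h where "h = (\<lambda>z \<in> X. d (i z) (x z))"
  have h: "h (c j y) = d j y" if "j \<in> I" "y \<in> A j" for j y
  proof -
    have z: "c j y \<in> X" using that X by blast
    show ?thesis using key[of "i (c j y)" "x (c j y)" j y] ix[OF z] that z by (simp add: h_def)
  qed
  have "inj_on h X"
  proof (rule inj_onI)
    fix z w assume zw: "z \<in> X" "w \<in> X" "h z = h w"
    then have "d (i z) (x z) = d (i w) (x w)" by (simp add: h_def)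
    then show "z = w" using key ix zw by metis
  qed
  then show ?thesis using h by (intro bexI[of _ h]) (auto simp: h_def)
qed

text \<open>Arities below \<open>\<mu>\<close> meet \<open>\<mu>\<close>-directedness here: fewer
  than \<open>\<mu>\<close> members contain the entries one by one, and an upper bound contains them
  together.\<close>

lemma directed_tuple:
  fixes A :: "'u \<Rightarrow> 'u set"
  assumes dir: "directed_poset \<mu> I r" and B: "|B| <o \<mu>" and x: "x \<in> B \<rightarrow>\<^sub>E (\<Union>i \<in> I. A i)"
    and mono: "\<And>i j. (i, j) \<in> r \<Longrightarrow> A i \<subseteq> A j"
  shows "\<exists>i \<in> I. x \<in> B \<rightarrow>\<^sub>E A i"
proof -
  have "\<forall>b \<in> B. \<exists>i \<in> I. x b \<in> A i" using x by auto
  then obtain i where i: "\<And>b. b \<in> B \<Longrightarrow> i b \<in> I \<and> x b \<in> A (i b)" by metis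
  then have "i ` B \<subseteq> I" by blast
  then obtain j where j: "j \<in> I" "\<forall>k \<in> i ` B. (k, j) \<in> r"
    using directed_posetD(5)[OF dir _ less_mu_image[OF B]] by blast
  then have "x b \<in> A j" if "b \<in> B" for b using i[OF that] mono j(2) that by blast
  then show ?thesis using j(1) x by (intro bexI[of _ j]) (auto simp: PiE_iff)
qed

text \<open>A structure is recovered from its universe, the graphs of its functions and its
  relations; arities below \<open>\<mu>\<close> keep the sets of tuples small.\<close>

lemma small_strucs:
  assumes voc: "is_vocabulary \<mu> \<tau>" and W: "small TYPE('u) W"
  shows "small TYPE('u) {M. is_struc \<tau> M \<and> Univ M \<subseteq> W}"
proof -
  let ?F = "SIGMA s : fun_syms \<tau>. (fun_arity \<tau> s \<rightarrow>\<^sub>E W) \<times> W"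
  let ?R = "SIGMA s : rel_syms \<tau>. rel_arity \<tau> s \<rightarrow>\<^sub>E W"
  let ?c = "\<lambda>M. (Univ M, {(s, x, y). s \<in> fun_syms \<tau> \<and> x \<in> fun_arity \<tau> s \<rightarrow>\<^sub>E Univ M \<and> y = Fn M s x},
    {(s, x). s \<in> rel_syms \<tau> \<and> x \<in> Rl M s})"
  have sm: "small TYPE('u) (Pow W \<times> Pow ?F \<times> Pow ?R)"
    using voc W less_mu_small unfolding is_vocabulary_def
    by (intro small_Sigma small_Pow small_PiE) auto
  have inj: "inj_on ?c {M. is_struc \<tau> M \<and> Univ M \<subseteq> W}"
  proof (rule inj_onI, elim CollectE conjE)
    fix M N assume M: "is_struc \<tau> M" and N: "is_struc \<tau> N" and eq: "?c M = ?c N"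
    have U: "Univ M = Univ N" using eq by simp
    show "M = N"
    proof (rule struc_eqI[OF M N U])
      fix s x assume s: "s \<in> fun_syms \<tau>" and x: "x \<in> fun_arity \<tau> s \<rightarrow>\<^sub>E Univ M"
      have "(s, x, Fn M s x) \<in> fst (snd (?c N))" unfolding eq[symmetric] using s x by simp
      then show "Fn M s x = Fn N s x" by simp
    next
      fix s x assume s: "s \<in> rel_syms \<tau>"
      have "(s, x) \<in> snd (snd (?c M)) \<longleftrightarrow> (s, x) \<in> snd (snd (?c N))" unfolding eq ..
      then show "x \<in> Rl M s \<longleftrightarrow> x \<in> Rl N s" using s by simp
    qed
  qed
  have "?c ` {M. is_struc \<tau> M \<and> Univ M \<subseteq> W} \<subseteq> Pow W \<times> Pow ?F \<times> Pow ?R"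
  proof (rule image_subsetI)
    fix M assume "M \<in> {M. is_struc \<tau> M \<and> Univ M \<subseteq> W}"
    then have M: "is_struc \<tau> M" and U: "Univ M \<subseteq> W" by auto
    have m: "B \<rightarrow>\<^sub>E Univ M \<subseteq> B \<rightarrow>\<^sub>E W" for B :: "'u set" using U by (rule PiE_mono)
    have F: "{(s, x, y). s \<in> fun_syms \<tau> \<and> x \<in> fun_arity \<tau> s \<rightarrow>\<^sub>E Univ M \<and> y = Fn M s x} \<subseteq> ?F"
      using is_struc_Fn[OF M] m U by blast
    have R: "{(s, x). s \<in> rel_syms \<tau> \<and> x \<in> Rl M s} \<subseteq> ?R" using is_struc_Rl[OF M] m by (auto simp: subset_iff)
    show "?c M \<in> Pow W \<times> Pow ?F \<times> Pow ?R"
      unfolding mem_Sigma_iff Pow_iff by (rule conjI[OF U conjI[OF F R]])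
  qed
  then show ?thesis by (rule small_inj[OF inj _ sm])
qed

end

section \<open>Factorizations, directed colimits and closures among the models\<close>

locale aec_intersections = sizes \<mu> for \<mu> :: "'u rel" +
  fixes K :: "'u abs_class"
  assumes AEC: "mu_AEC \<mu> K" and intersections: "admits_intersections K"
begin

sublocale abs_class \<mu> K
  using AEC by unfold_locales (simp add: mu_AEC_def)

text \<open>Coherence inside \<open>P\<close> relates the two images; the inverse of
  \<open>n\<close> on its image carries that relation to \<open>N\<close>.\<close>

lemma K_embedding_factor:
  assumes m: "K_embedding K M P m" and n: "K_embedding K N P n" and sub: "m ` Univ M \<subseteq> n ` Univ N"
  shows "\<exists>k. K_embedding K M N k \<and> compose (Univ M) n k = m"
proof -
  note md = K_embeddingD[OF m] and nd = K_embeddingD[OF n]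
  let ?\<tau> = "voc K"
  let ?M = "restr_struc ?\<tau> P (m ` Univ M)" and ?N = "restr_struc ?\<tau> P (n ` Univ N)"
  obtain k where k: "struc_emb ?\<tau> M N k" "compose (Univ M) n k = m"
    using struc_emb_factor[OF md(3) nd(3) sub] by blast
  have "substruc ?\<tau> ?M ?N" using substruc_within[OF leq_substruc[OF md(7)] leq_substruc[OF nd(7)]] sub by simp
  then have le: "leq K ?M ?N"
    using AEC md(7) nd(7) leq_models unfolding mu_AEC_def coherence_def by meson
  obtain g where g: "struc_iso ?\<tau> ?N N g" "\<forall>x \<in> Univ N. g (n x) = x"
    using struc_iso_inv[OF struc_emb_image(1)[OF nd(3)]] by blast
  have "leq K (restr_struc ?\<tau> N (g ` m ` Univ M)) (restr_struc ?\<tau> N (g ` n ` Univ N))"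
    using leq_transport[OF le, of N g] g(1) by (simp add: struc_iso_iff)
  moreover have "g ` n ` Univ N = Univ N" using g(1) by (simp add: struc_iso_iff)
  moreover have "restr_struc ?\<tau> N (Univ N) = N" using substruc_restr substruc_refl models_struc nd(1) by blast
  moreover have "g ` m ` Univ M = k ` Univ M"
  proof -
    have "g (m x) = k x" if "x \<in> Univ M" for x
    proof -
      have "m x = n (k x)" using k(2) that by (metis compose_eq)
      moreover have "k x \<in> Univ N" using k(1) that by (auto simp: struc_emb_def)
      ultimately show ?thesis using g(2) by simp
    qed
    then show ?thesis by (force simp: image_iff)
  qed
  ultimately have "leq K (restr_struc ?\<tau> N (k ` Univ M)) N" by simp
  then show ?thesis using k md(1) by (auto simp: K_embedding_iff)
qed

text \<open>The chain axioms speak of inclusions only. A set colimit inside \<open>'u\<close>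
  supplies an isomorphic system of genuine inclusions, whose union is then a model.\<close>

lemma ex_directed_cocone:
  assumes dir: "directed_poset \<mu> I r" and M: "\<And>i. i \<in> I \<Longrightarrow> M i \<in> models K"
    and \<phi>: "\<And>i j. (i, j) \<in> r \<Longrightarrow> K_embedding K (M i) (M j) (\<phi> i j)"
    and comp: "\<And>i j k. (i, j) \<in> r \<Longrightarrow> (j, k) \<in> r \<Longrightarrow> \<phi> i k = compose (Univ (M i)) (\<phi> j k) (\<phi> i j)"
  shows "\<exists>N c. (\<forall>i \<in> I. K_embedding K (M i) N (c i)) \<and>
    (\<forall>i j. (i, j) \<in> r \<longrightarrow> compose (Univ (M i)) (c j) (\<phi> i j) = c i) \<and> Univ N = (\<Union>i \<in> I. c i ` Univ (M i))"
proof -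
  let ?\<tau> = "voc K"
  note dp = directed_posetD[OF dir]
  have "\<exists>e :: 'u \<Rightarrow> 'u \<Rightarrow> 'u. (\<forall>i \<in> I. inj_on (e i) (Univ (M i))) \<and>
    (\<forall>i j x. (i, j) \<in> r \<longrightarrow> x \<in> Univ (M i) \<longrightarrow> e j (\<phi> i j x) = e i x)"
  proof (rule directed_set_colimit[OF dir])
    show "small TYPE('u) (Univ (M i))" if "i \<in> I" for i using models_struc[OF M[OF that]] by (simp add: is_struc_def)
    show "\<phi> i j x \<in> Univ (M j)" if "(i, j) \<in> r" "x \<in> Univ (M i)" for i j x using K_embeddingD(6)[OF \<phi>[OF that(1)]] that by blast
    show "inj_on (\<phi> i j) (Univ (M i))" if "(i, j) \<in> r" for i j using K_embeddingD(5)[OF \<phi>[OF that]] .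
    show "\<phi> j k (\<phi> i j x) = \<phi> i k x" if "(i, j) \<in> r" "(j, k) \<in> r" "x \<in> Univ (M i)" for i j k x
      using comp that by (simp add: compose_eq)
  qed
  then obtain e :: "'u \<Rightarrow> 'u \<Rightarrow> 'u" where e: "\<And>i. i \<in> I \<Longrightarrow> inj_on (e i) (Univ (M i))"
    "\<And>i j x. (i, j) \<in> r \<Longrightarrow> x \<in> Univ (M i) \<Longrightarrow> e j (\<phi> i j x) = e i x" by meson
  define c where "c i = restrict (e i) (Univ (M i))" for i
  have c: "compose (Univ (M i)) (c j) (\<phi> i j) = c i" if ij: "(i, j) \<in> r" for i j
  proof -
    have "\<phi> i j x \<in> Univ (M j)" if "x \<in> Univ (M i)" for x using K_embeddingD(6)[OF \<phi>[OF ij]] that by blast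
    then show ?thesis using e(2)[OF ij] by (auto simp: compose_def c_def fun_eq_iff)
  qed
  have "\<forall>i. \<exists>N. i \<in> I \<longrightarrow> struc_iso ?\<tau> (M i) N (c i)"
    using ex_struc_iso[OF models_struc[OF M] e(1)] unfolding c_def by blast
  then obtain N where N: "\<And>i. i \<in> I \<Longrightarrow> struc_iso ?\<tau> (M i) (N i) (c i)" by metis
  have Nm: "N i \<in> models K" if "i \<in> I" for i using models_iso[OF M N] that by blast
  have NU: "Univ (N i) = c i ` Univ (M i)" if "i \<in> I" for i using N[OF that] by (simp add: struc_iso_iff)
  have "leq K (N i) (N j)" if ij: "(i, j) \<in> r" for i j
  proof -
    have I: "i \<in> I" "j \<in> I" using ij dp(2) by auto
    have emb: "struc_emb ?\<tau> (M j) (N j) (c j)" using N[OF I(2)] by (simp add: struc_iso_iff)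
    have im: "c j ` \<phi> i j ` Univ (M i) = c i ` Univ (M i)"
      unfolding c[OF ij, symmetric] by (auto simp: compose_eq)
    have "restr_struc ?\<tau> (N j) (Univ (N j)) = N j"
      using substruc_restr substruc_refl models_struc Nm[OF I(2)] by blast
    then have "leq K (restr_struc ?\<tau> (N j) (c i ` Univ (M i))) (N j)"
      using leq_transport[OF K_embeddingD(7)[OF \<phi>[OF ij]] emb] im NU[OF I(2)] by simp
    moreover have "restr_struc ?\<tau> (N j) (c i ` Univ (M i)) = N i"
      using struc_emb_image(1)[OF struc_emb_comp[OF K_embeddingD(3)[OF \<phi>[OF ij]] emb]] N[OF I(1)]
      unfolding c[OF ij] by (rule struc_iso_unique)
    ultimately show ?thesis by simp
  qed
  then have sys: "directed_system \<mu> K I r N" unfolding directed_system_def using dir Nm by auto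
  let ?N = "union_struc ?\<tau> I N"
  have le: "leq K (N i) ?N" if "i \<in> I" for i
    using AEC sys that unfolding mu_AEC_def chain_axioms_def by blast
  have "K_embedding K (M i) ?N (c i)" if i: "i \<in> I" for i
    using K_embedding_leq[OF K_embedding_iso[OF M[OF i] N[OF i]] le[OF i]] .
  moreover have "Univ ?N = (\<Union>i \<in> I. c i ` Univ (M i))" using NU by (simp add: union_struc_def)
  ultimately show ?thesis using c by blast
qed

text \<open>A tuple in \<open>X\<close> comes from a single \<open>M i\<close>, on which
  \<open>h\<close> is known; this makes \<open>h\<close> an embedding of structures. That its image
  is below \<open>Y\<close> is the last clause of the chain axioms.\<close>

lemma ex_directed_mediator:
  assumes dir: "directed_poset \<mu> I r"
    and \<phi>: "\<And>i j. (i, j) \<in> r \<Longrightarrow> K_embedding K (M i) (M j) (\<phi> i j)"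
    and c: "\<And>i. i \<in> I \<Longrightarrow> K_embedding K (M i) X (c i)"
      "\<And>i j. (i, j) \<in> r \<Longrightarrow> compose (Univ (M i)) (c j) (\<phi> i j) = c i"
    and d: "\<And>i. i \<in> I \<Longrightarrow> K_embedding K (M i) Y (d i)"
      "\<And>i j. (i, j) \<in> r \<Longrightarrow> compose (Univ (M i)) (d j) (\<phi> i j) = d i"
    and surj: "Univ X \<subseteq> (\<Union>i \<in> I. c i ` Univ (M i))"
  shows "\<exists>h. K_embedding K X Y h \<and> (\<forall>i \<in> I. compose (Univ (M i)) h (c i) = d i)"
proof -
  let ?\<tau> = "voc K"
  note dp = directed_posetD[OF dir]
  have XU: "Univ X = (\<Union>i \<in> I. c i ` Univ (M i))" using surj K_embeddingD(6)[OF c(1)] by blast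
  have into: "\<phi> i j x \<in> Univ (M j)" if "(i, j) \<in> r" "x \<in> Univ (M i)" for i j x
    using K_embeddingD(6)[OF \<phi>[OF that(1)]] that by blast
  have cx: "c j (\<phi> i j x) = c i x" "d j (\<phi> i j x) = d i x" if "(i, j) \<in> r" "x \<in> Univ (M i)" for i j x
    using c(2)[OF that(1)] d(2)[OF that(1)] that(2) by (metis compose_eq)+
  obtain h where h: "h \<in> extensional (Univ X)" "inj_on h (Univ X)"
    and hc: "\<And>i x. i \<in> I \<Longrightarrow> x \<in> Univ (M i) \<Longrightarrow> h (c i x) = d i x"
    using directed_glue[OF dir into K_embeddingD(5)[OF c(1)] cx(1) K_embeddingD(5)[OF d(1)] cx(2) XU] by blast
  have hcd: "compose (Univ (M i)) h (c i) = d i" if i: "i \<in> I" for i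
  proof (rule extensionalityI)
    show "d i \<in> extensional (Univ (M i))" using K_embeddingD(4)[OF d(1)[OF i]] .
  qed (simp_all add: compose_eq hc[OF i])
  obtain i0 where i0: "i0 \<in> I" using directed_poset_nonempty[OF dir] by blast
  have X: "X \<in> models K" and Y: "Y \<in> models K" using K_embeddingD(2)[OF c(1)[OF i0]] K_embeddingD(2)[OF d(1)[OF i0]] by auto
  have im: "d j ` \<phi> i j ` Univ (M i) = d i ` Univ (M i)" "c j ` \<phi> i j ` Univ (M i) = c i ` Univ (M i)"
    if "(i, j) \<in> r" for i j using cx[OF that] by (force simp: image_iff)+
  have hX: "h ` Univ X = (\<Union>i \<in> I. d i ` Univ (M i))" unfolding XU image_UN using hc by (force simp: image_iff)
  have tuple: "\<exists>i \<in> I. \<exists>y \<in> A \<rightarrow>\<^sub>E Univ (M i). x = compose A (c i) y"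
    if A: "|A| <o \<mu>" and x: "x \<in> A \<rightarrow>\<^sub>E Univ X" for A x
  proof -
    have "c i ` Univ (M i) \<subseteq> c j ` Univ (M j)" if "(i, j) \<in> r" for i j
      using im(2)[OF that] K_embeddingD(6)[OF \<phi>[OF that]] by (metis image_mono)
    from directed_tuple[OF dir A x[unfolded XU] this] show ?thesis using PiE_image_lift by blast
  qed
  have voc: "is_vocabulary \<mu> ?\<tau>" using abstract_class by (simp add: abstract_class_def)
  have hd: "compose A h (compose A (c i) y) = compose A (d i) y" if "i \<in> I" "y \<in> A \<rightarrow>\<^sub>E Univ (M i)" for A i y
    using compose_compose[OF that(2), of h "c i"] hcd[OF that(1)] by simp
  have ce: "struc_emb ?\<tau> (M i) X (c i)" and de: "struc_emb ?\<tau> (M i) Y (d i)" if "i \<in> I" for i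
    using K_embeddingD(3)[OF c(1)[OF that]] K_embeddingD(3)[OF d(1)[OF that]] by auto
  have Fn: "h (Fn X s x) = Fn Y s (compose (fun_arity ?\<tau> s) h x)"
    if s: "s \<in> fun_syms ?\<tau>" and x: "x \<in> fun_arity ?\<tau> s \<rightarrow>\<^sub>E Univ X" for s x
  proof -
    obtain i y where i: "i \<in> I" and y: "y \<in> fun_arity ?\<tau> s \<rightarrow>\<^sub>E Univ (M i)" "x = compose (fun_arity ?\<tau> s) (c i) y"
      using tuple[OF _ x] voc s unfolding is_vocabulary_def by blast
    have "Fn (M i) s y \<in> Univ (M i)"
      using is_struc_Fn[OF models_struc[OF K_embeddingD(1)[OF c(1)[OF i]]] s y(1)] .
    moreover have "Fn X s x = c i (Fn (M i) s y)" using ce[OF i] s y by (simp add: struc_emb_def)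
    moreover have "d i (Fn (M i) s y) = Fn Y s (compose (fun_arity ?\<tau> s) (d i) y)"
      using de[OF i] s y(1) by (simp add: struc_emb_def)
    ultimately show ?thesis using hc[OF i] hd[OF i y(1)] y(2) by simp
  qed
  have Rl: "x \<in> Rl X s \<longleftrightarrow> compose (rel_arity ?\<tau> s) h x \<in> Rl Y s"
    if s: "s \<in> rel_syms ?\<tau>" and x: "x \<in> rel_arity ?\<tau> s \<rightarrow>\<^sub>E Univ X" for s x
  proof -
    obtain i y where i: "i \<in> I" and y: "y \<in> rel_arity ?\<tau> s \<rightarrow>\<^sub>E Univ (M i)" "x = compose (rel_arity ?\<tau> s) (c i) y"
      using tuple[OF _ x] voc s unfolding is_vocabulary_def by blast
    have "x \<in> Rl X s \<longleftrightarrow> y \<in> Rl (M i) s" using ce[OF i] s y by (simp add: struc_emb_def)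
    also have "\<dots> \<longleftrightarrow> compose (rel_arity ?\<tau> s) (d i) y \<in> Rl Y s" using de[OF i] s y(1) by (simp add: struc_emb_def)
    finally show ?thesis using hd[OF i y(1)] y(2) by simp
  qed
  have "h ` Univ X \<subseteq> Univ Y" unfolding hX using K_embeddingD(6)[OF d(1)] by blast
  then have emb: "struc_emb ?\<tau> X Y h"
    unfolding struc_emb_def using models_struc X Y h Fn Rl by blast
  define N where "N i = restr_struc ?\<tau> Y (d i ` Univ (M i))" for i
  have NY: "leq K (N i) Y" if "i \<in> I" for i unfolding N_def using K_embeddingD(7)[OF d(1)[OF that]] .
  have "leq K (N i) (N j)" if ij: "(i, j) \<in> r" for i j
    using leq_transport[OF K_embeddingD(7)[OF \<phi>[OF ij]] de[of j]] ij dp(2) im(1)[OF ij] by (auto simp: N_def)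
  then have sys: "directed_system \<mu> K I r N"
    unfolding directed_system_def using dir leq_models(1)[OF NY] by auto
  have le: "leq K (union_struc ?\<tau> I N) Y"
    using AEC sys NY Y unfolding mu_AEC_def chain_axioms_def by blast
  \<comment> \<open>The union of the images of the \<open>M i\<close> has the same universe as the
    image of \<open>h\<close>, and lies below \<open>Y\<close>, so it is the restriction of
    \<open>Y\<close> to that image.\<close>
  have "Univ (union_struc ?\<tau> I N) = h ` Univ X" unfolding hX by (simp add: union_struc_def N_def)
  then have "leq K (restr_struc ?\<tau> Y (h ` Univ X)) Y" using le leq_restr[OF le] by simp
  then have "K_embedding K X Y h" using X emb by (simp add: K_embedding_iff)
  then show ?thesis using hcd by blast
qed

text \<open>Intersections give a least submodel containing \<open>A\<close> but no bound on it; the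
  Loewenheim-Skolem submodel is bounded and contains it. Copies inside one fixed set
  \<open>W\<close> make the representatives a small set.\<close>

lemma ex_closure_bounded:
  fixes Z :: "'u set"
  assumes Z: "small TYPE('u) Z"
  shows "\<exists>T \<subseteq> models K. small TYPE('u) T \<and> (\<forall>N \<in> models K. \<forall>A \<subseteq> Univ N. |A| \<le>o |Z| \<longrightarrow>
    (\<exists>P \<in> T. \<exists>m. K_embedding K P N m \<and> A \<subseteq> m ` Univ P \<and>
      (\<forall>Y n. K_embedding K Y N n \<longrightarrow> A \<subseteq> n ` Univ Y \<longrightarrow> m ` Univ P \<subseteq> n ` Univ Y)))"
proof -
  obtain \<nu> :: "'u rel" where \<nu>: "Card_order \<nu>" "small TYPE('u) (Field \<nu>)"
    and LST: "\<And>M A. M \<in> models K \<Longrightarrow> A \<subseteq> Univ M \<Longrightarrow> \<exists>M0. leq K M0 M \<and> A \<subseteq> Univ M0 \<and>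
           |Univ M0| \<le>o cpow_less (card_of A) \<mu> +c \<nu>"
    using AEC unfolding mu_AEC_def LST_axiom_def by (elim conjE exE) (metis (no_types, lifting))
  let ?b = "cpow_less |Z| \<mu> +c \<nu>"
  have "small TYPE('u) (Field ?b)"
    unfolding Field_csum using \<nu> Z by (intro small_Un small_image small_cpow_less) (simp_all add: Field_card_of)
  then obtain W :: "'u set" where W: "small TYPE('u) W" "|Field ?b| =o |W|" using small_code_set by blast
  have bW: "?b \<le>o |W|"
    by (meson Card_order_csum W(2) card_of_Field_ordIso ordIso_imp_ordLeq ordIso_symmetric ordIso_transitive)
  let ?T = "{M \<in> models K. Univ M \<subseteq> W}"
  have voc: "is_vocabulary \<mu> (voc K)" using abstract_class by (simp add: abstract_class_def)
  have "small TYPE('u) ?T"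
    by (rule small_subset[OF small_strucs[OF voc W(1)]]) (use models_struc in blast)
  moreover have "\<exists>P \<in> ?T. \<exists>m. K_embedding K P N m \<and> A \<subseteq> m ` Univ P \<and>
      (\<forall>Y n. K_embedding K Y N n \<longrightarrow> A \<subseteq> n ` Univ Y \<longrightarrow> m ` Univ P \<subseteq> n ` Univ Y)"
    if N: "N \<in> models K" and A: "A \<subseteq> Univ N" "|A| \<le>o |Z|" for N A
  proof -
    obtain M where M: "leq K M N" and MU: "Univ M = \<Inter>{Univ M' | M'. leq K M' N \<and> A \<subseteq> Univ M'}"
      using intersections N A(1) unfolding admits_intersections_def by meson
    obtain M0 where M0: "leq K M0 N" "A \<subseteq> Univ M0" "|Univ M0| \<le>o cpow_less (card_of A) \<mu> +c \<nu>"
      using LST[OF N A(1)] by blast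
    have "cpow_less |A| \<mu> \<le>o cpow_less |Z| \<mu>" using cpow_less_mono[of "|A|" "|Z|"] A(2) by (simp add: Field_card_of)
    then have "cpow_less |A| \<mu> +c \<nu> \<le>o ?b" by (rule csum_mono1)
    then have M0W: "|Univ M0| \<le>o |W|"
      by (rule ordLeq_transitive[OF M0(3) ordLeq_transitive[OF _ bW]])
    have "Univ M \<subseteq> Univ M0" unfolding MU by (rule Inter_lower) (use M0 in blast)
    then have "|Univ M| \<le>o |W|" by (rule ordLeq_transitive[OF card_of_mono1 M0W])
    then obtain g where g: "inj_on g (Univ M)" "g ` Univ M \<subseteq> W" by (meson card_of_ordLeq)
    have Mm: "M \<in> models K" using leq_models(1)[OF M] .
    obtain P where P: "struc_iso (voc K) M P (restrict g (Univ M))"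
      using ex_struc_iso[OF models_struc[OF Mm] g(1)] by blast
    have PU: "Univ P \<subseteq> W" using P g(2) by (auto simp: struc_iso_iff)
    have Pm: "P \<in> models K" using models_iso[OF Mm P] .
    obtain m where m: "struc_iso (voc K) P M m" using struc_iso_inv[OF P] by blast
    have mU: "m ` Univ P = Univ M" using m by (simp add: struc_iso_iff)
    have "K_embedding K P N m" using K_embedding_leq[OF K_embedding_iso[OF Pm m] M] .
    moreover have "A \<subseteq> m ` Univ P" unfolding mU MU by blast
    moreover have "m ` Univ P \<subseteq> n ` Univ Y" if n: "K_embedding K Y N n" and An: "A \<subseteq> n ` Univ Y" for Y n
    proof -
      have "leq K (restr_struc (voc K) N (n ` Univ Y)) N" using K_embeddingD(7)[OF n] .
      then show ?thesis unfolding mU MU using An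
        by (intro Inter_lower CollectI exI[of _ "restr_struc (voc K) N (n ` Univ Y)"]) simp
    qed
    ultimately show ?thesis using Pm PU by blast
  qed
  ultimately show ?thesis by (intro exI[of _ ?T] conjI) blast+
qed

end

section \<open>Transport of underlying sets and maps to the given category\<close>

locale aec_presented_category = aec_intersections \<mu> K for \<mu> :: "'u rel" and K +
  fixes C :: "('o, 'u) cat" and F :: "('o, 'u, 'u struc, 'u struc \<times> ('u \<Rightarrow> 'u) \<times> 'u struc) ftor"
  assumes category: "category C" and locally_small: "locally_small TYPE('u) C"
    and weak_equivalence: "weak_equivalence C (class_cat K) F"
begin

definition U :: "'o \<Rightarrow> 'u set" where
  "U X = Univ (FOb F X)"

definition m :: "'u \<Rightarrow> 'u \<Rightarrow> 'u" where
  "m f = fst (snd (FArr F f))"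

lemma F: "is_functor C (class_cat K) F"
  using weak_equivalence by (simp add: weak_equivalence_def)

lemma F_Ob: "X \<in> Ob C \<Longrightarrow> FOb F X \<in> models K"
  using functor_Ob[OF F] by simp

lemma F_arr:
  assumes "f \<in> hom C X Y"
  shows "FArr F f = (FOb F X, m f, FOb F Y)" "K_embedding K (FOb F X) (FOb F Y) (m f)"
  using functor_hom[OF F assms] unfolding hom_class_cat m_def by auto

lemma F_full:
  assumes X: "X \<in> Ob C" and Y: "Y \<in> Ob C" and g: "K_embedding K (FOb F X) (FOb F Y) g"
  shows "\<exists>f \<in> hom C X Y. m f = g"
proof -
  have "FArr F ` hom C X Y = hom (class_cat K) (FOb F X) (FOb F Y)"
    using weak_equivalence X Y unfolding weak_equivalence_def bij_betw_def by blast
  then have "(FOb F X, g, FOb F Y) \<in> FArr F ` hom C X Y" using g by (simp add: hom_class_cat)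
  then obtain f where "f \<in> hom C X Y" "FArr F f = (FOb F X, g, FOb F Y)" by (elim imageE) simp
  then show ?thesis by (intro bexI[of _ f]) (simp_all add: m_def)
qed

lemma F_faithful:
  assumes f: "f \<in> hom C X Y" and g: "g \<in> hom C X Y" and eq: "m f = m g"
  shows "f = g"
proof -
  have "inj_on (FArr F) (hom C X Y)"
    using weak_equivalence hom_Ob[OF category f] unfolding weak_equivalence_def bij_betw_def by blast
  then show ?thesis using f g eq F_arr(1)[OF f] F_arr(1)[OF g] by (simp add: inj_on_def)
qed

lemma m_Cmp: "f \<in> hom C X Y \<Longrightarrow> g \<in> hom C Y Z \<Longrightarrow> m (Cmp C g f) = compose (U X) (m g) (m f)"
  by (simp add: m_def[of "Cmp C g f"] functor_Cmp[OF F] F_arr(1) U_def)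

lemma ess_surj:
  assumes M: "M \<in> models K"
  shows "\<exists>X \<in> Ob C. \<exists>t t'. K_embedding K (FOb F X) M t \<and> K_embedding K M (FOb F X) t' \<and>
    t ` U X = Univ M \<and> t' ` Univ M = U X"
proof -
  obtain X a where X: "X \<in> Ob C" and a: "a \<in> hom (class_cat K) (FOb F X) M" "iso_arr (class_cat K) a"
    using weak_equivalence M unfolding weak_equivalence_def by auto
  obtain b where b: "b \<in> hom (class_cat K) M (FOb F X)"
    "Cmp (class_cat K) b a = Idn (class_cat K) (FOb F X)" "Cmp (class_cat K) a b = Idn (class_cat K) M"
    using iso_arrE[OF a(2,1)] by blast
  obtain t t' where t: "a = (FOb F X, t, M)" "K_embedding K (FOb F X) M t"
    and t': "b = (M, t', FOb F X)" "K_embedding K M (FOb F X) t'"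
    using a(1) b(1) unfolding hom_class_cat by blast
  have "compose (U X) t' t = (\<lambda>x \<in> U X. x)" "compose (Univ M) t t' = (\<lambda>x \<in> Univ M. x)"
    using b(2,3) t(1) t'(1) by (simp_all add: U_def)
  then have 1: "\<And>x. x \<in> U X \<Longrightarrow> t' (t x) = x" and 2: "\<And>y. y \<in> Univ M \<Longrightarrow> t (t' y) = y"
    by (metis compose_eq restrict_apply')+
  have "t ` U X \<subseteq> Univ M" "t' ` Univ M \<subseteq> U X" using K_embeddingD(6)[OF t(2)] K_embeddingD(6)[OF t'(2)] by (auto simp: U_def)
  then have "t ` U X = Univ M" "t' ` Univ M = U X" using 1 2 by (metis image_eqI subset_antisym subsetI image_subset_iff)+
  then show ?thesis using X t(2) t'(2) by blast
qed

lemma functor_embeddings: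
  assumes dir: "directed_poset \<mu> I r" and D: "is_functor (poset_cat I r) C D"
  shows "\<And>i. i \<in> I \<Longrightarrow> FOb D i \<in> Ob C"
    and "\<And>i j. (i, j) \<in> r \<Longrightarrow> FArr D (i, j) \<in> hom C (FOb D i) (FOb D j)"
    and "\<And>i j. (i, j) \<in> r \<Longrightarrow> K_embedding K (FOb F (FOb D i)) (FOb F (FOb D j)) (m (FArr D (i, j)))"
    and "\<And>i j k. (i, j) \<in> r \<Longrightarrow> (j, k) \<in> r \<Longrightarrow>
      m (FArr D (i, k)) = compose (U (FOb D i)) (m (FArr D (j, k))) (m (FArr D (i, j)))"
proof -
  show DO: "FOb D i \<in> Ob C" if "i \<in> I" for i using D that by (simp add: poset_functor_iff)
  show DA: "FArr D (i, j) \<in> hom C (FOb D i) (FOb D j)" if "(i, j) \<in> r" for i j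
    using D that unfolding poset_functor_iff by blast
  show "K_embedding K (FOb F (FOb D i)) (FOb F (FOb D j)) (m (FArr D (i, j)))" if "(i, j) \<in> r" for i j
    using F_arr(2)[OF DA[OF that]] .
  show "m (FArr D (i, k)) = compose (U (FOb D i)) (m (FArr D (j, k))) (m (FArr D (i, j)))"
    if "(i, j) \<in> r" "(j, k) \<in> r" for i j k
  proof -
    have "FArr D (i, k) = Cmp C (FArr D (j, k)) (FArr D (i, j))"
      using D that unfolding poset_functor_iff by blast
    then show ?thesis using m_Cmp[OF DA[OF that(1)] DA[OF that(2)]] by simp
  qed
qed

lemma cocone_embeddings:
  assumes dir: "directed_poset \<mu> I r" and D: "is_functor (poset_cat I r) C D"
    and cc: "is_cocone (poset_cat I r) C D (X, c)"
  shows "X \<in> Ob C" and "\<And>i. i \<in> I \<Longrightarrow> c i \<in> hom C (FOb D i) X"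
    and "\<And>i. i \<in> I \<Longrightarrow> K_embedding K (FOb F (FOb D i)) (FOb F X) (m (c i))"
    and "\<And>i j. (i, j) \<in> r \<Longrightarrow> compose (U (FOb D i)) (m (c j)) (m (FArr D (i, j))) = m (c i)"
proof -
  show "X \<in> Ob C" using cc by (simp add: poset_cocone_iff)
  show c: "c i \<in> hom C (FOb D i) X" if "i \<in> I" for i using cc that by (simp add: poset_cocone_iff)
  show "K_embedding K (FOb F (FOb D i)) (FOb F X) (m (c i))" if "i \<in> I" for i using F_arr(2)[OF c[OF that]] .
  show "compose (U (FOb D i)) (m (c j)) (m (FArr D (i, j))) = m (c i)" if ij: "(i, j) \<in> r" for i j
  proof -
    have "j \<in> I" using ij directed_posetD(2)[OF dir] by blast
    moreover have "Cmp C (c j) (FArr D (i, j)) = c i" using cc ij unfolding poset_cocone_iff by blast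
    ultimately show ?thesis using m_Cmp[OF functor_embeddings(2)[OF dir D ij] c] by metis
  qed
qed

text \<open>The colimit is formed among the models and then replaced by an isomorphic image of an
  object of \<open>C\<close>; fullness lifts the legs and faithfulness the cocone equations.\<close>

lemma ex_surjective_cocone:
  assumes dir: "directed_poset \<mu> I r" and D: "is_functor (poset_cat I r) C D"
  shows "\<exists>X c. is_cocone (poset_cat I r) C D (X, c) \<and> U X \<subseteq> (\<Union>i \<in> I. m (c i) ` U (FOb D i))"
proof -
  let ?M = "\<lambda>i. FOb F (FOb D i)" and ?\<phi> = "\<lambda>i j. m (FArr D (i, j))"
  note dp = directed_posetD[OF dir]
  note DO = functor_embeddings(1)[OF dir D] and DA = functor_embeddings(2)[OF dir D]
    and \<phi> = functor_embeddings(3)[OF dir D]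
  have comp: "?\<phi> i k = compose (Univ (?M i)) (?\<phi> j k) (?\<phi> i j)" if "(i, j) \<in> r" "(j, k) \<in> r" for i j k
    using functor_embeddings(4)[OF dir D that] by (simp add: U_def)
  have "\<exists>N c. (\<forall>i \<in> I. K_embedding K (?M i) N (c i)) \<and>
    (\<forall>i j. (i, j) \<in> r \<longrightarrow> compose (Univ (?M i)) (c j) (?\<phi> i j) = c i) \<and> Univ N = (\<Union>i \<in> I. c i ` Univ (?M i))"
    by (rule ex_directed_cocone[OF dir]) (fact F_Ob[OF DO] \<phi> comp)+
  then obtain N c where c': "\<forall>i \<in> I. K_embedding K (?M i) N (c i)"
    and cn': "\<forall>i j. (i, j) \<in> r \<longrightarrow> compose (Univ (?M i)) (c j) (?\<phi> i j) = c i"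
    and NU: "Univ N = (\<Union>i \<in> I. c i ` Univ (?M i))" by (elim exE conjE)
  note c = c'[rule_format] and cn = cn'[rule_format]
  obtain i0 where "i0 \<in> I" using directed_poset_nonempty[OF dir] by blast
  then have "N \<in> models K" using K_embeddingD(2)[OF c] by blast
  then obtain X t where X: "X \<in> Ob C" and t: "K_embedding K N (FOb F X) t" "t ` Univ N = U X" using ess_surj by blast
  have "\<forall>i. \<exists>a. i \<in> I \<longrightarrow> a \<in> hom C (FOb D i) X \<and> m a = compose (Univ (?M i)) t (c i)"
    using F_full[OF DO X K_embedding_comp[OF c t(1)]] by blast
  then obtain a where a: "\<And>i. i \<in> I \<Longrightarrow> a i \<in> hom C (FOb D i) X \<and> m (a i) = compose (Univ (?M i)) t (c i)" by metis
  have "Cmp C (a j) (FArr D (i, j)) = a i" if ij: "(i, j) \<in> r" for i j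
  proof -
    have I: "i \<in> I" "j \<in> I" using ij dp(2) by auto
    have "m (Cmp C (a j) (FArr D (i, j))) = compose (Univ (?M i)) (compose (Univ (?M j)) t (c j)) (?\<phi> i j)"
      using m_Cmp[OF DA[OF ij] conjunct1[OF a[OF I(2)]]] a[OF I(2)] by (simp add: U_def)
    also have "\<dots> = compose (Univ (?M i)) t (compose (Univ (?M i)) (c j) (?\<phi> i j))"
      using K_embeddingD(6)[OF \<phi>[OF ij]] by (auto simp: compose_def fun_eq_iff)
    also have "\<dots> = m (a i)" using a[OF I(1)] cn[OF ij] by simp
    finally show ?thesis using F_faithful Cmp_hom[OF category DA[OF ij]] a[OF I(1)] a[OF I(2)] by blast
  qed
  then have "is_cocone (poset_cat I r) C D (X, restrict a I)"
    unfolding poset_cocone_iff using X a dp(2) by auto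
  moreover have "U X \<subseteq> (\<Union>i \<in> I. m (restrict a I i) ` U (FOb D i))"
  proof
    fix x assume "x \<in> U X"
    then have "x \<in> t ` Univ N" using t(2) by simp
    then obtain i y where i: "i \<in> I" "y \<in> Univ (?M i)" "x = t (c i y)" unfolding NU by blast
    then have "x = m (restrict a I i) y" using a[OF i(1)] by (simp add: compose_eq)
    then show "x \<in> (\<Union>i \<in> I. m (restrict a I i) ` U (FOb D i))" using i(1,2) by (auto simp: U_def)
  qed
  ultimately show ?thesis by blast
qed

lemma ex_cocone_mediator:
  assumes dir: "directed_poset \<mu> I r" and D: "is_functor (poset_cat I r) C D"
    and cc: "is_cocone (poset_cat I r) C D (X, c)" and surj: "U X \<subseteq> (\<Union>i \<in> I. m (c i) ` U (FOb D i))"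
    and dc: "is_cocone (poset_cat I r) C D (Y, d)"
  shows "\<exists>h \<in> hom C X Y. \<forall>i \<in> I. Cmp C h (c i) = d i"
proof -
  note cE = cocone_embeddings[OF dir D cc] and dE = cocone_embeddings[OF dir D dc]
  have "\<exists>h. K_embedding K (FOb F X) (FOb F Y) h \<and>
      (\<forall>i \<in> I. compose (Univ (FOb F (FOb D i))) h (m (c i)) = m (d i))"
    by (rule ex_directed_mediator[OF dir, where \<phi> = "\<lambda>i j. m (FArr D (i, j))"])
      (fact functor_embeddings(3)[OF dir D] cE(3) cE(4)[unfolded U_def] dE(3) dE(4)[unfolded U_def] surj[unfolded U_def])+
  then obtain h where h: "K_embedding K (FOb F X) (FOb F Y) h"
    "\<And>i. i \<in> I \<Longrightarrow> compose (U (FOb D i)) h (m (c i)) = m (d i)" unfolding U_def by blast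
  obtain h' where h': "h' \<in> hom C X Y" "m h' = h" using F_full[OF cE(1) dE(1) h(1)] by blast
  have "Cmp C h' (c i) = d i" if i: "i \<in> I" for i
    using F_faithful[OF Cmp_hom[OF category cE(2)[OF i] h'(1)] dE(2)[OF i]]
      m_Cmp[OF cE(2)[OF i] h'(1)] h'(2) h(2)[OF i] by simp
  then show ?thesis using h'(1) by blast
qed

text \<open>Each representative model is replaced by one chosen object of \<open>C\<close>;
  composing with the isomorphism leaves the image in \<open>X\<close> unchanged.\<close>

lemma ex_closure_objects:
  fixes Z :: "'u set"
  assumes Z: "small TYPE('u) Z"
  shows "\<exists>T. small TYPE('u) T \<and> T \<subseteq> Ob C \<and>
      (\<forall>X \<in> Ob C. \<forall>A \<subseteq> U X. |A| \<le>o |Z| \<longrightarrow> (\<exists>P \<in> T. \<exists>a. hull C U m A P a X))"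
proof -
  obtain T where TK: "T \<subseteq> models K" and smT: "small TYPE('u) T"
    and T: "\<And>N A. N \<in> models K \<Longrightarrow> A \<subseteq> Univ N \<Longrightarrow> |A| \<le>o |Z| \<Longrightarrow>
      \<exists>P \<in> T. \<exists>m. K_embedding K P N m \<and> A \<subseteq> m ` Univ P \<and>
    (\<forall>Y n. K_embedding K Y N n \<longrightarrow> A \<subseteq> n ` Univ Y \<longrightarrow> m ` Univ P \<subseteq> n ` Univ Y)"
    using ex_closure_bounded[OF Z] by meson
  have "\<forall>M. \<exists>X t. M \<in> T \<longrightarrow> X \<in> Ob C \<and> K_embedding K (FOb F X) M t \<and> t ` U X = Univ M"
    using ess_surj TK by blast
  then obtain s t where s: "\<And>M. M \<in> T \<Longrightarrow> s M \<in> Ob C \<and> K_embedding K (FOb F (s M)) M (t M) \<and> t M ` U (s M) = Univ M"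
    by metis
  have "\<exists>P \<in> s ` T. \<exists>a. hull C U m A P a X"
    if X: "X \<in> Ob C" and A: "A \<subseteq> U X" "|A| \<le>o |Z|" for X A
  proof -
    obtain P b where P: "P \<in> T" and b: "K_embedding K P (FOb F X) b" "A \<subseteq> b ` Univ P"
      and min: "\<And>Y n. K_embedding K Y (FOb F X) n \<Longrightarrow> A \<subseteq> n ` Univ Y \<Longrightarrow> b ` Univ P \<subseteq> n ` Univ Y"
      using T[OF F_Ob[OF X] A[unfolded U_def]] by meson
    note sP = s[OF P]
    obtain a where a: "a \<in> hom C (s P) X" "m a = compose (U (s P)) b (t P)"
      using F_full[OF conjunct1[OF sP] X K_embedding_comp[OF conjunct1[OF conjunct2[OF sP]] b(1)]]
      unfolding U_def by blast
    have im: "m a ` U (s P) = b ` Univ P"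
    proof -
      have "m a ` U (s P) = b ` t P ` U (s P)" unfolding a(2) by (auto simp: compose_eq)
      then show ?thesis using sP by simp
    qed
    have "m a ` U (s P) \<subseteq> m n ` U Y" if "n \<in> hom C Y X" "A \<subseteq> m n ` U Y" for n Y
      unfolding im using min[OF F_arr(2)[OF that(1)]] that(2) by (simp add: U_def)
    then have "hull C U m A (s P) a X" unfolding hull_def using a(1) b(2) im by simp
    then show ?thesis using P by blast
  qed
  moreover have "small TYPE('u) (s ` T)" "s ` T \<subseteq> Ob C" using small_image[OF smT] s by blast+
  ultimately show ?thesis by (intro exI[of _ "s ` T"] conjI ballI allI impI)
qed

sublocale concrete_category \<mu> C U m
proof
  show "category C" "locally_small TYPE('u) C" by (fact category locally_small)+
  show "small TYPE('u) (U X)" if "X \<in> Ob C" for X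
    using models_struc[OF F_Ob[OF that]] by (simp add: is_struc_def U_def)
  show "m f ` U X \<subseteq> U Y" "inj_on (m f) (U X)" if "f \<in> hom C X Y" for f X Y
    using K_embeddingD[OF F_arr(2)[OF that]] by (auto simp: U_def)
  show "m (Cmp C g f) x = m g (m f x)" if "f \<in> hom C X Y" "g \<in> hom C Y W" "x \<in> U X" for f g X Y W x
    using m_Cmp[OF that(1,2)] that(3) by (simp add: compose_eq)
  show "f = g" if fg: "f \<in> hom C X Y" "g \<in> hom C X Y" and eq: "\<And>x. x \<in> U X \<Longrightarrow> m f x = m g x" for f g X Y
  proof (rule F_faithful[OF fg], rule extensionalityI)
    show "m f \<in> extensional (U X)" "m g \<in> extensional (U X)"
      using K_embeddingD(4)[OF F_arr(2)[OF fg(1)]] K_embeddingD(4)[OF F_arr(2)[OF fg(2)]] by (auto simp: U_def)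
  qed (rule eq)
  show "\<exists>k \<in> hom C P Y. Cmp C n k = f" if f: "f \<in> hom C P X" and n: "n \<in> hom C Y X"
    and sub: "m f ` U P \<subseteq> m n ` U Y" for f n P X Y
  proof -
    obtain k where k: "K_embedding K (FOb F P) (FOb F Y) k" "compose (U P) (m n) k = m f"
      using K_embedding_factor[OF F_arr(2)[OF f] F_arr(2)[OF n]] sub unfolding U_def by blast
    obtain k' where k': "k' \<in> hom C P Y" "m k' = k"
      using F_full[OF _ _ k(1)] hom_Ob[OF category f] hom_Ob[OF category n] by blast
    have "m (Cmp C n k') = m f" using m_Cmp[OF k'(1) n] k' k(2) by simp
    then show ?thesis using F_faithful[OF Cmp_hom[OF category k'(1) n] f] k'(1) by blast
  qed
qed (fact ex_closure_objects ex_surjective_cocone ex_cocone_mediator)+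

end

section \<open>Locally polypresentable categories as classes of structures\<close>

lemma substruc_trans:
  assumes MN: "substruc \<tau> M N" and NP: "substruc \<tau> N P" shows "substruc \<tau> M P"
proof -
  have m: "A \<rightarrow>\<^sub>E Univ M \<subseteq> A \<rightarrow>\<^sub>E Univ N" for A :: "'a set"
    by (rule PiE_mono) (use MN in \<open>simp add: substruc_def\<close>)
  have "Rl M s = Rl P s \<inter> (rel_arity \<tau> s \<rightarrow>\<^sub>E Univ M)" if "s \<in> rel_syms \<tau>" for s
    using MN NP that m[of "rel_arity \<tau> s"] by (auto simp: substruc_def)
  moreover have "Fn M s x = Fn P s x" if "s \<in> fun_syms \<tau>" "x \<in> fun_arity \<tau> s \<rightarrow>\<^sub>E Univ M" for s x
    using MN NP that subsetD[OF m that(2)] by (simp add: substruc_def)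
  ultimately show ?thesis using MN NP by (auto simp: substruc_def)
qed

lemma substruc_inclusion: "substruc \<tau> M N \<Longrightarrow> struc_emb \<tau> M N (\<lambda>x \<in> Univ M. x)"
proof -
  assume sub: "substruc \<tau> M N"
  have "restrict (\<lambda>x \<in> Univ N. x) (Univ M) = (\<lambda>x \<in> Univ M. x)"
    using sub by (auto simp: substruc_def fun_eq_iff)
  moreover have "is_struc \<tau> N" using sub by (simp add: substruc_def)
  ultimately show ?thesis using struc_emb_restrict[OF struc_emb_id sub] by simp
qed

lemma struc_iso_comp:
  assumes "struc_iso \<tau> M N f" "struc_iso \<tau> N P g" shows "struc_iso \<tau> M P (compose (Univ M) g f)"
proof -
  have "compose (Univ M) g f ` Univ M = g ` f ` Univ M" by (auto simp: compose_eq)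
  then show ?thesis using assms struc_emb_comp unfolding struc_iso_iff by metis
qed

section \<open>Discrete diagrams, whose cocones are families of arrows\<close>

definition discrete_cat :: "'a set \<Rightarrow> ('a, 'a) cat" where
  "discrete_cat A = \<lparr>Ob = A, Arr = A, Dom = (\<lambda>x. x), Cod = (\<lambda>x. x), Idn = (\<lambda>x. x), Cmp = (\<lambda>g f. f)\<rparr>"

definition discrete_diagram :: "('o, 'm) cat \<Rightarrow> ('a \<Rightarrow> 'o) \<Rightarrow> ('a, 'a, 'o, 'm) ftor" where
  "discrete_diagram C d = \<lparr>FOb = d, FArr = (\<lambda>j. Idn C (d j))\<rparr>"

lemma Ob_discrete_cat [simp]: "Ob (discrete_cat A) = A"
  by (simp add: discrete_cat_def)

lemma small_category_discrete: "small TYPE('u) A \<Longrightarrow> small_category TYPE('u) (discrete_cat A)"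
  by (simp add: small_category_def category_def discrete_cat_def hom_def)

lemma discrete_diagram_functor:
  assumes C: "category C" and d: "\<And>j. j \<in> J \<Longrightarrow> d j \<in> Ob C"
  shows "is_functor (discrete_cat J) C (discrete_diagram C d)"
  using Idn_hom[OF C d] Cmp_Idn[OF C Idn_hom[OF C d]] d
  by (simp add: is_functor_def discrete_cat_def discrete_diagram_def)

lemma discrete_cocone_iff:
  assumes C: "category C"
  shows "is_cocone (discrete_cat J) C (discrete_diagram C d) (X, c) \<longleftrightarrow>
    X \<in> Ob C \<and> c \<in> extensional J \<and> (\<forall>j \<in> J. c j \<in> hom C (d j) X)"
  using Cmp_Idn[OF C] by (auto simp: is_cocone_def discrete_cat_def discrete_diagram_def)

text \<open>Arities are index sets, so binary relations need two fixed places in \<open>'u\<close>;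
  these are \<open>p\<close> and \<open>q\<close>.\<close>

locale polypresentable_category = lsm_category \<mu> C for \<mu> :: "'u rel" and C :: "('o, 'u) cat" +
  fixes S :: "'o set" and p q :: 'u
  assumes directed_colimits: "has_directed_colimits \<mu> C"
    and polycolimits: "has_polycolimits TYPE('u) C"
    and small_S: "small TYPE('u) S"
    and presentable_S: "s \<in> S \<Longrightarrow> presentable \<mu> C s"
    and colimits_of_S: "X \<in> Ob C \<Longrightarrow> \<exists>I r D c. directed_poset \<mu> I r \<and> is_functor (poset_cat I r) C D \<and>
           (\<forall>i \<in> I. FOb D i \<in> S) \<and> is_colimit (poset_cat I r) C D (X, c)"
    and pq: "p \<noteq> q"
begin

definition pair :: "'u \<Rightarrow> 'u \<Rightarrow> 'u \<Rightarrow> 'u" where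
  "pair a b = (\<lambda>i \<in> {p, q}. if i = p then a else b)"

lemma pair_eq_iff [simp]: "pair a b = pair a' b' \<longleftrightarrow> a = a' \<and> b = b'"
proof
  assume eq: "pair a b = pair a' b'"
  show "a = a' \<and> b = b'" using fun_cong[OF eq, of p] fun_cong[OF eq, of q] pq by (simp add: pair_def)
qed simp

lemma pair_PiE [simp]: "pair a b \<in> {p, q} \<rightarrow>\<^sub>E A \<longleftrightarrow> a \<in> A \<and> b \<in> A"
  using pq by (auto simp: pair_def PiE_iff)

lemma compose_pair [simp]: "compose {p, q} f (pair a b) = pair (f a) (f b)"
  using pq by (auto simp: pair_def compose_def fun_eq_iff)

lemma PiE_pairE:
  assumes "x \<in> {p, q} \<rightarrow>\<^sub>E A" obtains a b where "a \<in> A" "b \<in> A" "x = pair a b"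
proof
  show "x p \<in> A" "x q \<in> A" using assms by auto
  show "x = pair (x p) (x q)"
  proof (rule extensionalityI)
    show "x \<in> extensional {p, q}" using assms by (simp add: PiE_def)
  qed (auto simp: pair_def)
qed

definition syms :: "'u set" where
  "syms = {u \<in> Arr C. Dom C u \<in> S \<and> Cod C u \<in> S}"

definition \<tau> :: "'u vocabulary" where
  "\<tau> = \<lparr>fun_syms = {}, rel_syms = syms, fun_arity = (\<lambda>s. {}), rel_arity = (\<lambda>s. {p, q})\<rparr>"

definition pts :: "'o \<Rightarrow> 'u set" where
  "pts X = {a \<in> Arr C. Dom C a \<in> S \<and> Cod C a = X}"

text \<open>The restricted Yoneda embedding: the presheaf hom(-, X) on \<open>S\<close> as one set
  of elements, each remembering its domain. The action of \<open>u\<close> is defined only where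
  \<open>Dom C a = Cod C u\<close>, hence its graph as a relation instead of a function
  symbol.\<close>

definition St :: "'o \<Rightarrow> 'u struc" where
  "St X = \<lparr>Univ = pts X, Fn = (\<lambda>s x. undefined),
     Rl = (\<lambda>u. if u \<in> syms
       then {pair a b | a b. a \<in> pts X \<and> b \<in> pts X \<and> Dom C a = Cod C u \<and> b = Cmp C a u} else {})\<rparr>"

definition em :: "'u \<Rightarrow> 'u \<Rightarrow> 'u" where
  "em f = (\<lambda>a \<in> pts (Dom C f). Cmp C f a)"

lemma \<tau>_simps [simp]: "fun_syms \<tau> = {}" "rel_syms \<tau> = syms" "rel_arity \<tau> s = {p, q}"
  by (simp_all add: \<tau>_def)

lemma S_Ob: "s \<in> S \<Longrightarrow> s \<in> Ob C"
  using presentable_S by (simp add: presentable_def)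

lemma pts_iff: "a \<in> pts X \<longleftrightarrow> Dom C a \<in> S \<and> a \<in> hom C (Dom C a) X"
  by (auto simp: pts_def hom_def)

lemma hom_pts: "a \<in> hom C s X \<Longrightarrow> s \<in> S \<Longrightarrow> a \<in> pts X"
  by (auto simp: pts_def hom_def)

lemma small_pts:
  assumes "X \<in> Ob C" shows "small TYPE('u) (pts X)"
proof (rule small_subset)
  show "small TYPE('u) (\<Union>s \<in> S. hom C s X)" using small_S small_hom S_Ob assms by (intro small_UN) auto
  show "pts X \<subseteq> (\<Union>s \<in> S. hom C s X)" by (auto simp: pts_def hom_def)
qed

lemma small_syms: "small TYPE('u) syms"
proof (rule small_subset)
  show "small TYPE('u) (\<Union>s \<in> S. pts s)" using small_S small_pts S_Ob by (intro small_UN) auto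
  show "syms \<subseteq> (\<Union>s \<in> S. pts s)" by (auto simp: pts_def syms_def)
qed

lemma Univ_St [simp]: "Univ (St X) = pts X"
  by (simp add: St_def)

lemma Rl_St: "u \<in> syms \<Longrightarrow> a \<in> pts X \<Longrightarrow> b \<in> pts X \<Longrightarrow>
    pair a b \<in> Rl (St X) u \<longleftrightarrow> Dom C a = Cod C u \<and> b = Cmp C a u"
  by (auto simp: St_def)

lemma is_struc_iff: "is_struc \<tau> M \<longleftrightarrow> small TYPE('u) (Univ M) \<and> Fn M = (\<lambda>s x. undefined) \<and>
    (\<forall>s \<in> syms. Rl M s \<subseteq> {p, q} \<rightarrow>\<^sub>E Univ M) \<and> (\<forall>s. s \<notin> syms \<longrightarrow> Rl M s = {})"
  unfolding is_struc_def by (auto simp: fun_eq_iff)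

lemma St_struc: "X \<in> Ob C \<Longrightarrow> is_struc \<tau> (St X)"
proof -
  have "x \<in> {p, q} \<rightarrow>\<^sub>E pts X" if x: "x \<in> Rl (St X) s" and s: "s \<in> syms" for x s
  proof -
    obtain a b where "x = pair a b" "a \<in> pts X" "b \<in> pts X" using x s by (auto simp: St_def)
    then show ?thesis by simp
  qed
  then show ?thesis if "X \<in> Ob C" unfolding is_struc_iff using small_pts[OF that] by (simp add: subset_iff) (simp add: St_def)
qed

lemma struc_emb_iff: "struc_emb \<tau> M N f \<longleftrightarrow> is_struc \<tau> M \<and> is_struc \<tau> N \<and>
    f \<in> extensional (Univ M) \<and> inj_on f (Univ M) \<and> f ` Univ M \<subseteq> Univ N \<and>
    (\<forall>s \<in> syms. \<forall>a \<in> Univ M. \<forall>b \<in> Univ M. pair a b \<in> Rl M s \<longleftrightarrow> pair (f a) (f b) \<in> Rl N s)"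
proof -
  have "(\<forall>x \<in> {p, q} \<rightarrow>\<^sub>E A. Q x) \<longleftrightarrow> (\<forall>a \<in> A. \<forall>b \<in> A. Q (pair a b))" for A Q
    by (metis PiE_pairE pair_PiE)
  then show ?thesis unfolding struc_emb_def by simp
qed

lemma Cmp_sym:
  assumes a: "a \<in> pts X" and u: "u \<in> syms" and d: "Dom C a = Cod C u"
  shows "Cmp C a u \<in> pts X"
proof -
  have "u \<in> hom C (Dom C u) (Dom C a)" "Dom C u \<in> S" using u d by (auto simp: syms_def hom_def)
  then show ?thesis using a Cmp_hom[OF category] hom_pts unfolding pts_iff[of a] by blast
qed

lemma em_into:
  assumes f: "f \<in> hom C X Y" and a: "a \<in> pts X"
  shows "em f a = Cmp C f a \<and> Cmp C f a \<in> hom C (Dom C a) Y \<and> em f a \<in> pts Y"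
proof -
  have ah: "a \<in> hom C (Dom C a) X" and s: "Dom C a \<in> S" using a by (simp_all add: pts_iff)
  have "em f a = Cmp C f a" using a homD(2)[OF f] by (simp add: em_def)
  then show ?thesis using Cmp_hom[OF category ah f] hom_pts s by simp
qed

lemma em_emb:
  assumes f: "f \<in> hom C X Y" shows "struc_emb \<tau> (St X) (St Y) (em f)"
  unfolding struc_emb_iff Univ_St
proof (intro conjI ballI)
  show "is_struc \<tau> (St X)" "is_struc \<tau> (St Y)" using St_struc hom_Ob[OF category f] by auto
  show "em f \<in> extensional (pts X)" using homD(2)[OF f] by (simp add: em_def)
  show "em f ` pts X \<subseteq> pts Y" using em_into[OF f] by blast
  show "inj_on (em f) (pts X)"
  proof (rule inj_onI)
    fix a b assume a: "a \<in> pts X" and b: "b \<in> pts X" and eq: "em f a = em f b"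
    have "Dom C a = Dom C b" using em_into[OF f a] em_into[OF f b] eq homD(2) by metis
    then show "a = b" using cancel[OF f, of a "Dom C a" b] a b eq em_into[OF f a] em_into[OF f b]
      unfolding pts_iff by simp
  qed
  fix u a b assume u: "u \<in> syms" and a: "a \<in> pts X" and b: "b \<in> pts X"
  have fa: "em f a = Cmp C f a" "em f b = Cmp C f b" "em f a \<in> pts Y" "em f b \<in> pts Y"
    "Dom C (em f a) = Dom C a" "Dom C (em f b) = Dom C b"
    using em_into[OF f a] em_into[OF f b] homD(2) by metis+
  have ah: "a \<in> hom C (Dom C a) X" and bh: "b \<in> hom C (Dom C b) X" using a b by (simp_all add: pts_iff)
  have "b = Cmp C a u \<longleftrightarrow> Cmp C f b = Cmp C (Cmp C f a) u" if d: "Dom C a = Cod C u"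
  proof -
    have uh: "u \<in> hom C (Dom C u) (Dom C a)" using u d by (auto simp: syms_def hom_def)
    have au: "Cmp C a u \<in> hom C (Dom C u) X" using Cmp_hom[OF category uh ah] .
    have eq: "Cmp C (Cmp C f a) u = Cmp C f (Cmp C a u)" using Cmp_assoc[OF category uh ah f] by simp
    show ?thesis
    proof
      assume "Cmp C f b = Cmp C (Cmp C f a) u"
      then have e: "Cmp C f b = Cmp C f (Cmp C a u)" using eq by simp
      \<comment> \<open>Cancellation compares parallel arrows, so the domains are first matched by
        means of the equal composites.\<close>
      have "Dom C b = Dom C u"
        using homD(2)[OF Cmp_hom[OF category bh f]] homD(2)[OF Cmp_hom[OF category au f]] e by simp
      then show "b = Cmp C a u" using cancel[OF f _ au e] bh by simp
    qed (simp add: eq)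
  qed
  then show "pair a b \<in> Rl (St X) u \<longleftrightarrow> pair (em f a) (em f b) \<in> Rl (St Y) u"
    unfolding Rl_St[OF u a b] Rl_St[OF u fa(3,4)] fa(5) unfolding fa(1,2) by blast
qed

lemma em_Cmp:
  assumes f: "f \<in> hom C X Y" and g: "g \<in> hom C Y Z"
  shows "em (Cmp C g f) = compose (pts X) (em g) (em f)"
proof (rule extensionalityI)
  note gf = Cmp_hom[OF category f g]
  show "em (Cmp C g f) \<in> extensional (pts X)" using homD(2)[OF gf] by (simp add: em_def)
  show "em (Cmp C g f) a = compose (pts X) (em g) (em f) a" if a: "a \<in> pts X" for a
  proof -
    have "a \<in> hom C (Dom C a) X" using a by (simp add: pts_iff)
    then have "Cmp C g (Cmp C f a) = Cmp C (Cmp C g f) a" using Cmp_assoc[OF category _ f g] by blast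
    moreover have "em g (em f a) = Cmp C g (em f a)" using em_into[OF g] em_into[OF f a] by blast
    ultimately show ?thesis using em_into[OF gf a] em_into[OF f a] a by (simp add: compose_eq)
  qed
qed simp

text \<open>\<open>X\<close> is a colimit of objects of \<open>S\<close>, so the legs are themselves
  elements of \<open>pts X\<close>, and \<open>f\<close> is determined by its composites with
  them.\<close>

lemma em_faithful:
  assumes f: "f \<in> hom C X Y" and g: "g \<in> hom C X Y" and eq: "em f = em g"
  shows "f = g"
proof -
  have X: "X \<in> Ob C" and Y: "Y \<in> Ob C" using hom_Ob[OF category f] by auto
  obtain I r D c where D: "\<forall>i \<in> I. FOb D i \<in> S" and col: "is_colimit (poset_cat I r) C D (X, c)"
    and dir: "directed_poset \<mu> I r" and Df: "is_functor (poset_cat I r) C D"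
    using colimits_of_S[OF X] by blast
  have cc: "is_cocone (poset_cat I r) C D (X, c)" using col by (simp add: is_colimit_iff)
  have c: "c i \<in> hom C (FOb D i) X" if "i \<in> I" for i using cc that by (simp add: poset_cocone_iff)
  let ?d = "\<lambda>i \<in> I. Cmp C f (c i)"
  have fg: "Cmp C f (c i) = Cmp C g (c i)" if "i \<in> I" for i
  proof -
    have "c i \<in> pts X" using hom_pts[OF c[OF that]] D that by blast
    then show ?thesis using em_into[OF f] em_into[OF g] eq by metis
  qed
  have "is_cocone (poset_cat I r) C D (Y, ?d)"
    unfolding poset_cocone_iff
  proof (intro conjI ballI allI impI Y)
    show "?d \<in> extensional I" by simp
    show "?d i \<in> hom C (FOb D i) Y" if "i \<in> I" for i using Cmp_hom[OF category c[OF that] f] that by simp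
    fix i j assume ij: "(i, j) \<in> r"
    have I: "i \<in> I" "j \<in> I" using ij directed_posetD(2)[OF dir] by auto
    have n: "Cmp C (c j) (FArr D (i, j)) = c i" using cc ij unfolding poset_cocone_iff by blast
    have DA: "FArr D (i, j) \<in> hom C (FOb D i) (FOb D j)" using Df ij unfolding poset_functor_iff by blast
    show "Cmp C (?d j) (FArr D (i, j)) = ?d i" using Cmp_assoc[OF category DA c[OF I(2)] f] n I by simp
  qed
  then have ex1: "\<exists>!h. h \<in> hom C X Y \<and> (\<forall>i \<in> I. Cmp C h (c i) = ?d i)"
    using col unfolding is_colimit_iff poset_cat_simps by blast
  have "f \<in> hom C X Y \<and> (\<forall>i \<in> I. Cmp C f (c i) = ?d i)" "g \<in> hom C X Y \<and> (\<forall>i \<in> I. Cmp C g (c i) = ?d i)"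
    using f g fg by simp_all
  then show ?thesis using ex1 by (elim ex1E) metis
qed

text \<open>The relations say that \<open>g\<close> commutes with the action of \<open>S\<close>.
  Its values at the legs of a colimit presentation of \<open>X\<close> then form a cocone on
  \<open>Y\<close>, and \<open>f\<close> is the mediator.\<close>

lemma em_full:
  assumes X: "X \<in> Ob C" and Y: "Y \<in> Ob C" and g: "struc_emb \<tau> (St X) (St Y) g"
  shows "\<exists>f \<in> hom C X Y. em f = g"
proof -
  obtain I r D c where D: "\<forall>i \<in> I. FOb D i \<in> S" and col: "is_colimit (poset_cat I r) C D (X, c)"
    and dir: "directed_poset \<mu> I r" and Df: "is_functor (poset_cat I r) C D"
    using colimits_of_S[OF X] by blast
  have cc: "is_cocone (poset_cat I r) C D (X, c)" using col by (simp add: is_colimit_iff)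
  have c: "c i \<in> hom C (FOb D i) X" if "i \<in> I" for i using cc that by (simp add: poset_cocone_iff)
  have gY: "g a \<in> pts Y" if "a \<in> pts X" for a using g that by (auto simp: struc_emb_iff)
  have gu: "g (Cmp C a u) = Cmp C (g a) u \<and> Dom C (g a) = Cod C u"
    if a: "a \<in> pts X" and u: "u \<in> syms" and d: "Dom C a = Cod C u" for a u
  proof -
    note au = Cmp_sym[OF a u d]
    have "pair a (Cmp C a u) \<in> Rl (St X) u" using Rl_St[OF u a au] d by simp
    then have "pair (g a) (g (Cmp C a u)) \<in> Rl (St Y) u" using g u a au by (simp add: struc_emb_iff)
    then show ?thesis using Rl_St[OF u gY[OF a] gY[OF au]] by simp
  qed
  \<comment> \<open>The relation of the identity of \<open>Dom C a\<close> holds at the pair of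
    \<open>a\<close> with itself; preserving it forces \<open>g a\<close> to have the same
    domain.\<close>
  have gd: "Dom C (g a) = Dom C a" if a: "a \<in> pts X" for a
  proof -
    have s: "Dom C a \<in> S" using a by (simp add: pts_iff)
    have "Idn C (Dom C a) \<in> hom C (Dom C a) (Dom C a)" using Idn_hom[OF category S_Ob[OF s]] .
    then have "Idn C (Dom C a) \<in> syms" "Cod C (Idn C (Dom C a)) = Dom C a" using s by (auto simp: syms_def hom_def)
    then show ?thesis using gu[OF a] by simp
  qed
  have gh: "g a \<in> hom C s Y" if "a \<in> hom C s X" "s \<in> S" for a s
    using gY[OF hom_pts[OF that]] gd[OF hom_pts[OF that]] homD(2)[OF that(1)] by (simp add: pts_iff)
  let ?d = "\<lambda>i \<in> I. g (c i)"
  have "is_cocone (poset_cat I r) C D (Y, ?d)"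
    unfolding poset_cocone_iff
  proof (intro conjI ballI allI impI Y)
    show "?d \<in> extensional I" by simp
    show "?d i \<in> hom C (FOb D i) Y" if "i \<in> I" for i using gh[OF c[OF that]] D that by simp
    fix i j assume ij: "(i, j) \<in> r"
    have I: "i \<in> I" "j \<in> I" using ij directed_posetD(2)[OF dir] by auto
    have n: "Cmp C (c j) (FArr D (i, j)) = c i" using cc ij unfolding poset_cocone_iff by blast
    have DA: "FArr D (i, j) \<in> hom C (FOb D i) (FOb D j)" using Df ij unfolding poset_functor_iff by blast
    then have u: "FArr D (i, j) \<in> syms" using D I by (auto simp: syms_def hom_def)
    have "c j \<in> pts X" using hom_pts[OF c[OF I(2)]] D I by blast
    from gu[OF this u] show "Cmp C (?d j) (FArr D (i, j)) = ?d i"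
      using n I homD[OF DA] homD(2)[OF c[OF I(2)]] by simp
  qed
  then obtain f where f: "f \<in> hom C X Y" "\<forall>i \<in> I. Cmp C f (c i) = ?d i"
    using col unfolding is_colimit_iff poset_cat_simps by blast
  have "em f = g"
  proof (rule extensionalityI)
    show "em f \<in> extensional (pts X)" using homD(2)[OF f(1)] by (simp add: em_def)
    show "g \<in> extensional (pts X)" using g by (simp add: struc_emb_iff)
    fix a assume a: "a \<in> pts X"
    then have s: "Dom C a \<in> S" and ah: "a \<in> hom C (Dom C a) X" by (simp_all add: pts_iff)
    \<comment> \<open>Presentability extends the agreement of \<open>f\<close> and \<open>g\<close>
      from the legs to every \<open>a\<close>: the factor \<open>b\<close> runs between objects of
      \<open>S\<close>, so it is a symbol, and \<open>g\<close> commutes with it.\<close>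
    obtain i b where i: "i \<in> I" and b: "b \<in> hom C (Dom C a) (FOb D i)" "Cmp C (c i) b = a"
      using presentable_S[OF s] dir Df col ah unfolding presentable_iff by blast
    have bs: "b \<in> syms" using b(1) s D i by (auto simp: syms_def hom_def)
    have ci: "c i \<in> pts X" using hom_pts[OF c[OF i]] D i by blast
    have "g a = Cmp C (g (c i)) b" using gu[OF ci bs] b homD[OF b(1)] homD(2)[OF c[OF i]] by simp
    also have "\<dots> = Cmp C (Cmp C f (c i)) b" using f(2) i by simp
    also have "\<dots> = Cmp C f a" using Cmp_assoc[OF category b(1) c[OF i] f(1)] b(2) by simp
    also have "\<dots> = em f a" using em_into[OF f(1) a] by simp
    finally show "em f a = g a" by simp
  qed
  then show ?thesis using f(1) by blast
qed

end

section \<open>The class of structures and its chain axioms\<close>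

context polypresentable_category begin

definition \<K>\<^sub>S :: "'u abs_class" where
  "\<K>\<^sub>S = (let Mod = {M. \<exists>X \<in> Ob C. \<exists>g. struc_iso \<tau> (St X) M g}
    in \<lparr>voc = \<tau>, models = Mod, leq = (\<lambda>M N. M \<in> Mod \<and> N \<in> Mod \<and> substruc \<tau> M N)\<rparr>)"

lemma voc_K [simp]: "voc \<K>\<^sub>S = \<tau>"
  by (simp add: \<K>\<^sub>S_def Let_def)

lemma models_K: "M \<in> models \<K>\<^sub>S \<longleftrightarrow> (\<exists>X \<in> Ob C. \<exists>g. struc_iso \<tau> (St X) M g)"
  by (simp add: \<K>\<^sub>S_def Let_def)

lemma leq_K: "leq \<K>\<^sub>S M N \<longleftrightarrow> M \<in> models \<K>\<^sub>S \<and> N \<in> models \<K>\<^sub>S \<and> substruc \<tau> M N"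
  by (simp add: \<K>\<^sub>S_def Let_def)

lemma vocabulary: "is_vocabulary \<mu> \<tau>"
  unfolding is_vocabulary_def using small_syms finite_less_mu[of "{p, q}"] by (simp add: finite_small)

lemma abstract_class_K: "abstract_class \<mu> \<K>\<^sub>S"
  unfolding abstract_class_def voc_K
proof (intro conjI ballI allI impI)
  show "is_vocabulary \<mu> \<tau>" by (rule vocabulary)
  show st: "is_struc \<tau> M" if "M \<in> models \<K>\<^sub>S" for M using that by (auto simp: models_K struc_iso_def)
  show mi: "N \<in> models \<K>\<^sub>S" if "M \<in> models \<K>\<^sub>S" "struc_iso \<tau> M N f" for M N f
    using that struc_iso_comp unfolding models_K by blast
  show "substruc \<tau> M N" if "leq \<K>\<^sub>S M N" for M N using that by (simp add: leq_K)
  show "partial_order_on (models \<K>\<^sub>S) {(M, N). leq \<K>\<^sub>S M N}"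
    unfolding partial_order_on_def preorder_on_def
  proof (intro conjI)
    show "refl_on (models \<K>\<^sub>S) {(M, N). leq \<K>\<^sub>S M N}" using st substruc_refl by (auto simp: refl_on_def leq_K)
    show "trans {(M, N). leq \<K>\<^sub>S M N}" using substruc_trans by (auto simp: trans_def leq_K)
    show "{(M, N). leq \<K>\<^sub>S M N} \<subseteq> models \<K>\<^sub>S \<times> models \<K>\<^sub>S" by (auto simp: leq_K)
    have "M = N" if MN: "substruc \<tau> M N" and NM: "substruc \<tau> N M" for M N
    proof (rule substruc_unique[OF MN])
      show "substruc \<tau> N N" by (rule substruc_refl) (use MN in \<open>simp add: substruc_def\<close>)
      show "Univ M = Univ N" using MN NM by (auto simp: substruc_def)
    qed
    then show "antisym {(M, N). leq \<K>\<^sub>S M N}" by (auto simp: antisym_def leq_K)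
  qed
  fix M N M' N' f
  assume "leq \<K>\<^sub>S M N \<and> struc_iso \<tau> N N' f \<and> struc_iso \<tau> M M' (restrict f (Univ M))"
  then have le: "leq \<K>\<^sub>S M N" and f: "struc_iso \<tau> N N' f" and fM: "struc_iso \<tau> M M' (restrict f (Univ M))" by auto
  have "struc_emb \<tau> M N' (restrict f (Univ M))"
    using struc_emb_restrict[of \<tau> N N' f M] le f by (simp add: leq_K struc_iso_iff)
  from struc_emb_image[OF this] have "substruc \<tau> M' N'" using struc_iso_unique[OF fM] by metis
  moreover have "M' \<in> models \<K>\<^sub>S" "N' \<in> models \<K>\<^sub>S" using mi[OF _ f] mi[OF _ fM] le by (auto simp: leq_K)
  ultimately show "leq \<K>\<^sub>S M' N'" by (simp add: leq_K)
qed

sublocale K: abs_class \<mu> \<K>\<^sub>S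
  by unfold_locales (rule abstract_class_K)

lemma coherence_K: "coherence \<K>\<^sub>S"
  by (auto simp: coherence_def leq_K)

lemma St_models: "X \<in> Ob C \<Longrightarrow> St X \<in> models \<K>\<^sub>S"
proof -
  assume X: "X \<in> Ob C"
  have "struc_iso \<tau> (St X) (St X) (\<lambda>x \<in> Univ (St X). x)"
    using struc_emb_id[OF St_struc[OF X]] by (auto simp: struc_iso_iff)
  then show ?thesis using X models_K by blast
qed

lemma emb_image_leq:
  assumes M: "M \<in> models \<K>\<^sub>S" and N: "N \<in> models \<K>\<^sub>S" and f: "struc_emb \<tau> M N f"
  shows "leq \<K>\<^sub>S (restr_struc \<tau> N (f ` Univ M)) N"
  using K.models_iso[OF M] struc_emb_image[OF f] N by (auto simp: leq_K)

text \<open>Fullness extended from the structures \<open>St X\<close> to their isomorphic copies,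
  relative to chosen presentations \<open>g\<close> and \<open>h\<close>.\<close>

lemma emb_arrow:
  assumes X: "X \<in> Ob C" and Y: "Y \<in> Ob C" and g: "struc_iso \<tau> (St X) M g" and h: "struc_iso \<tau> (St Y) N h"
    and f: "struc_emb \<tau> M N f"
  shows "\<exists>k \<in> hom C X Y. \<forall>a \<in> pts X. h (em k a) = f (g a)"
proof -
  obtain h' where h': "struc_iso \<tau> N (St Y) h'" "\<forall>y \<in> Univ N. h (h' y) = y" using struc_iso_inv[OF h] by blast
  have ge: "struc_emb \<tau> (St X) M g" and he: "struc_emb \<tau> N (St Y) h'" using g h'(1) by (auto simp: struc_iso_iff)
  obtain k where k: "k \<in> hom C X Y" "em k = compose (pts X) h' (compose (pts X) f g)"
    using em_full[OF X Y struc_emb_comp[OF struc_emb_comp[OF ge f] he]] by auto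
  have "h (em k a) = f (g a)" if a: "a \<in> pts X" for a
  proof -
    have "g a \<in> Univ M" using ge a by (auto simp: struc_emb_def)
    then have "f (g a) \<in> Univ N" using f by (auto simp: struc_emb_def)
    then show ?thesis using k(2) a h'(2) by (simp add: compose_eq)
  qed
  then show ?thesis using k(1) by blast
qed

text \<open>The real content is that the union is a model. The inclusions are translated to a
  diagram in \<open>C\<close>, and the union turns out to be isomorphic to the structure of its
  colimit.\<close>

lemma chain_axioms_K: "chain_axioms \<mu> \<K>\<^sub>S"
  unfolding chain_axioms_def voc_K
proof (intro allI impI)
  fix I r M
  assume sys: "directed_system \<mu> \<K>\<^sub>S I r M"
  have dir: "directed_poset \<mu> I r" and Mm: "\<And>i. i \<in> I \<Longrightarrow> M i \<in> models \<K>\<^sub>S"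
    and le: "\<And>i j. (i, j) \<in> r \<Longrightarrow> substruc \<tau> (M i) (M j)"
    using sys by (auto simp: directed_system_def leq_K)
  note dp = directed_posetD[OF dir]
  let ?N = "union_struc \<tau> I M"
  have NU: "Univ ?N = (\<Union>i \<in> I. Univ (M i))" and NR: "Rl ?N s = (\<Union>i \<in> I. Rl (M i) s)" for s
    by (simp_all add: union_struc_def)
  have Ms: "is_struc \<tau> (M i)" if "i \<in> I" for i using K.models_struc[OF Mm[OF that]] by simp
  have Mmono: "Univ (M i) \<subseteq> Univ (M j)" if "(i, j) \<in> r" for i j using le[OF that] by (simp add: substruc_def)
  have MRl: "pair a b \<in> Rl (M i) s \<longleftrightarrow> pair a b \<in> Rl (M j) s"
    if "(i, j) \<in> r" "s \<in> syms" "a \<in> Univ (M i)" "b \<in> Univ (M i)" for i j s a b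
    using le[OF that(1)] that by (simp add: substruc_def)
  have MRl_in: "a \<in> Univ (M i)" "b \<in> Univ (M i)" if "pair a b \<in> Rl (M i) s" "i \<in> I" "s \<in> syms" for a b i s
  proof -
    have "pair a b \<in> {p, q} \<rightarrow>\<^sub>E Univ (M i)" using is_struc_Rl[OF Ms[OF that(2)], of s] that by auto
    then show "a \<in> Univ (M i)" "b \<in> Univ (M i)" by simp_all
  qed
  have Ns: "is_struc \<tau> ?N"
    unfolding is_struc_iff
  proof (intro conjI ballI allI impI)
    show "small TYPE('u) (Univ ?N)" unfolding NU using dp(1) Ms by (intro small_UN) (auto simp: is_struc_iff)
    show "Fn ?N = (\<lambda>s x. undefined)" by (simp add: union_struc_def)
    show "Rl ?N s \<subseteq> {p, q} \<rightarrow>\<^sub>E Univ ?N" if s: "s \<in> syms" for s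
    proof -
      have "Rl (M i) s \<subseteq> {p, q} \<rightarrow>\<^sub>E Univ ?N" if i: "i \<in> I" for i
      proof -
        have "Rl (M i) s \<subseteq> {p, q} \<rightarrow>\<^sub>E Univ (M i)" using is_struc_Rl[OF Ms[OF i], of s] s by simp
        also have "\<dots> \<subseteq> {p, q} \<rightarrow>\<^sub>E Univ ?N" by (rule PiE_mono) (use NU i in blast)
        finally show ?thesis .
      qed
      then show ?thesis unfolding NR by blast
    qed
    show "Rl ?N s = {}" if "s \<notin> syms" for s unfolding NR using Ms that by (auto simp: is_struc_iff)
  qed
  \<comment> \<open>The union adds no relation between elements of \<open>M i\<close>: one that
    holds in \<open>M j\<close> is compared with \<open>M i\<close> in a common extension.\<close>
  have NRl: "pair a b \<in> Rl ?N s \<longleftrightarrow> pair a b \<in> Rl (M i) s"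
    if i: "i \<in> I" and s: "s \<in> syms" and ab: "a \<in> Univ (M i)" "b \<in> Univ (M i)" for i s a b
  proof
    assume "pair a b \<in> Rl ?N s"
    then obtain j where j: "j \<in> I" "pair a b \<in> Rl (M j) s" unfolding NR by blast
    obtain k where k: "(i, k) \<in> r" "(j, k) \<in> r" using directed_poset_ub[OF dir i j(1)] by blast
    show "pair a b \<in> Rl (M i) s"
      using MRl[OF k(1) s ab] MRl[OF k(2) s MRl_in[OF j(2,1) s]] j(2) by blast
  qed (use i NR in blast)
  have emb_incl: "substruc \<tau> (M i) P" if i: "i \<in> I" and P: "is_struc \<tau> P" and U: "Univ (M i) \<subseteq> Univ P"
    and R: "\<And>s a b. s \<in> syms \<Longrightarrow> a \<in> Univ (M i) \<Longrightarrow> b \<in> Univ (M i) \<Longrightarrow> pair a b \<in> Rl P s \<longleftrightarrow> pair a b \<in> Rl (M i) s" for i P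
  proof -
    have "x \<in> Rl (M i) s \<longleftrightarrow> x \<in> Rl P s \<and> x \<in> {p, q} \<rightarrow>\<^sub>E Univ (M i)" if s: "s \<in> syms" for s x
    proof (cases "x \<in> {p, q} \<rightarrow>\<^sub>E Univ (M i)")
      case True
      then show ?thesis using R[OF s] by (elim PiE_pairE) simp
    next
      case False
      then show ?thesis using is_struc_Rl[OF Ms[OF i], of s] s by auto
    qed
    then show ?thesis unfolding substruc_def using Ms[OF i] P U by auto
  qed
  have MN: "substruc \<tau> (M i) ?N" if "i \<in> I" for i
    by (rule emb_incl[OF that Ns]) (use NU NRl that in auto)
  have "\<forall>i. \<exists>X g. i \<in> I \<longrightarrow> X \<in> Ob C \<and> struc_iso \<tau> (St X) (M i) g" using Mm unfolding models_K by blast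
  then obtain X g where Xg: "\<And>i. i \<in> I \<Longrightarrow> X i \<in> Ob C \<and> struc_iso \<tau> (St (X i)) (M i) (g i)" by metis
  have gU: "g i ` pts (X i) = Univ (M i)" and ge: "struc_emb \<tau> (St (X i)) (M i) (g i)" and ginj: "inj_on (g i) (pts (X i))"
    if "i \<in> I" for i using Xg[OF that] by (auto simp: struc_iso_iff struc_emb_def)
  have "\<forall>i j. \<exists>k. (i, j) \<in> r \<longrightarrow> k \<in> hom C (X i) (X j) \<and> (\<forall>a \<in> pts (X i). g j (em k a) = g i a)"
  proof (intro allI)
    fix i j
    show "\<exists>k. (i, j) \<in> r \<longrightarrow> k \<in> hom C (X i) (X j) \<and> (\<forall>a \<in> pts (X i). g j (em k a) = g i a)"
    proof (cases "(i, j) \<in> r")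
      case True
      then have I: "i \<in> I" "j \<in> I" using dp(2) by auto
      obtain k where k: "k \<in> hom C (X i) (X j)" "\<forall>a \<in> pts (X i). g j (em k a) = (\<lambda>x \<in> Univ (M i). x) (g i a)"
        using emb_arrow[of "X i" "X j" "M i" "g i" "M j" "g j"] Xg[OF I(1)] Xg[OF I(2)] substruc_inclusion[OF le[OF True]]
        by blast
      have "g i a \<in> Univ (M i)" if "a \<in> pts (X i)" for a using gU[OF I(1)] that by blast
      then show ?thesis using k by auto
    qed simp
  qed
  then obtain \<phi> where \<phi>: "\<And>i j. (i, j) \<in> r \<Longrightarrow> \<phi> i j \<in> hom C (X i) (X j) \<and> (\<forall>a \<in> pts (X i). g j (em (\<phi> i j) a) = g i a)"
    by metis
  have \<phi>h: "\<phi> i j \<in> hom C (X i) (X j)" if "(i, j) \<in> r" for i j using \<phi> that by blast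
  \<comment> \<open>Faithfulness characterizes the transition arrows by their compatibility with the
    presentations \<open>g\<close>; both functor laws are then checked on elements.\<close>
  have \<phi>_unique: "k = \<phi> i j" if ij: "(i, j) \<in> r" and k: "k \<in> hom C (X i) (X j)"
    and kg: "\<And>a. a \<in> pts (X i) \<Longrightarrow> g j (em k a) = g i a" for i j k
  proof (rule em_faithful[OF k \<phi>h[OF ij]], rule extensionalityI)
    show "em k \<in> extensional (pts (X i))" "em (\<phi> i j) \<in> extensional (pts (X i))"
      using homD(2)[OF k] homD(2)[OF \<phi>h[OF ij]] by (simp_all add: em_def)
    have j: "j \<in> I" using ij dp(2) by blast
    fix a assume a: "a \<in> pts (X i)"
    have "g j (em k a) = g j (em (\<phi> i j) a)" using kg[OF a] \<phi>[OF ij] a by simp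
    then show "em k a = em (\<phi> i j) a"
      using ginj[OF j] em_into[OF k a] em_into[OF \<phi>h[OF ij] a] by (meson inj_onD)
  qed
  define D where "D = \<lparr>FOb = X, FArr = (\<lambda>(i, j). \<phi> i j)\<rparr>"
  have D: "is_functor (poset_cat I r) C D"
    unfolding poset_functor_iff D_def ftor.simps prod.case
  proof (intro conjI ballI allI impI)
    show "X i \<in> Ob C" if "i \<in> I" for i using Xg that by blast
    show "\<phi> i j \<in> hom C (X i) (X j)" if "(i, j) \<in> r" for i j using \<phi>h that .
    show "\<phi> i i = Idn C (X i)" if i: "i \<in> I" for i
    proof -
      have id: "Idn C (X i) \<in> hom C (X i) (X i)" using Idn_hom[OF category] Xg[OF i] by blast
      have "em (Idn C (X i)) a = a" if "a \<in> pts (X i)" for a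
        using em_into[OF id that] Idn_Cmp[OF category] that unfolding pts_iff[of a] by metis
      then show ?thesis using \<phi>_unique[OF dp(3)[OF i] id] by simp
    qed
    show "\<phi> i k = Cmp C (\<phi> j k) (\<phi> i j)" if ij: "(i, j) \<in> r" and jk: "(j, k) \<in> r" for i j k
    proof -
      note ik = dp(4)[OF ij jk]
      have "g k (em (Cmp C (\<phi> j k) (\<phi> i j)) a) = g i a" if a: "a \<in> pts (X i)" for a
      proof -
        have "g k (em (\<phi> j k) (em (\<phi> i j) a)) = g j (em (\<phi> i j) a)"
          using \<phi>[OF jk] em_into[OF \<phi>h[OF ij] a] by blast
        then show ?thesis
          unfolding em_Cmp[OF \<phi>h[OF ij] \<phi>h[OF jk]] using a \<phi>[OF ij] by (simp add: compose_eq)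
      qed
      then show ?thesis using \<phi>_unique[OF ik Cmp_hom[OF category \<phi>h[OF ij] \<phi>h[OF jk]]] by simp
    qed
  qed
  obtain Y c where col: "is_colimit (poset_cat I r) C D (Y, c)"
    using directed_colimits dir D unfolding has_directed_colimits_def by (metis surj_pair)
  have cc: "is_cocone (poset_cat I r) C D (Y, c)" using col by (simp add: is_colimit_iff)
  have Y: "Y \<in> Ob C" and c: "\<And>i. i \<in> I \<Longrightarrow> c i \<in> hom C (X i) Y"
    and cn: "\<And>i j. (i, j) \<in> r \<Longrightarrow> Cmp C (c j) (\<phi> i j) = c i"
    using cc by (auto simp: poset_cocone_iff D_def)
  have cin: "em (c i) a \<in> pts Y" if "i \<in> I" "a \<in> pts (X i)" for i a using em_into[OF c[OF that(1)] that(2)] by blast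
  have ce: "struc_emb \<tau> (St (X i)) (St Y) (em (c i))" if "i \<in> I" for i using em_emb[OF c[OF that]] .
  \<comment> \<open>Presentability of \<open>S\<close> enters here: an element of the colimit is an
    arrow from an object of \<open>S\<close>, so it factors through a leg.\<close>
  have surj: "pts Y = (\<Union>i \<in> I. em (c i) ` pts (X i))"
  proof
    show "(\<Union>i \<in> I. em (c i) ` pts (X i)) \<subseteq> pts Y" using cin by blast
    show "pts Y \<subseteq> (\<Union>i \<in> I. em (c i) ` pts (X i))"
    proof
      fix a assume a: "a \<in> pts Y"
      then have s: "Dom C a \<in> S" and ah: "a \<in> hom C (Dom C a) Y" by (simp_all add: pts_iff)
      obtain i b where i: "i \<in> I" and b': "b \<in> hom C (Dom C a) (FOb D i)" "Cmp C (c i) b = a"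
        using presentable_S[OF s] dir D col ah unfolding presentable_iff by blast
      have b: "b \<in> hom C (Dom C a) (X i)" "Cmp C (c i) b = a" using b' by (simp_all add: D_def)
      have "b \<in> pts (X i)" using hom_pts[OF b(1) s] .
      then have "a = em (c i) b" "b \<in> pts (X i)" using em_into[OF c[OF i]] b(2) by auto
      then show "a \<in> (\<Union>i \<in> I. em (c i) ` pts (X i))" using i by blast
    qed
  qed
  have c\<phi>: "em (c j) (em (\<phi> i j) a) = em (c i) a" if ij: "(i, j) \<in> r" and a: "a \<in> pts (X i)" for i j a
  proof -
    have "j \<in> I" using ij dp(2) by blast
    then have "em (c i) = compose (pts (X i)) (em (c j)) (em (\<phi> i j))"
      using em_Cmp[OF \<phi>h[OF ij] c] cn[OF ij] by simp
    then show ?thesis using a by (simp add: compose_eq)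
  qed
  have cinj: "inj_on (em (c i)) (pts (X i))" if "i \<in> I" for i using ce[OF that] by (simp add: struc_emb_def)
  \<comment> \<open>The sets \<open>pts (X i)\<close> cover the colimit through the legs and the
    union through the presentations, with the same transition maps, so the comparison is obtained by
    gluing.\<close>
  have "\<exists>h \<in> extensional (pts Y). inj_on h (pts Y) \<and> (\<forall>i \<in> I. \<forall>x \<in> pts (X i). h (em (c i) x) = g i x)"
  proof (rule directed_glue[OF dir, where \<phi> = "\<lambda>i j. em (\<phi> i j)"])
    show "em (\<phi> i j) x \<in> pts (X j)" if "(i, j) \<in> r" "x \<in> pts (X i)" for i j x
      using em_into[OF \<phi>h[OF that(1)] that(2)] by blast
    show "g j (em (\<phi> i j) x) = g i x" if "(i, j) \<in> r" "x \<in> pts (X i)" for i j x using \<phi> that by blast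
  qed (fact cinj c\<phi> ginj surj)+
  then obtain h where h: "h \<in> extensional (pts Y)" "inj_on h (pts Y)"
    and hc: "\<And>i x. i \<in> I \<Longrightarrow> x \<in> pts (X i) \<Longrightarrow> h (em (c i) x) = g i x" by blast
  have hU: "h ` pts Y = Univ ?N"
  proof -
    have "h ` em (c i) ` pts (X i) = Univ (M i)" if "i \<in> I" for i
      unfolding gU[OF that, symmetric] image_image using hc[OF that] by (rule image_cong[OF refl])
    then show ?thesis unfolding surj NU image_UN by simp
  qed
  have iso: "struc_iso \<tau> (St Y) ?N h"
    unfolding struc_iso_iff struc_emb_iff Univ_St
  proof (intro conjI ballI hU Ns St_struc[OF Y] h)
    show "h ` pts Y \<subseteq> Univ ?N" using hU by simp
    fix s a b assume s: "s \<in> syms" and a: "a \<in> pts Y" and b: "b \<in> pts Y"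
    obtain i j a0 b0 where i: "i \<in> I" "a0 \<in> pts (X i)" "a = em (c i) a0" and j: "j \<in> I" "b0 \<in> pts (X j)" "b = em (c j) b0"
      using a b unfolding surj by blast
    obtain k where k: "k \<in> I" "(i, k) \<in> r" "(j, k) \<in> r" using directed_poset_ub[OF dir i(1) j(1)] .
    define a' b' where "a' = em (\<phi> i k) a0" and "b' = em (\<phi> j k) b0"
    have a': "a' \<in> pts (X k)" "a = em (c k) a'"
      using em_into[OF \<phi>h[OF k(2)] i(2)] c\<phi>[OF k(2) i(2)] i(3) by (auto simp: a'_def)
    have b': "b' \<in> pts (X k)" "b = em (c k) b'"
      using em_into[OF \<phi>h[OF k(3)] j(2)] c\<phi>[OF k(3) j(2)] j(3) by (auto simp: b'_def)
    have "pair a b \<in> Rl (St Y) s \<longleftrightarrow> pair a' b' \<in> Rl (St (X k)) s"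
      using ce[OF k(1)] s a' b' by (simp add: struc_emb_iff)
    also have "\<dots> \<longleftrightarrow> pair (g k a') (g k b') \<in> Rl (M k) s"
      using ge[OF k(1)] s a' b' by (simp add: struc_emb_iff)
    also have "\<dots> \<longleftrightarrow> pair (g k a') (g k b') \<in> Rl ?N s"
      using NRl[OF k(1) s] gU[OF k(1)] a'(1) b'(1) by blast
    also have "g k a' = h a" using hc[OF k(1) a'(1)] a'(2) by simp
    also have "g k b' = h b" using hc[OF k(1) b'(1)] b'(2) by simp
    finally show "pair a b \<in> Rl (St Y) s \<longleftrightarrow> pair (h a) (h b) \<in> Rl ?N s" .
  qed
  then have Nm: "?N \<in> models \<K>\<^sub>S" using Y models_K by blast
  have "leq \<K>\<^sub>S (M i) ?N" if "i \<in> I" for i using MN[OF that] Mm[OF that] Nm by (simp add: leq_K)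
  moreover have "leq \<K>\<^sub>S ?N P" if P: "P \<in> models \<K>\<^sub>S" and MP: "\<And>i. i \<in> I \<Longrightarrow> leq \<K>\<^sub>S (M i) P" for P
  proof -
    have MP': "substruc \<tau> (M i) P" if "i \<in> I" for i using MP[OF that] by (simp add: leq_K)
    have U: "Univ ?N \<subseteq> Univ P" unfolding NU using MP' by (auto simp: substruc_def)
    \<comment> \<open>A pair of elements of the union lies in one \<open>M i\<close>, which is a
      substructure of both \<open>?N\<close> and \<open>P\<close>.\<close>
    have "x \<in> Rl ?N s \<longleftrightarrow> x \<in> Rl P s" if s: "s \<in> syms" and x: "x \<in> {p, q} \<rightarrow>\<^sub>E Univ ?N" for s x
    proof -
      obtain i where i: "i \<in> I" "x \<in> {p, q} \<rightarrow>\<^sub>E Univ (M i)"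
        using directed_tuple[OF dir finite_less_mu[of "{p, q}"] x[unfolded NU] Mmono] by blast
      obtain a b where ab: "a \<in> Univ (M i)" "b \<in> Univ (M i)" "x = pair a b" using PiE_pairE[OF i(2)] .
      show ?thesis unfolding ab(3) NRl[OF i(1) s ab(1,2)] using MP'[OF i(1)] s ab(1,2) by (simp add: substruc_def)
    qed
    then have "Rl ?N s = Rl P s \<inter> ({p, q} \<rightarrow>\<^sub>E Univ ?N)" if s: "s \<in> syms" for s
      using is_struc_Rl[OF Ns, of s] s by auto
    then have "substruc \<tau> ?N P" unfolding substruc_def using Ns K.models_struc[OF P] U by simp
    then show ?thesis using Nm P by (simp add: leq_K)
  qed
  ultimately show "?N \<in> models \<K>\<^sub>S \<and> (\<forall>i \<in> I. leq \<K>\<^sub>S (M i) ?N) \<and>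
    (\<forall>P \<in> models \<K>\<^sub>S. (\<forall>i \<in> I. leq \<K>\<^sub>S (M i) P) \<longrightarrow> leq \<K>\<^sub>S ?N P)" using Nm by blast
qed

end

section \<open>Closures from polycolimits, intersections and the Loewenheim-Skolem axiom\<close>

context polypresentable_category begin

text \<open>Containing an element \<open>b j\<close> is expressed as factorization of the arrow
  \<open>b j\<close>, so that the statement concerns the category alone;
  \<open>polycolimit_hull\<close> translates it into images.\<close>

lemma polycolimit_closure:
  assumes pc: "is_polycolimit TYPE('u) (discrete_cat J) C (discrete_diagram C d) \<I>"
    and X: "X \<in> Ob C" and b: "\<And>j. j \<in> J \<Longrightarrow> b j \<in> hom C (d j) X"
  shows "\<exists>P \<in> fst ` \<I>. \<exists>h \<in> hom C P X. (\<forall>j \<in> J. \<exists>a \<in> hom C (d j) P. Cmp C h a = b j) \<and>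
    (\<forall>Y. \<forall>n \<in> hom C Y X. (\<forall>j \<in> J. \<exists>y \<in> hom C (d j) Y. Cmp C n y = b j) \<longrightarrow> (\<exists>k \<in> hom C P Y. Cmp C n k = h))"
proof -
  let ?J = "discrete_cat J" and ?D = "discrete_diagram C d"
  let ?K = "cocone_cat ?J C ?D"
  have poly: "\<I> \<subseteq> Ob ?K" "\<And>s. s \<in> Ob ?K \<Longrightarrow> \<exists>!i. i \<in> \<I> \<and> hom ?K i s \<noteq> {}"
    "\<And>s i f g. s \<in> Ob ?K \<Longrightarrow> i \<in> \<I> \<Longrightarrow> f \<in> hom ?K i s \<Longrightarrow> g \<in> hom ?K i s \<Longrightarrow> \<exists>h. h \<in> hom ?K i i \<and> Cmp ?K f h = g"
    using pc unfolding is_polycolimit_def polyinitial_def by blast+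
  let ?X = "(X, restrict b J)"
  have Xc: "is_cocone ?J C ?D ?X" unfolding discrete_cocone_iff[OF category] using X b by simp
  obtain i where i: "i \<in> \<I>" "hom ?K i ?X \<noteq> {}" using poly(2)[of ?X] Xc cocone_Ob by blast
  obtain h where h: "(i, h, ?X) \<in> hom ?K i ?X" using i(2) unfolding cocone_hom_nonempty by (elim exE)
  have ic: "is_cocone ?J C ?D i" and hh: "h \<in> hom C (fst i) X" and hj: "\<And>j. j \<in> J \<Longrightarrow> Cmp C h (snd i j) = b j"
    using h unfolding cocone_hom_iff by auto
  have legs: "snd i j \<in> hom C (d j) (fst i)" if "j \<in> J" for j
    using ic that discrete_cocone_iff[OF category, of J d "fst i" "snd i"] by simp
  have "\<exists>k \<in> hom C (fst i) Y. Cmp C n k = h"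
    if n: "n \<in> hom C Y X" and nb: "\<forall>j \<in> J. \<exists>y \<in> hom C (d j) Y. Cmp C n y = b j" for Y n
  proof -
    obtain y where y: "\<And>j. j \<in> J \<Longrightarrow> y j \<in> hom C (d j) Y \<and> Cmp C n (y j) = b j" using nb by metis
    let ?Y = "(Y, restrict y J)"
    have Yc: "is_cocone ?J C ?D ?Y"
      unfolding discrete_cocone_iff[OF category] using hom_Ob[OF category n] y by simp
    obtain i' where i': "i' \<in> \<I>" "hom ?K i' ?Y \<noteq> {}" using poly(2)[of ?Y] Yc cocone_Ob by blast
    obtain k where k: "(i', k, ?Y) \<in> hom ?K i' ?Y" using i'(2) unfolding cocone_hom_nonempty by (elim exE)
    have ic': "is_cocone ?J C ?D i'" and kh: "k \<in> hom C (fst i') Y" and kj: "\<And>j. j \<in> J \<Longrightarrow> Cmp C k (snd i' j) = y j"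
      using k unfolding cocone_hom_iff by auto
    have legs': "snd i' j \<in> hom C (d j) (fst i')" if "j \<in> J" for j
      using ic' that discrete_cocone_iff[OF category, of J d "fst i'" "snd i'"] by simp
    note nk = Cmp_hom[OF category kh n]
    have "Cmp C (Cmp C n k) (snd i' j) = b j" if j: "j \<in> J" for j
      using Cmp_assoc[OF category legs'[OF j] kh n] kj[OF j] y[OF j] by simp
    then have nkK: "(i', Cmp C n k, ?X) \<in> hom ?K i' ?X" unfolding cocone_hom_iff using ic' Xc nk by simp
    \<comment> \<open>The member below the cocone on \<open>Y\<close> is also below the cocone on
      \<open>X\<close>, through \<open>n\<close>; uniqueness of the member identifies the
      two.\<close>
    then have "i' = i" using poly(2)[of ?X] Xc cocone_Ob i i'(1) by blast
    then obtain t where t: "t \<in> hom ?K i i" "Cmp ?K (i, Cmp C n k, ?X) t = (i, h, ?X)"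
      using poly(3)[of ?X i "(i, Cmp C n k, ?X)" "(i, h, ?X)"] nkK h i(1) Xc cocone_Ob by blast
    obtain t' where t': "t = (i, t', i)" "t' \<in> hom C (fst i) (fst i)" using t(1) unfolding cocone_hom_iff by blast
    \<comment> \<open>The endomorphism \<open>t'\<close> corrects \<open>k\<close>: precomposing it
      turns the arrow through \<open>Y\<close> into \<open>h\<close>.\<close>
    have "Cmp C n (Cmp C k t') = h"
      using t(2) Cmp_assoc[OF category t'(2) _ n] kh \<open>i' = i\<close> by (simp add: t'(1))
    then show ?thesis using Cmp_hom[OF category t'(2)] kh \<open>i' = i\<close> by blast
  qed
  then show ?thesis using i(1) hh legs hj by (intro bexI[of _ "fst i"] bexI[of _ h]) blast+
qed

lemma image_em_iff:
  assumes n: "n \<in> hom C Y X" and b: "b \<in> pts X"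
  shows "b \<in> em n ` pts Y \<longleftrightarrow> (\<exists>y \<in> hom C (Dom C b) Y. Cmp C n y = b)"
proof
  assume "b \<in> em n ` pts Y"
  then obtain y where y: "y \<in> pts Y" "b = em n y" by blast
  have ny: "em n y = Cmp C n y" "Cmp C n y \<in> hom C (Dom C y) X" using em_into[OF n y(1)] by auto
  have "Dom C b = Dom C y" using homD(2)[OF ny(2)] ny(1) y(2) by simp
  then show "\<exists>y \<in> hom C (Dom C b) Y. Cmp C n y = b" using y ny(1) by (auto simp: pts_iff[of y])
next
  assume "\<exists>y \<in> hom C (Dom C b) Y. Cmp C n y = b"
  then obtain y where y: "y \<in> hom C (Dom C b) Y" "Cmp C n y = b" by blast
  have "y \<in> pts Y" using hom_pts[OF y(1)] b by (simp add: pts_iff)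
  then show "b \<in> em n ` pts Y" using em_into[OF n] y(2) by force
qed

text \<open>Elements are given as a family over \<open>J\<close> so that index sets may be taken
  from \<open>Field \<mu>\<close> when sizes are to be bounded; for intersections the family is the
  identity on a set of arrows.\<close>

lemma polycolimit_hull:
  assumes pc: "is_polycolimit TYPE('u) (discrete_cat J) C (discrete_diagram C d) \<I>"
    and X: "X \<in> Ob C" and B: "b ` J \<subseteq> pts X" and d: "\<And>j. j \<in> J \<Longrightarrow> d j = Dom C (b j)"
  shows "\<exists>P \<in> fst ` \<I>. \<exists>h. hull C pts em (b ` J) P h X"
proof -
  have bh: "b j \<in> hom C (d j) X" if "j \<in> J" for j using B d[OF that] that by (auto simp: pts_iff)
  have "\<exists>P \<in> fst ` \<I>. \<exists>h \<in> hom C P X. (\<forall>j \<in> J. \<exists>a \<in> hom C (d j) P. Cmp C h a = b j) \<and>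
    (\<forall>Y. \<forall>n \<in> hom C Y X. (\<forall>j \<in> J. \<exists>y \<in> hom C (d j) Y. Cmp C n y = b j) \<longrightarrow> (\<exists>k \<in> hom C P Y. Cmp C n k = h))"
    by (rule polycolimit_closure[OF pc X]) (rule bh)
  then obtain P h where P: "P \<in> fst ` \<I>" and h: "h \<in> hom C P X"
    and in_h: "\<forall>j \<in> J. \<exists>a \<in> hom C (d j) P. Cmp C h a = b j"
    and min: "\<forall>Y. \<forall>n \<in> hom C Y X. (\<forall>j \<in> J. \<exists>y \<in> hom C (d j) Y. Cmp C n y = b j) \<longrightarrow> (\<exists>k \<in> hom C P Y. Cmp C n k = h)" by (elim bexE conjE)
  have sub: "b ` J \<subseteq> em n ` pts Y \<longleftrightarrow> (\<forall>j \<in> J. \<exists>y \<in> hom C (d j) Y. Cmp C n y = b j)" if n: "n \<in> hom C Y X" for Y n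
  proof -
    have "b j \<in> em n ` pts Y \<longleftrightarrow> (\<exists>y \<in> hom C (d j) Y. Cmp C n y = b j)" if j: "j \<in> J" for j
      using image_em_iff[OF n, of "b j"] B d[OF j] j by (simp add: image_subset_iff)
    then show ?thesis by (simp add: image_subset_iff)
  qed
  have "em h ` pts P \<subseteq> em n ` pts Y" if n: "n \<in> hom C Y X" and nb: "b ` J \<subseteq> em n ` pts Y" for Y n
  proof -
    obtain k where k: "k \<in> hom C P Y" "Cmp C n k = h" using min n sub[OF n] nb by blast
    have "em h = compose (pts P) (em n) (em k)" using em_Cmp[OF k(1) n] k(2) by simp
    then have "em h ` pts P = em n ` em k ` pts P" by (auto simp: compose_eq)
    moreover have "em k ` pts P \<subseteq> pts Y" using em_into[OF k(1)] by blast
    ultimately show ?thesis by (simp add: image_mono)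
  qed
  then have "hull C pts em (b ` J) P h X"
    unfolding hull_def using h iffD2[OF sub[OF h] in_h] by (intro conjI allI ballI impI)
  then show ?thesis using P by blast
qed

lemma hull_submodel:
  assumes N: "struc_iso \<tau> (St X) N g" and X: "X \<in> Ob C" and h: "h \<in> hom C P X"
  shows "leq \<K>\<^sub>S (restr_struc \<tau> N (g ` em h ` pts P)) N"
proof -
  have "g ` em h ` pts P = compose (pts P) g (em h) ` pts P" by (auto simp: compose_eq)
  moreover have "struc_emb \<tau> (St P) N (compose (pts P) g (em h))"
    using struc_emb_comp[OF em_emb[OF h], of N g] N by (simp add: struc_iso_iff)
  moreover have "N \<in> models \<K>\<^sub>S" using N X models_K by blast
  ultimately show ?thesis
    using emb_image_leq[OF St_models, of P N "compose (pts P) g (em h)"] hom_Ob[OF category h] by simp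
qed

lemma intersections_K: "admits_intersections \<K>\<^sub>S"
  unfolding admits_intersections_def
proof (intro ballI allI impI)
  fix N A assume N: "N \<in> models \<K>\<^sub>S" and A: "A \<subseteq> Univ N"
  obtain X g where X: "X \<in> Ob C" and g: "struc_iso \<tau> (St X) N g" using N models_K by blast
  have gU: "g ` pts X = Univ N" and ginj: "inj_on g (pts X)" using g by (auto simp: struc_iso_iff struc_emb_def)
  \<comment> \<open>The preimage of \<open>A\<close> under the presentation. Its members are arrows,
    and each indexes its own domain in the discrete diagram.\<close>
  define B where "B = {a \<in> pts X. g a \<in> A}"
  have gB: "g ` B = A" using gU A by (auto simp: B_def)
  have BX: "B \<subseteq> pts X" by (auto simp: B_def)
  have smB: "small TYPE('u) B" using small_subset[OF small_pts[OF X] BX] .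
  have "is_functor (discrete_cat B) C (discrete_diagram C (Dom C))"
    by (rule discrete_diagram_functor[OF category]) (use BX S_Ob pts_iff in blast)
  then obtain \<I> where pc: "is_polycolimit TYPE('u) (discrete_cat B) C (discrete_diagram C (Dom C)) \<I>"
    using polycolimits small_category_discrete[OF smB] unfolding has_polycolimits_def by blast
  have "\<exists>P \<in> fst ` \<I>. \<exists>h. hull C pts em ((\<lambda>x. x) ` B) P h X"
    by (rule polycolimit_hull[OF pc X]) (use BX in auto)
  then obtain P h where hull: "hull C pts em B P h X" unfolding image_ident by blast
  note h = hullD(1)[OF hull] and Bh = hullD(2)[OF hull]
  let ?M = "restr_struc \<tau> N (g ` em h ` pts P)"
  have le: "leq \<K>\<^sub>S ?M N" using hull_submodel[OF g X h] .
  have "Univ ?M = \<Inter>{Univ M' | M'. leq \<K>\<^sub>S M' N \<and> A \<subseteq> Univ M'}"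
  proof
    have "A \<subseteq> Univ ?M" using Bh gB by auto
    then show "\<Inter>{Univ M' | M'. leq \<K>\<^sub>S M' N \<and> A \<subseteq> Univ M'} \<subseteq> Univ ?M"
      using le by (intro Inter_lower CollectI exI[of _ ?M]) simp
    have "Univ ?M \<subseteq> Univ M'" if M': "leq \<K>\<^sub>S M' N" "A \<subseteq> Univ M'" for M'
    proof -
      obtain Y g' where Y: "Y \<in> Ob C" and g': "struc_iso \<tau> (St Y) M' g'"
        using M'(1) leq_K models_K by blast
      have g'U: "g' ` pts Y = Univ M'" using g' by (simp add: struc_iso_iff)
      have "struc_emb \<tau> M' N (\<lambda>x \<in> Univ M'. x)" by (rule substruc_inclusion) (use M'(1) in \<open>simp add: leq_K\<close>)
      \<comment> \<open>A submodel of \<open>N\<close> is the image of an arrow of \<open>C\<close>,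
        so the minimality of the hull applies to it.\<close>
      then obtain n where n: "n \<in> hom C Y X" "\<forall>a \<in> pts Y. g (em n a) = (\<lambda>x \<in> Univ M'. x) (g' a)"
        using emb_arrow[OF Y X g' g] by blast
      have gn: "g (em n a) = g' a" if "a \<in> pts Y" for a using n(2) that g'U by auto
      have gnU: "g ` em n ` pts Y = Univ M'"
        unfolding g'U[symmetric] image_image by (rule image_cong[OF refl gn])
      have nX: "em n ` pts Y \<subseteq> pts X" using em_into[OF n(1)] by blast
      have "B \<subseteq> em n ` pts Y"
        by (rule inj_on_image_subsetD[OF ginj BX nX]) (simp add: gnU gB M'(2))
      then have "em h ` pts P \<subseteq> em n ` pts Y" using hullD(3)[OF hull n(1)] by blast
      then show ?thesis using image_mono[of _ _ g] gnU by fastforce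
    qed
    then show "Univ ?M \<subseteq> \<Inter>{Univ M' | M'. leq \<K>\<^sub>S M' N \<and> A \<subseteq> Univ M'}" by blast
  qed
  then show "\<exists>M. leq \<K>\<^sub>S M N \<and> Univ M = \<Inter>{Univ M' | M'. leq \<K>\<^sub>S M' N \<and> A \<subseteq> Univ M'}" using le by blast
qed

text \<open>
  There is only a small number of discrete diagrams of fewer than \<open>\<mu>\<close> objects of \<open>S\<close>, and each has
  a small polycolimit; this bounds the size of the closure of fewer than \<open>\<mu>\<close> elements.
\<close>

lemma ex_hull_bound:
  "\<exists>Z :: 'u set. small TYPE('u) Z \<and> (\<forall>N \<in> models \<K>\<^sub>S. \<forall>B \<subseteq> Univ N. |B| <o \<mu> \<longrightarrow>
     (\<exists>M. leq \<K>\<^sub>S M N \<and> B \<subseteq> Univ M \<and> |Univ M| \<le>o |Z| ))"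
proof -
  \<comment> \<open>Index sets are confined to \<open>Field \<mu>\<close>; this makes the diagrams a
    small set, uniformly in \<open>N\<close> and \<open>B\<close>.\<close>
  let ?W = "SIGMA J : Pow (Field \<mu>). J \<rightarrow>\<^sub>E S"
  have smJ: "small TYPE('u) J" if "J \<in> Pow (Field \<mu>)" for J using small_subset[OF small_Field_mu] that by blast
  have "\<exists>\<I>. is_polycolimit TYPE('u) (discrete_cat J) C (discrete_diagram C d) \<I>" if Jd: "(J, d) \<in> ?W" for J d
  proof -
    have "small_category TYPE('u) (discrete_cat J)" using small_category_discrete smJ Jd by blast
    moreover have "is_functor (discrete_cat J) C (discrete_diagram C d)"
      by (rule discrete_diagram_functor[OF category]) (use Jd S_Ob in auto)
    ultimately show ?thesis using polycolimits unfolding has_polycolimits_def by blast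
  qed
  then obtain \<I> where \<I>: "\<And>J d. (J, d) \<in> ?W \<Longrightarrow> is_polycolimit TYPE('u) (discrete_cat J) C (discrete_diagram C d) (\<I> J d)"
    by metis
  define T where "T = (\<Union>(J, d) \<in> ?W. fst ` \<I> J d)"
  have smT: "small TYPE('u) T"
    unfolding T_def
  proof (rule small_UN)
    show "small TYPE('u) ?W" using smJ small_S by (intro small_Sigma small_Pow small_Field_mu small_PiE)
    show "small TYPE('u) (case w of (J, d) \<Rightarrow> fst ` \<I> J d)" if "w \<in> ?W" for w
    proof -
      obtain J d where w: "w = (J, d)" by (cases w)
      have "small TYPE('u) (\<I> J d)"
        using \<I>[of J d] that unfolding w is_polycolimit_def polyinitial_def by blast
      then show ?thesis unfolding w by (simp add: small_image)
    qed
  qed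
  have TO: "T \<subseteq> Ob C"
  proof -
    have "fst i \<in> Ob C" if Jd: "(J, d) \<in> ?W" and i: "i \<in> \<I> J d" for J d i
    proof -
      have "\<I> J d \<subseteq> Ob (cocone_cat (discrete_cat J) C (discrete_diagram C d))"
        using \<I>[OF Jd] unfolding is_polycolimit_def polyinitial_def by blast
      then have "is_cocone (discrete_cat J) C (discrete_diagram C d) i" using i by (auto simp: cocone_cat_def)
      then show ?thesis by (auto simp: is_cocone_def)
    qed
    then show ?thesis unfolding T_def by blast
  qed
  have "small TYPE('u) (\<Union>P \<in> T. pts P)" using smT small_pts TO by (intro small_UN) auto
  moreover have "\<exists>M. leq \<K>\<^sub>S M N \<and> B \<subseteq> Univ M \<and> |Univ M| \<le>o |\<Union>P \<in> T. pts P|"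
    if N: "N \<in> models \<K>\<^sub>S" and B: "B \<subseteq> Univ N" "|B| <o \<mu>" for N B
  proof -
    obtain X g where X: "X \<in> Ob C" and g: "struc_iso \<tau> (St X) N g" using N models_K by blast
    have gU: "g ` pts X = Univ N" using g by (simp add: struc_iso_iff)
    \<comment> \<open>Enumerating \<open>B\<close> along an initial segment of \<open>\<mu>\<close>
      brings the diagram of its domains into \<open>?W\<close>.\<close>
    obtain j0 f where f: "bij_betw f (underS \<mu> j0) B" using less_mu_enum[OF B(2)] by blast
    let ?J = "underS \<mu> j0"
    have J: "?J \<in> Pow (Field \<mu>)" by (auto simp: underS_def Field_def)
    have "\<forall>j. \<exists>a. j \<in> ?J \<longrightarrow> a \<in> pts X \<and> g a = f j"
      using f B(1) gU by (metis bij_betwE image_iff subsetD)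
    then obtain b where b: "\<And>j. j \<in> ?J \<Longrightarrow> b j \<in> pts X \<and> g (b j) = f j" by metis
    let ?d = "\<lambda>j \<in> ?J. Dom C (b j)"
    have Jd: "(?J, ?d) \<in> ?W" using J b by (auto simp: pts_iff)
    have "\<exists>P \<in> fst ` \<I> ?J ?d. \<exists>h. hull C pts em (b ` ?J) P h X"
      by (rule polycolimit_hull[OF \<I>[OF Jd] X]) (use b in auto)
    then obtain P h where P: "P \<in> fst ` \<I> ?J ?d" and hull: "hull C pts em (b ` ?J) P h X" by blast
    note h = hullD(1)[OF hull] and bh = hullD(2)[OF hull]
    have PT: "P \<in> T" unfolding T_def using Jd P by blast
    have "B \<subseteq> g ` em h ` pts P"
    proof -
      have "B = f ` ?J" using f by (simp add: bij_betw_def)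
      also have "\<dots> = g ` b ` ?J" unfolding image_image using b by (intro image_cong) simp_all
      finally show ?thesis using bh by blast
    qed
    moreover have "|g ` em h ` pts P| \<le>o |\<Union>P \<in> T. pts P|"
    proof -
      have "|g ` em h ` pts P| \<le>o |pts P|" using card_of_image[of "\<lambda>x. g (em h x)" "pts P"] by (simp add: image_image)
      moreover have "|pts P| \<le>o |\<Union>P \<in> T. pts P|" by (rule card_of_mono1) (use PT in blast)
      ultimately show ?thesis by (rule ordLeq_transitive)
    qed
    ultimately show ?thesis using hull_submodel[OF g X h] by (intro exI[of _ "restr_struc \<tau> N (g ` em h ` pts P)"]) simp
  qed
  ultimately show ?thesis by blast
qed

text \<open>\<open>ex_hull_bound\<close> covers fewer than \<open>\<mu>\<close> elements. A general
  \<open>A\<close> lies in the directed union of the closures of its subsets of size below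
  \<open>\<mu>\<close>, which is a submodel by the chain axioms and is bounded by
  \<open>card_UN_subsets_less_mu\<close>.\<close>

lemma LST_K: "LST_axiom \<mu> \<K>\<^sub>S"
proof -
  obtain Z :: "'u set" where smZ: "small TYPE('u) Z"
    and Z: "\<And>N B. N \<in> models \<K>\<^sub>S \<Longrightarrow> B \<subseteq> Univ N \<Longrightarrow> |B| <o \<mu> \<Longrightarrow> \<exists>M. leq \<K>\<^sub>S M N \<and> B \<subseteq> Univ M \<and> |Univ M| \<le>o |Z|"
    using ex_hull_bound by meson
  obtain \<nu> :: "'u rel" where \<nu>: "Cinfinite \<nu>" "small TYPE('u) (Field \<nu>)" "cpow_less \<nu> \<mu> =o \<nu>"
    "|Z \<union> syms| \<le>o \<nu>" "\<mu> \<le>o \<nu>"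
    using ex_cpow_less_closed[OF small_Un[OF smZ small_syms]] by blast
  have Z\<nu>: "|Z| \<le>o \<nu>" and S\<nu>: "|syms| \<le>o \<nu>"
    using ordLeq_transitive[OF card_of_mono1 \<nu>(4)] by auto
  have "|fun_syms \<tau>| +c |rel_syms \<tau>| +c \<mu> \<le>o \<nu>"
  proof (intro csum_cinfinite_bound)
    show "|fun_syms \<tau>| \<le>o \<nu>" using \<nu>(1) by (simp add: Card_order_empty)
  qed (use \<nu> S\<nu> Cinfinite_mu in \<open>auto simp: card_of_Card_order Card_order_csum\<close>)
  moreover have "\<exists>M. leq \<K>\<^sub>S M N \<and> A \<subseteq> Univ M \<and> |Univ M| \<le>o cpow_less |A| \<mu> +c \<nu>"
    if N: "N \<in> models \<K>\<^sub>S" and A: "A \<subseteq> Univ N" for N A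
  proof -
    let ?A = "{B. B \<subseteq> A \<and> |B| <o \<mu>}"
    \<comment> \<open>The bounded submodels supplied by \<open>Z\<close> come without any
      monotonicity in \<open>B\<close>; the intersections are monotone, which makes the system
      directed.\<close>
    let ?cl = "\<lambda>B. \<Inter>{Univ M' | M'. leq \<K>\<^sub>S M' N \<and> B \<subseteq> Univ M'}"
    have "\<forall>B. \<exists>M. B \<in> ?A \<longrightarrow> leq \<K>\<^sub>S M N \<and> Univ M = ?cl B"
      using intersections_K N A unfolding admits_intersections_def by (metis (no_types, lifting) mem_Collect_eq subset_trans)
    then have "\<exists>M. \<forall>B. B \<in> ?A \<longrightarrow> leq \<K>\<^sub>S (M B) N \<and> Univ (M B) = ?cl B" by (rule choice)
    then obtain M where M': "\<forall>B. B \<in> ?A \<longrightarrow> leq \<K>\<^sub>S (M B) N \<and> Univ (M B) = ?cl B" by (elim exE)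
    note M = M'[rule_format]
    have BM: "B \<subseteq> Univ (M B)" if "B \<in> ?A" for B using M[OF that] by blast
    have "small TYPE('u) A"
      using small_subset[OF _ A] K.models_struc[OF N] by (simp add: is_struc_def)
    from ex_poset_of_subsets_less_mu[OF this] obtain I r d
      where dir: "directed_poset \<mu> I r" and bij: "bij_betw d I ?A"
        and r: "\<And>i j. (i, j) \<in> r \<longleftrightarrow> i \<in> I \<and> j \<in> I \<and> d i \<subseteq> d j" by meson
    have d: "d i \<in> ?A" if "i \<in> I" for i using bij_betwE[OF bij] that by blast
    have "leq \<K>\<^sub>S (M (d i)) (M (d j))" if ij: "(i, j) \<in> r" for i j
    proof -
      have dd: "d i \<in> ?A" "d j \<in> ?A" "d i \<subseteq> d j" using ij d unfolding r by blast+
      have "d i \<subseteq> Univ (M (d j))" using BM[OF dd(2)] dd(3) by blast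
      then have U: "Univ (M (d i)) \<subseteq> Univ (M (d j))"
        unfolding conjunct2[OF M[OF dd(1)]] by (intro Inter_lower CollectI exI[of _ "M (d j)"]) (simp add: M[OF dd(2)])
      have "leq \<K>\<^sub>S (M (d i)) N" "leq \<K>\<^sub>S (M (d j)) N" using M[OF dd(1)] M[OF dd(2)] by simp_all
      then show ?thesis using substruc_within[OF _ _ U, of \<tau> N] by (simp add: leq_K)
    qed
    moreover have "M (d i) \<in> models \<K>\<^sub>S" if "i \<in> I" for i using M[OF d[OF that]] by (simp add: leq_K)
    ultimately have sys: "directed_system \<mu> \<K>\<^sub>S I r (\<lambda>i. M (d i))"
      unfolding directed_system_def using dir by auto
    let ?M = "union_struc \<tau> I (\<lambda>i. M (d i))"
    have leN: "leq \<K>\<^sub>S ?M N"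
      using chain_axioms_K sys N M[OF d] unfolding chain_axioms_def voc_K by blast
    have MU: "Univ ?M = (\<Union>B \<in> ?A. Univ (M B))"
    proof -
      have "(\<Union>B \<in> ?A. Univ (M B)) = (\<Union>i \<in> I. Univ (M (d i)))"
        using bij_betw_imp_surj_on[OF bij] by (metis image_image)
      then show ?thesis by (simp add: union_struc_def)
    qed
    have "|Univ (M B)| \<le>o \<nu>" if B: "B \<subseteq> A" "|B| <o \<mu>" for B
    proof -
      \<comment> \<open>The canonical closure inherits its bound by lying inside the bounded
        submodel.\<close>
      obtain M' where M': "leq \<K>\<^sub>S M' N" "B \<subseteq> Univ M'" "|Univ M'| \<le>o |Z|" using Z[OF N, of B] A B by blast
      have "Univ (M B) = ?cl B" using M B by blast
      also have "\<dots> \<subseteq> Univ M'" by (rule Inter_lower) (use M' in blast)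
      finally show ?thesis
        by (rule ordLeq_transitive[OF card_of_mono1 ordLeq_transitive[OF M'(3) Z\<nu>]])
    qed
    from card_UN_subsets_less_mu[OF \<nu>(1) this]
    have "|Univ ?M| \<le>o cpow_less |A| \<mu> +c \<nu>" unfolding MU .
    moreover have "A \<subseteq> Univ ?M"
    proof
      fix a assume a: "a \<in> A"
      then have "{a} \<in> ?A" by (simp add: finite_less_mu)
      then show "a \<in> Univ ?M" unfolding MU using BM[of "{a}"] by blast
    qed
    ultimately show ?thesis using leN by blast
  qed
  ultimately show ?thesis unfolding LST_axiom_def voc_K using \<nu>(1,2,3) by blast
qed

lemma mu_AEC_K: "mu_AEC \<mu> \<K>\<^sub>S"
  unfolding mu_AEC_def using abstract_class_K coherence_K chain_axioms_K LST_K by blast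

lemma equivalent_K: "equivalent_categories C (class_cat \<K>\<^sub>S)"
proof (rule weak_equivalence_imp_equivalent[OF category K.category_class_cat])
  let ?F = "\<lparr>FOb = St, FArr = (\<lambda>f. (St (Dom C f), em f, St (Cod C f)))\<rparr>"
  \<comment> \<open>The image of an embedding between models is again a model, so the order imposes
    no further condition on embeddings.\<close>
  have emb: "K_embedding \<K>\<^sub>S (St X) (St Y) g \<longleftrightarrow> struc_emb \<tau> (St X) (St Y) g" if "X \<in> Ob C" "Y \<in> Ob C" for X Y g
    unfolding K.K_embedding_iff voc_K using St_models[OF that(1)] St_models[OF that(2)] emb_image_leq by blast
  have arr: "FArr ?F f = (St X, em f, St Y)" if "f \<in> hom C X Y" for f X Y using homD[OF that] by simp
  have hom: "FArr ?F f \<in> hom (class_cat \<K>\<^sub>S) (St X) (St Y)" if f: "f \<in> hom C X Y" for f X Y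
    unfolding arr[OF f] K.hom_class_cat using emb hom_Ob[OF category f] em_emb[OF f] by blast
  show "weak_equivalence C (class_cat \<K>\<^sub>S) ?F"
    unfolding weak_equivalence_def
  proof (intro conjI ballI)
    show "is_functor C (class_cat \<K>\<^sub>S) ?F"
      unfolding is_functor_def
    proof (intro conjI ballI impI)
      show "FOb ?F X \<in> Ob (class_cat \<K>\<^sub>S)" if "X \<in> Ob C" for X using St_models[OF that] by simp
      show "FArr ?F f \<in> hom (class_cat \<K>\<^sub>S) (FOb ?F (Dom C f)) (FOb ?F (Cod C f))" if "f \<in> Arr C" for f
        using hom[OF Arr_hom[OF that]] by simp
      fix X assume X: "X \<in> Ob C"
      note i = Idn_hom[OF category X]
      have "em (Idn C X) = (\<lambda>a \<in> pts X. a)"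
      proof (rule extensionalityI)
        show "em (Idn C X) \<in> extensional (pts X)" using homD(2)[OF i] by (simp add: em_def)
        show "em (Idn C X) a = (\<lambda>a \<in> pts X. a) a" if "a \<in> pts X" for a
          using em_into[OF i that] Idn_Cmp[OF category, of a "Dom C a" X] that by (simp add: pts_iff)
      qed simp
      then show "FArr ?F (Idn C X) = Idn (class_cat \<K>\<^sub>S) (FOb ?F X)" using arr[OF i] by simp
    next
      fix f g assume fg: "f \<in> Arr C" "g \<in> Arr C" "Cod C f = Dom C g"
      have f: "f \<in> hom C (Dom C f) (Dom C g)" and g: "g \<in> hom C (Dom C g) (Cod C g)"
        using fg by (auto simp: hom_def)
      show "FArr ?F (Cmp C g f) = Cmp (class_cat \<K>\<^sub>S) (FArr ?F g) (FArr ?F f)"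
        unfolding arr[OF Cmp_hom[OF category f g]] arr[OF f] arr[OF g] using em_Cmp[OF f g] by simp
    qed
    fix X Y assume X: "X \<in> Ob C" and Y: "Y \<in> Ob C"
    show "bij_betw (FArr ?F) (hom C X Y) (hom (class_cat \<K>\<^sub>S) (FOb ?F X) (FOb ?F Y))"
      unfolding bij_betw_def
    proof (intro conjI equalityI subsetI)
      show "inj_on (FArr ?F) (hom C X Y)"
        by (rule inj_onI) (use arr em_faithful in \<open>auto simp del: ftor.simps\<close>)
      show "x \<in> hom (class_cat \<K>\<^sub>S) (FOb ?F X) (FOb ?F Y)" if "x \<in> FArr ?F ` hom C X Y" for x using that hom by auto
      fix x assume "x \<in> hom (class_cat \<K>\<^sub>S) (FOb ?F X) (FOb ?F Y)"
      then obtain g where g: "x = (St X, g, St Y)" "struc_emb \<tau> (St X) (St Y) g"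
        using emb[OF X Y] unfolding K.hom_class_cat by auto
      obtain f where f: "f \<in> hom C X Y" "em f = g" using em_full[OF X Y g(2)] by blast
      have "x = FArr ?F f" unfolding arr[OF f(1)] using g(1) f(2) by simp
      then show "x \<in> FArr ?F ` hom C X Y" using f(1) by blast
    qed
  next
    fix M assume "M \<in> Ob (class_cat \<K>\<^sub>S)"
    then have M: "M \<in> models \<K>\<^sub>S" by simp
    obtain X g where X: "X \<in> Ob C" and g: "struc_iso \<tau> (St X) M g" using M models_K by blast
    obtain g' where g': "struc_iso \<tau> M (St X) g'" "\<forall>x \<in> pts X. g' (g x) = x" "\<forall>y \<in> Univ M. g (g' y) = y"
      using struc_iso_inv[OF g] by auto
    have "iso_arr (class_cat \<K>\<^sub>S) (St X, g, M)"
    proof (rule iso_arrI[of _ _ "St X" M "(M, g', St X)"])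
      show "(St X, g, M) \<in> hom (class_cat \<K>\<^sub>S) (St X) M" "(M, g', St X) \<in> hom (class_cat \<K>\<^sub>S) M (St X)"
        unfolding K.hom_class_cat using K.K_embedding_iso[OF St_models[OF X]] K.K_embedding_iso[OF M] g g'(1) by auto
      show "Cmp (class_cat \<K>\<^sub>S) (M, g', St X) (St X, g, M) = Idn (class_cat \<K>\<^sub>S) (St X)"
        using g'(2) by (auto simp: compose_def fun_eq_iff)
      show "Cmp (class_cat \<K>\<^sub>S) (St X, g, M) (M, g', St X) = Idn (class_cat \<K>\<^sub>S) M"
        using g'(3) by (auto simp: compose_def fun_eq_iff)
    qed
    moreover have "(St X, g, M) \<in> hom (class_cat \<K>\<^sub>S) (FOb ?F X) M"
      unfolding K.hom_class_cat using K.K_embedding_iso[OF St_models[OF X]] g by auto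
    ultimately show "\<exists>X \<in> Ob C. \<exists>t \<in> hom (class_cat \<K>\<^sub>S) (FOb ?F X) M. iso_arr (class_cat \<K>\<^sub>S) t" using X by blast
  qed
qed

end

theorem theorem5p7:
  fixes \<K> :: "('o, 'u) cat" and \<mu> :: "'u rel"
  assumes "set_universe TYPE('u)"
    and "category \<K>" and "locally_small TYPE('u) \<K>"
    and "regular_cardinal \<mu>"
  shows "locally_polypresentable \<mu> \<K> \<and> (\<forall>f \<in> Arr \<K>. mono_arr \<K> f) \<longleftrightarrow>
    (\<exists>K :: 'u abs_class. mu_AEC \<mu> K \<and> admits_intersections K \<and>
       equivalent_categories \<K> (class_cat K))"
proof -
  interpret sizes \<mu>
    using assms by unfold_locales
  show ?thesis
  proof
    assume lp: "locally_polypresentable \<mu> \<K> \<and> (\<forall>f \<in> Arr \<K>. mono_arr \<K> f)"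
    then obtain S where S: "small TYPE('u) S" "\<forall>X \<in> S. presentable \<mu> \<K> X"
      "\<forall>X \<in> Ob \<K>. \<exists>I r D c. directed_poset \<mu> I r \<and> is_functor (poset_cat I r) \<K> D \<and>
         (\<forall>i \<in> I. FOb D i \<in> S) \<and> is_colimit (poset_cat I r) \<K> D (X, c)"
      unfolding locally_polypresentable_def accessible_def by (elim conjE exE)
    obtain p q :: 'u where "p \<noteq> q" by (rule ex_two_elements)
    then interpret polypresentable_category \<mu> \<K> S p q
      using assms lp S
      by unfold_locales (simp_all add: locally_polypresentable_def accessible_def)
    show "\<exists>K :: 'u abs_class. mu_AEC \<mu> K \<and> admits_intersections K \<and>
        equivalent_categories \<K> (class_cat K)"
      using mu_AEC_K intersections_K equivalent_K by (intro exI conjI)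
  next
    assume "\<exists>K :: 'u abs_class. mu_AEC \<mu> K \<and> admits_intersections K \<and>
      equivalent_categories \<K> (class_cat K)"
    then obtain K :: "'u abs_class" where K: "mu_AEC \<mu> K" "admits_intersections K"
      and eqv: "equivalent_categories \<K> (class_cat K)" by (elim exE conjE)
    interpret aec_intersections \<mu> K
      using K by unfold_locales
    obtain F where "weak_equivalence \<K> (class_cat K) F"
      using equivalent_imp_weak_equivalence[OF assms(2) category_class_cat eqv] by (elim exE)
    then interpret aec_presented_category \<mu> K \<K> F
      using assms(2,3) by unfold_locales
    show "locally_polypresentable \<mu> \<K> \<and> (\<forall>f \<in> Arr \<K>. mono_arr \<K> f)"
      using locally_polypresentable all_mono by blast
  qed
qed


end
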